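(* Suppose $\Omega \subset \mathbb{C}^d$ is a bounded $\mathbb{C}$-convex open set, $\partial \Omega$ is a $C^1$ hypersurface, and $(\Omega, K_{\Omega})$ is Gromov hyperbolic, where $K_\Omega$ is the Kobayashi distance on $\Omega$. If $\Delta = \{z \in \mathbb{C} : |z|<1\}$ is the unit disk, then every holomorphic map $\varphi: \Delta \rightarrow \partial \Omega$ (that is, every holomorphic map $\varphi : \Delta \to \mathbb{C}^d$ with $\varphi(\Delta) \subset \partial\Omega$) is constant.
   Context: An open set $\Omega \subset \mathbb{C}^d$ is called $\mathbb{C}$-convex if its intersection with any complex (affine) line is either empty or contractible. Kobayashi metric and distance: with $\mathrm{Hol}(\Delta,\Omega)$ the set of holomorphic maps $\Delta \to \Omega$, for $x \in \Omega$ and $v \in \mathbb{C}^d$ put $k_{\Omega}(x;v) = \inf \{ |\xi| : f \in \mathrm{Hol}(\Delta, \Omega),\ f(0) = x,\ d(f)_0(\xi) = v \}$. For an absolutely continuous curve $\sigma:[a,b]\to\Omega$ put $\ell_\Omega(\sigma)= \int_a^b k_\Omega(\sigma(t); \sigma'(t))\, dt$. The Kobayashi (pseudo-)distance $K_\Omega(x,y)$ is the infimum of $\ell_\Omega(\sigma)$ over all absolutely continuous curves $\sigma:[a,b]\to\Omega$ with $\sigma(a)=x$ and $\sigma(b)=y$. Gromov hyperbolicity: in a metric space $(X,d)$, a geodesic is a curve $\sigma : I \to X$ ($I\subset\mathbb{R}$ an interval) with $d(\sigma(t_1),\sigma(t_2))=|t_1-t_2|$ for all $t_1,t_2\in I$.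 A geodesic triangle is a choice of three points and geodesic segments connecting them; it is $\delta$-thin if any point on any side is within distance $\delta$ of the union of the other two sides. A proper geodesic metric space is $\delta$-hyperbolic if every geodesic triangle is $\delta$-thin, and Gromov hyperbolic if it is $\delta$-hyperbolic for some $\delta \ge 0$. *)

theory Defs
  imports "HOL-Analysis.Analysis"
begin

section \<open>Complex lines and complex convexity\<close>

definition complex_line :: "(complex^'d) set \<Rightarrow> bool" where
  "complex_line L \<longleftrightarrow> (\<exists>p v. v \<noteq> 0 \<and> L = {p + c *s v | c. c \<in> UNIV})"

text \<open>In the literature this notion is reserved for open sets; openness is not part of the
  predicate and has to be assumed separately.\<close>

definition C_convex :: "(complex^'d) set \<Rightarrow> bool" where
  "C_convex \<Omega> \<longleftrightarrow> (\<forall>L. complex_line L \<longrightarrow> \<Omega> \<inter> L = {} \<or> contractible (\<Omega> \<inter> L))"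


section \<open>Real hypersurfaces of class C1\<close>

text \<open>A subset that is locally the zero set of a real-valued C1 function with nowhere vanishing
  (real) differential, i.e. an embedded C1 submanifold of real codimension one.\<close>

definition C1_hypersurface :: "'a::euclidean_space set \<Rightarrow> bool" where
  "C1_hypersurface S \<longleftrightarrow>
     (\<forall>p\<in>S. \<exists>U (r :: 'a \<Rightarrow> real) (r' :: 'a \<Rightarrow> 'a \<Rightarrow>\<^sub>L real).
        open U \<and> p \<in> U \<and>
        (\<forall>x\<in>U. (r has_derivative blinfun_apply (r' x)) (at x)) \<and>
        continuous_on U r' \<and>
        (\<forall>x\<in>U. r' x \<noteq> 0) \<and>
        S \<inter> U = {x \<in> U. r x = 0})"


section \<open>The Kobayashi metric and distance\<close>

definition holomorphic_map_on :: "(complex \<Rightarrow> complex^'d) \<Rightarrow> complex set \<Rightarrow> bool" where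
  "holomorphic_map_on f S \<longleftrightarrow> (\<forall>i. (\<lambda>z. f z $ i) holomorphic_on S)"

definition Hol_disc :: "(complex^'d) set \<Rightarrow> (complex \<Rightarrow> complex^'d) set" where
  "Hol_disc \<Omega> = {f. holomorphic_map_on f (ball 0 1) \<and> f ` ball 0 1 \<subseteq> \<Omega>}"

text \<open>For open \<open>\<Omega>\<close> and \<open>x \<in> \<Omega>\<close> the set below is nonempty (small affine discs); for \<open>x \<notin> \<Omega>\<close> it is
  empty and the value is irrelevant.\<close>

definition kobayashi_metric :: "(complex^'d) set \<Rightarrow> complex^'d \<Rightarrow> complex^'d \<Rightarrow> real" where
  "kobayashi_metric \<Omega> x v =
     Inf {cmod \<xi> | \<xi> f. f \<in> Hol_disc \<Omega> \<and> f 0 = x \<and> (\<chi> i. deriv (\<lambda>z. f z $ i) 0 * \<xi>) = v}"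

definition absolutely_continuous_on_interval ::
    "real \<Rightarrow> real \<Rightarrow> (real \<Rightarrow> 'a::real_normed_vector) \<Rightarrow> bool" where
  "absolutely_continuous_on_interval a b \<sigma> \<longleftrightarrow>
     (\<forall>\<epsilon>>0. \<exists>\<delta>>0. \<forall>(n::nat) (s :: nat \<Rightarrow> real) (t :: nat \<Rightarrow> real).
        (\<forall>k<n. a \<le> s k \<and> s k \<le> t k \<and> t k \<le> b) \<and>
        disjoint_family_on (\<lambda>k. {s k<..<t k}) {..<n} \<and>
        (\<Sum>k<n. t k - s k) < \<delta>
        \<longrightarrow> (\<Sum>k<n. norm (\<sigma> (t k) - \<sigma> (s k))) < \<epsilon>)"

text \<open>An absolutely continuous curve is differentiable almost everywhere; on the exceptional null
  set the value of \<^const>\<open>vector_derivative\<close> is unspecified, which does not affect the integral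
  with respect to the completed measure \<^const>\<open>lebesgue\<close>.\<close>

definition kobayashi_length ::
    "(complex^'d) set \<Rightarrow> real \<Rightarrow> real \<Rightarrow> (real \<Rightarrow> complex^'d) \<Rightarrow> ennreal" where
  "kobayashi_length \<Omega> a b \<sigma> =
     (\<integral>\<^sup>+ t\<in>{a..b}. ennreal (kobayashi_metric \<Omega> (\<sigma> t)
                              (vector_derivative \<sigma> (at t within {a..b}))) \<partial>lebesgue)"

text \<open>Distances are real-valued, as \<^locale>\<open>Metric_space\<close> requires: \<^const>\<open>enn2real\<close> sends the
  infimum of the empty set to 0. This affects only pairs of points of \<open>\<Omega>\<close> that no curve in \<open>\<Omega>\<close>
  joins, and pairs with a point outside \<open>\<Omega>\<close>.\<close>

definition kobayashi_dist :: "(complex^'d) set \<Rightarrow> complex^'d \<Rightarrow> complex^'d \<Rightarrow> real" where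
  "kobayashi_dist \<Omega> x y =
     enn2real (Inf {kobayashi_length \<Omega> a b \<sigma> | a b \<sigma>.
       a \<le> b \<and> absolutely_continuous_on_interval a b \<sigma> \<and> \<sigma> ` {a..b} \<subseteq> \<Omega> \<and>
       \<sigma> a = x \<and> \<sigma> b = y})"


section \<open>Gromov hyperbolicity\<close>

context Metric_space
begin

definition geodesic :: "real set \<Rightarrow> (real \<Rightarrow> 'a) \<Rightarrow> bool" where
  "geodesic I \<sigma> \<longleftrightarrow> is_interval I \<and> \<sigma> ` I \<subseteq> M \<and>
     (\<forall>t1\<in>I. \<forall>t2\<in>I. d (\<sigma> t1) (\<sigma> t2) = \<bar>t1 - t2\<bar>)"

definition geodesic_segment :: "'a \<Rightarrow> 'a \<Rightarrow> 'a set \<Rightarrow> bool" where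
  "geodesic_segment x y S \<longleftrightarrow>
     (\<exists>a b \<sigma>. a \<le> b \<and> geodesic {a..b} \<sigma> \<and> \<sigma> a = x \<and> \<sigma> b = y \<and> S = \<sigma> ` {a..b})"

definition geodesic_space :: bool where
  "geodesic_space \<longleftrightarrow> (\<forall>x\<in>M. \<forall>y\<in>M. \<exists>S. geodesic_segment x y S)"

definition proper_space :: bool where
  "proper_space \<longleftrightarrow> (\<forall>x\<in>M. \<forall>r. compactin mtopology (mcball x r))"

definition geodesic_triangle :: "'a set \<Rightarrow> 'a set \<Rightarrow> 'a set \<Rightarrow> bool" where
  "geodesic_triangle A B C \<longleftrightarrow>
     (\<exists>x\<in>M. \<exists>y\<in>M. \<exists>z\<in>M.
        geodesic_segment x y A \<and> geodesic_segment y z B \<and> geodesic_segment z x C)"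

definition thin_triangle :: "real \<Rightarrow> 'a set \<Rightarrow> 'a set \<Rightarrow> 'a set \<Rightarrow> bool" where
  "thin_triangle \<delta> A B C \<longleftrightarrow>
     (\<forall>p\<in>A. \<exists>q\<in>B \<union> C. d p q \<le> \<delta>) \<and>
     (\<forall>p\<in>B. \<exists>q\<in>C \<union> A. d p q \<le> \<delta>) \<and>
     (\<forall>p\<in>C. \<exists>q\<in>A \<union> B. d p q \<le> \<delta>)"

definition delta_hyperbolic :: "real \<Rightarrow> bool" where
  "delta_hyperbolic \<delta> \<longleftrightarrow> proper_space \<and> geodesic_space \<and>
     (\<forall>A B C. geodesic_triangle A B C \<longrightarrow> thin_triangle \<delta> A B C)"

end

definition Gromov_hyperbolic :: "'a set \<Rightarrow> ('a \<Rightarrow> 'a \<Rightarrow> real) \<Rightarrow> bool" where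
  "Gromov_hyperbolic M d \<longleftrightarrow>
     Metric_space M d \<and> (\<exists>\<delta>\<ge>0. Metric_space.delta_hyperbolic M d \<delta>)"

end

theory Submission
  imports Defs "HOL-Complex_Analysis.Complex_Analysis"
begin

text \<open>Suppose that \<open>\<phi>\<close> is not constant near \<open>z0\<close>. Put \<open>p = \<phi> z0\<close> and let \<open>\<gamma> s = p + s \<nu>\<close> enter \<open>\<Omega>\<close>
  transversally. Let \<open>Y\<close> be the set of Euclidean limits, as \<open>s\<close> tends to 0, of points at bounded Kobayashi
  distance from \<open>\<gamma> s\<close>. Translates of \<open>\<phi>\<close> by \<open>s \<nu>\<close> show that \<open>Y\<close> contains \<open>\<phi> z\<close> for \<open>z\<close> near \<open>z0\<close>. Two
  properties of \<open>Y\<close> contradict each other.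

  First, \<open>Y\<close> is compact. Transversal segments are quasi-geodesics: balls contained in \<open>\<Omega>\<close> bound the Kobayashi
  distance along them from above, and it is bounded from below because complex tangent hyperplanes
  do not meet the \<open>\<complex>\<close>-convex set \<open>\<Omega>\<close>. If such a segment starts at distance at most \<open>R\<close> from \<open>\<gamma> s\<close>, where \<open>s\<close> is
  small, then by hyperbolicity its points at a fixed depth have a distance from \<open>\<gamma>\<close> that is bounded
  independently of \<open>R\<close>. Hence \<open>Y\<close> is closed.

  Second, no real linear functional that is larger somewhere on \<open>Y\<close> than at \<open>p\<close> attains its supremum \<open>m\<close> on
  \<open>Y\<close>. Holomorphic discs whose centres have bounded distance from \<open>\<gamma> s\<close> asymptotically stay in the half
  space below \<open>m\<close>, so along curves of bounded length ending at \<open>\<gamma> s\<close> the logarithm of the distance to the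
  boundary of that half space varies by a bounded amount.\<close>

section \<open>Absolutely continuous functions\<close>

text \<open>A \<complex>-convex set need not lie in a real half space at a frontier point, so
  distances cannot be compared with those of a half plane there. What remains is an omitted complex
  hyperplane. Its equation has a logarithm that depends only on the value of the functional, and
  Bloch's theorem then bounds the Kobayashi metric from below up to the factor 48; quasi-geodesics
  tolerate any such constant. Compactness of \<open>Y\<close> rests on the order of choices: the
  depth at which a point is picked depends on the desired accuracy and not on \<open>R\<close>, and
  only afterwards is the segment made long enough to absorb \<open>R\<close>. The half space used
  for the second property need not contain \<Omega>. Maximality of \<open>m\<close> makes it contain
  the relevant discs up to an arbitrarily small error, while \<open>p\<close> stays at a fixed depth
  in it; the ratio of the two depths is then too large to be bridged by curves of bounded length.
  Distances are infima over absolutely continuous curves, so infinitesimal lower bounds can be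
  integrated only with differentiability almost everywhere and the fundamental theorem of calculus
  for such curves.\<close>

text \<open>\<open>absolutely_continuous_on_interval\<close> speaks of families indexed by initial
  segments of the naturals, whereas Vitali families and tagged divisions are indexed by pairs and
  sets; a bijection transports the estimate.\<close>

lemma absolutely_continuous_finite_family:
  fixes f :: "real \<Rightarrow> 'a::real_normed_vector"
  assumes "absolutely_continuous_on_interval a b f" "0 < \<epsilon>"
  obtains \<delta> where "0 < \<delta>"
    "\<And>(I::'i set) l u. \<lbrakk>finite I; \<And>i. i \<in> I \<Longrightarrow> a \<le> l i \<and> l i \<le> u i \<and> u i \<le> b;
       disjoint_family_on (\<lambda>i. {l i<..<u i}) I; (\<Sum>i\<in>I. u i - l i) < \<delta>\<rbrakk>
      \<Longrightarrow> (\<Sum>i\<in>I. norm (f (u i) - f (l i))) < \<epsilon>"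
proof -
  obtain \<delta> where "0 < \<delta>" and \<delta>: "\<And>n s t. \<lbrakk>\<forall>k<n. a \<le> s k \<and> s k \<le> t k \<and> t k \<le> b;
       disjoint_family_on (\<lambda>k. {s k<..<t k}) {..<n}; (\<Sum>k<n. t k - s k) < \<delta>\<rbrakk>
       \<Longrightarrow> (\<Sum>k<(n::nat). norm (f (t k) - f (s k))) < \<epsilon>"
    using assms(1)[unfolded absolutely_continuous_on_interval_def, rule_format, OF assms(2)] by blast
  show ?thesis
  proof
    fix I :: "'i set" and l u
    assume I: "finite I" and lu: "\<And>i. i \<in> I \<Longrightarrow> a \<le> l i \<and> l i \<le> u i \<and> u i \<le> b"
      and dis: "disjoint_family_on (\<lambda>i. {l i<..<u i}) I" and sm: "(\<Sum>i\<in>I. u i - l i) < \<delta>"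
    obtain h where h: "bij_betw h {..<card I} I"
      using ex_bij_betw_nat_finite [OF I] by (metis atLeast0LessThan)
    have "(\<Sum>k<card I. norm (f ((u \<circ> h) k) - f ((l \<circ> h) k))) < \<epsilon>"
    proof (rule \<delta>)
      show "\<forall>k<card I. a \<le> (l \<circ> h) k \<and> (l \<circ> h) k \<le> (u \<circ> h) k \<and> (u \<circ> h) k \<le> b"
        using lu bij_betwE [OF h] by auto
      show "disjoint_family_on (\<lambda>k. {(l \<circ> h) k<..<(u \<circ> h) k}) {..<card I}"
        unfolding disjoint_family_on_def
      proof (intro ballI impI)
        fix m n assume "m \<in> {..<card I}" "n \<in> {..<card I}" "m \<noteq> n"
        then have "h m \<in> I" "h n \<in> I" "h m \<noteq> h n"
          using h by (auto simp: bij_betw_def inj_on_def)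
        then show "{(l \<circ> h) m<..<(u \<circ> h) m} \<inter> {(l \<circ> h) n<..<(u \<circ> h) n} = {}"
          using dis unfolding disjoint_family_on_def comp_def by blast
      qed
      show "(\<Sum>k<card I. (u \<circ> h) k - (l \<circ> h) k) < \<delta>"
        using sm sum.reindex_bij_betw [OF h, of "\<lambda>i. u i - l i"] by simp
    qed
    then show "(\<Sum>i\<in>I. norm (f (u i) - f (l i))) < \<epsilon>"
      using sum.reindex_bij_betw [OF h, of "\<lambda>i. norm (f (u i) - f (l i))"] by simp
  qed fact
qed

text \<open>The intervals satisfying \<open>P\<close> form a Vitali cover of \<open>E\<close>, and
  keeping only finitely many of the disjoint intervals loses little measure. Since \<open>E\<close>
  may be non-measurable, what escapes is enclosed in a measurable set \<open>T\<close>.\<close>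

lemma Vitali_finite_intervals:
  fixes E :: "real set" and P :: "real \<Rightarrow> real \<Rightarrow> bool"
  assumes W: "open W" "W \<in> lmeasurable" and EW: "E \<subseteq> W" and "0 < \<eta>"
    and P: "\<And>x d. x \<in> E \<Longrightarrow> 0 < d \<Longrightarrow> \<exists>l u. l \<le> x \<and> x \<le> u \<and> l < u \<and> u - l < d \<and> P l u"
  obtains F :: "(real \<times> real) set" and T
  where "finite F" "\<And>l u. (l,u) \<in> F \<Longrightarrow> l < u \<and> P l u \<and> {l..u} \<subseteq> W"
    "disjoint_family_on (\<lambda>(l,u). {l..u}) F"
    "T \<in> lmeasurable" "measure lebesgue T < \<eta>" "E \<subseteq> T \<union> (\<Union>(l,u)\<in>F. {l..u})"
proof -
  define K where "K = {(l,u). l < u \<and> P l u \<and> {l..u} \<subseteq> W}"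
  define m where "m = (\<lambda>(l,u). (l+u)/2 :: real)"
  define r where "r = (\<lambda>(l,u). (u-l)/2 :: real)"
  have cb: "cball (m i) (r i) = (case i of (l,u) \<Rightarrow> {l..u})" for i
    by (auto simp: m_def r_def cball_eq_atLeastAtMost field_simps split: prod.split)
  obtain C where C: "countable C" "C \<subseteq> K"
     "pairwise (\<lambda>i j. disjnt (cball (m i) (r i)) (cball (m j) (r j))) C"
     "negligible (E - (\<Union>i \<in> C. cball (m i) (r i)))"
  proof (rule Vitali_covering_theorem_cballs [of K r E m])
    show "0 < r i" if "i \<in> K" for i
      using that by (auto simp: K_def r_def)
    fix x d :: real assume x: "x \<in> E" and "0 < d"
    obtain e where "e > 0" and e: "ball x e \<subseteq> W"
      using W(1) EW x by (meson open_contains_ball subsetD)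
    obtain l u where lu: "l \<le> x \<and> x \<le> u \<and> l < u \<and> u - l < min d e \<and> P l u"
      using P [OF x, of "min d e"] \<open>0 < d\<close> \<open>0 < e\<close> by auto
    then have "{l..u} \<subseteq> W"
      using e by (auto simp: subset_iff dist_real_def)
    then have "(l,u) \<in> K" using lu by (auto simp: K_def)
    moreover have "x \<in> cball (m (l,u)) (r (l,u))" using lu by (simp add: cb)
    moreover have "r (l,u) < d" using lu by (auto simp: r_def)
    ultimately show "\<exists>i. i \<in> K \<and> x \<in> cball (m i) (r i) \<and> r i < d" by blast
  qed
  define S where "S = (\<Union>i \<in> C. cball (m i) (r i))"
  have SW: "S \<subseteq> W" using C(2) by (auto simp: S_def cb K_def)
  have S: "S \<in> lmeasurable"
    by (rule fmeasurableI2 [OF W(2) SW])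
       (auto simp: S_def intro!: sets.countable_UN'' C(1))
  \<comment> \<open>Finite unions exhaust the countable one, so continuity of the measure from below
    makes the loss smaller than \<open>\<eta>\<close>.\<close>
  obtain F where F: "finite F" "F \<subseteq> C" "measure lebesgue S - \<eta> < measure lebesgue (\<Union>i\<in>F. cball (m i) (r i))"
  proof (cases "C = {}")
    case True then show ?thesis using that [of "{}"] \<open>0 < \<eta>\<close> by (auto simp: S_def)
  next
    case False
    define c where "c = from_nat_into C"
    have rc: "range c = C" using C(1) False by (simp add: c_def)
    define A where "A n = (\<Union>k\<le>n. cball (m (c k)) (r (c k)))" for n :: nat
    have UA: "(\<Union>n. A n) = S" unfolding A_def S_def rc [symmetric] by auto
    have "(\<lambda>n. measure lebesgue (A n)) \<longlonglongrightarrow> measure lebesgue (\<Union>n. A n)"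
    proof (rule Lim_measure_incseq)
      show "range A \<subseteq> sets lebesgue" by (auto simp: A_def intro!: sets.finite_UN)
      show "incseq A" unfolding A_def incseq_def by (intro allI impI UN_mono) auto
      show "emeasure lebesgue (\<Union> (range A)) \<noteq> \<infinity>" unfolding UA using fmeasurableD2 [OF S] by (metis infinity_ennreal_def)
    qed
    then have "\<forall>\<^sub>F n in sequentially. measure lebesgue S - \<eta> < measure lebesgue (A n)"
      unfolding UA by (rule order_tendstoD(1)) (use \<open>0 < \<eta>\<close> in linarith)
    then obtain n where "measure lebesgue S - \<eta> < measure lebesgue (A n)"
      using eventually_happens'[OF sequentially_bot] by blast
    moreover have "A n = (\<Union>i\<in>c ` {..n}. cball (m i) (r i))" by (simp add: A_def)
    moreover have "c ` {..n} \<subseteq> C" using rc by blast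
    ultimately show ?thesis
      using that [of "c ` {..n}"] by simp
  qed
  define U where "U = (\<Union>i\<in>F. cball (m i) (r i))"
  have US: "U \<subseteq> S" using F(2) by (auto simp: U_def S_def)
  have U: "U \<in> lmeasurable" using F(1) unfolding U_def by (intro fmeasurable.finite_UN) auto
  \<comment> \<open>\<open>S - U\<close> is lost by the truncation; \<open>E - S\<close> is the null
    set left over by Vitali's theorem.\<close>
  define T where "T = (S - U) \<union> (E - S)"
  have neg: "negligible (E - S)" using C(4) by (simp add: S_def)
  have T: "T \<in> lmeasurable"
    unfolding T_def by (intro fmeasurable.Un fmeasurable.Diff negligible_imp_measurable S U neg)
  have "measure lebesgue T \<le> measure lebesgue (S - U) + measure lebesgue (E - S)"
    unfolding T_def by (intro measure_Un_le fmeasurableD fmeasurable.Diff S U negligible_imp_measurable neg)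
  also have "\<dots> = measure lebesgue S - measure lebesgue U"
    using measurable_measure_Diff [OF S fmeasurableD [OF U] US] negligible_imp_measure0 [OF neg] by linarith
  also have "\<dots> < \<eta>" using F(3) by (simp add: U_def)
  finally have mT: "measure lebesgue T < \<eta>" .
  show ?thesis
  proof
    show "finite F" by fact
    show "\<And>l u. (l, u) \<in> F \<Longrightarrow> l < u \<and> P l u \<and> {l..u} \<subseteq> W"
      using F(2) C(2) by (auto simp: K_def)
    show "disjoint_family_on (\<lambda>(l, u). {l..u}) F"
      unfolding disjoint_family_on_def
    proof (intro ballI impI)
      fix i j assume "i \<in> F" "j \<in> F" "i \<noteq> j"
      then have "disjnt (cball (m i) (r i)) (cball (m j) (r j))"
        using C(3) F(2) by (auto simp: pairwise_def)
      then show "(case i of (l,u) \<Rightarrow> {l..u}) \<inter> (case j of (l,u) \<Rightarrow> {l..u}) = {}"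
        by (simp add: cb disjnt_def)
    qed
    show "T \<in> lmeasurable" "measure lebesgue T < \<eta>" by fact+
    show "E \<subseteq> T \<union> (\<Union>(l, u)\<in>F. {l..u})"
    proof -
      have "U = (\<Union>(l, u)\<in>F. {l..u})" unfolding U_def cb ..
      then show ?thesis using US unfolding T_def by auto
    qed
  qed
qed

section \<open>Permanence of absolute continuity under domination and sums\<close>

lemma absolutely_continuous_on_interval_dominated2:
  assumes f: "absolutely_continuous_on_interval a b f" and g: "absolutely_continuous_on_interval a b g"
    and h: "\<And>s t. \<lbrakk>a \<le> s; s \<le> t; t \<le> b\<rbrakk> \<Longrightarrow> norm (h t - h s) \<le> C * (norm (f t - f s) + norm (g t - g s))"
  shows "absolutely_continuous_on_interval a b h"
  unfolding absolutely_continuous_on_interval_def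
proof (intro allI impI)
  fix \<epsilon> :: real assume "\<epsilon> > 0"
  define e where "e = \<epsilon> / (\<bar>C\<bar> + 1) / 2"
  have C: "0 < \<bar>C\<bar> + 1" by simp
  then have "0 < e" using \<open>\<epsilon> > 0\<close> unfolding e_def by (intro divide_pos_pos) auto
  moreover have "(\<bar>C\<bar> + 1) * (e + e) = \<epsilon>"
    unfolding e_def field_sum_of_halves using C by (metis less_irrefl nonzero_mult_div_cancel_left times_divide_eq_right)
  ultimately have e: "0 < e" "(\<bar>C\<bar> + 1) * (e + e) = \<epsilon>" .
  let ?A = "\<lambda>(n::nat) s t \<delta>. (\<forall>k<n. a \<le> s k \<and> s k \<le> t k \<and> t k \<le> b) \<and>
        disjoint_family_on (\<lambda>k. {s k<..<t k}) {..<n} \<and> (\<Sum>k<n. t k - s k) < \<delta>"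
  obtain \<delta>1 where "\<delta>1 > 0" and \<delta>1: "\<And>n s t. ?A n s t \<delta>1 \<Longrightarrow> (\<Sum>k<(n::nat). norm (f (t k) - f (s k))) < e"
    using f[unfolded absolutely_continuous_on_interval_def, rule_format, OF e(1)] by blast
  obtain \<delta>2 where "\<delta>2 > 0" and \<delta>2: "\<And>n s t. ?A n s t \<delta>2 \<Longrightarrow> (\<Sum>k<(n::nat). norm (g (t k) - g (s k))) < e"
    using g[unfolded absolutely_continuous_on_interval_def, rule_format, OF e(1)] by blast
  show "\<exists>\<delta>>0. \<forall>(n::nat) s t. ?A n s t \<delta> \<longrightarrow> (\<Sum>k<n. norm (h (t k) - h (s k))) < \<epsilon>"
  proof (intro exI [of _ "min \<delta>1 \<delta>2"] conjI allI impI)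
    show "0 < min \<delta>1 \<delta>2" using \<open>\<delta>1 > 0\<close> \<open>\<delta>2 > 0\<close> by simp
    fix n :: nat and s t :: "nat \<Rightarrow> real"
    assume A: "?A n s t (min \<delta>1 \<delta>2)"
    let ?F = "\<lambda>k. norm (f (t k) - f (s k)) + norm (g (t k) - g (s k))"
    have "(\<Sum>k<n. norm (h (t k) - h (s k))) \<le> (\<Sum>k<n. (\<bar>C\<bar> + 1) * ?F k)"
    proof (rule sum_mono)
      fix k assume "k \<in> {..<n}"
      then have "norm (h (t k) - h (s k)) \<le> C * ?F k" using A by (intro h) auto
      also have "\<dots> \<le> (\<bar>C\<bar> + 1) * ?F k" by (intro mult_right_mono) auto
      finally show "norm (h (t k) - h (s k)) \<le> (\<bar>C\<bar> + 1) * ?F k" .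
    qed
    also have "\<dots> = (\<bar>C\<bar> + 1) * ((\<Sum>k<n. norm (f (t k) - f (s k))) + (\<Sum>k<n. norm (g (t k) - g (s k))))"
      by (simp only: sum_distrib_left [symmetric] sum.distrib)
    also have "\<dots> < (\<bar>C\<bar> + 1) * (e + e)"
      by (intro mult_strict_left_mono add_strict_mono \<delta>1 \<delta>2) (use A in auto)
    finally show "(\<Sum>k<n. norm (h (t k) - h (s k))) < \<epsilon>" using e(2) by simp
  qed
qed

lemma absolutely_continuous_on_interval_dominated:
  assumes f: "absolutely_continuous_on_interval a b f"
    and "\<And>s t. \<lbrakk>a \<le> s; s \<le> t; t \<le> b\<rbrakk> \<Longrightarrow> norm (g t - g s) \<le> C * norm (f t - f s)"
  shows "absolutely_continuous_on_interval a b g"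
  by (rule absolutely_continuous_on_interval_dominated2 [OF f f, of _ "C / 2"]) (use assms(2) in simp)

lemma absolutely_continuous_on_interval_lipschitz:
  assumes "\<And>s t. \<lbrakk>a \<le> s; s \<le> t; t \<le> b\<rbrakk> \<Longrightarrow> norm (f t - f s) \<le> C * (t - s)"
  shows "absolutely_continuous_on_interval a b f"
proof (rule absolutely_continuous_on_interval_dominated)
  show "absolutely_continuous_on_interval a b (\<lambda>t. t)"
    unfolding absolutely_continuous_on_interval_def
  proof (intro allI impI)
    fix \<epsilon> :: real assume "\<epsilon> > 0"
    have "(\<Sum>k<n. norm (t k - s k)) = (\<Sum>k<n. t k - s k)"
      if "\<forall>k<n. a \<le> s k \<and> s k \<le> t k \<and> t k \<le> b" for n :: nat and s t :: "nat \<Rightarrow> real"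
      using that by (intro sum.cong) auto
    then show "\<exists>\<delta>>0. \<forall>(n::nat) s t. (\<forall>k<n. a \<le> s k \<and> s k \<le> t k \<and> t k \<le> b) \<and>
        disjoint_family_on (\<lambda>k. {s k<..<t k}) {..<n} \<and> (\<Sum>k<n. t k - s k) < \<delta> \<longrightarrow>
        (\<Sum>k<n. norm (t k - s k)) < \<epsilon>"
      using \<open>\<epsilon> > 0\<close> by (intro exI [of _ \<epsilon>]) auto
  qed
qed (use assms in simp)

lemma absolutely_continuous_on_interval_add:
  assumes "absolutely_continuous_on_interval a b f" "absolutely_continuous_on_interval a b g"
  shows "absolutely_continuous_on_interval a b (\<lambda>x. f x + g x)"
proof (rule absolutely_continuous_on_interval_dominated2 [OF assms])
  fix s t
  show "norm (f t + g t - (f s + g s)) \<le> 1 * (norm (f t - f s) + norm (g t - g s))"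
    using norm_triangle_ineq [of "f t - f s" "g t - g s"] by (simp add: add_diff_add)
qed

section \<open>Differentiability almost everywhere\<close>

text \<open>Extending \<open>F\<close> to a division of \<open>{A..B}\<close> makes lengths and
  increments of \<open>h\<close> telescope; \<open>R\<close> consists of the gaps between the
  intervals of \<open>F\<close>. Absolute continuity will be applied to such gaps, which are short
  in total.\<close>

lemma sum_interval_increments_extend:
  fixes h :: "real \<Rightarrow> real" and F :: "(real \<times> real) set"
  assumes "finite F" and F: "\<And>l u. (l,u) \<in> F \<Longrightarrow> l < u \<and> {l..u} \<subseteq> {A..B}"
    and dis: "disjoint_family_on (\<lambda>(l,u). {l..u}) F" and "A \<le> B"
  obtains R :: "real set set" where "finite R"
    "\<And>K. K \<in> R \<Longrightarrow> A \<le> Inf K \<and> Inf K \<le> Sup K \<and> Sup K \<le> B"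
    "disjoint_family_on (\<lambda>K. {Inf K<..<Sup K}) R"
    "(\<Sum>K\<in>R. Sup K - Inf K) = B - A - (\<Sum>(l,u)\<in>F. u - l)"
    "(\<Sum>K\<in>R. h (Sup K) - h (Inf K)) = h B - h A - (\<Sum>(l,u)\<in>F. h u - h l)"
proof -
  define p where "p = (\<lambda>(l,u). {l..u::real}) ` F"
  have inj: "inj_on (\<lambda>(l,u). {l..u::real}) F"
  proof (rule inj_onI)
    fix x y :: "real \<times> real"
    assume "x \<in> F" "y \<in> F" "(case x of (l,u) \<Rightarrow> {l..u}) = (case y of (l,u) \<Rightarrow> {l..u})"
    then show "x = y" using F [of "fst x" "snd x"] F [of "fst y" "snd y"]
      by (cases x; cases y) (auto simp: Icc_eq_Icc)
  qed
  have pd: "p division_of \<Union>p"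
    unfolding division_of_def
  proof (intro conjI ballI impI)
    show "finite p" using \<open>finite F\<close> by (simp add: p_def)
    show "K \<subseteq> \<Union>p" if "K \<in> p" for K using that by auto
    show "K \<noteq> {}" if K: "K \<in> p" for K
    proof -
      obtain l u where lu: "(l,u) \<in> F" "K = {l..u}" using K by (auto simp: p_def)
      then show ?thesis using F [OF lu(1)] by simp
    qed
    show "\<exists>a b. K = cbox a b" if K: "K \<in> p" for K
    proof -
      obtain l u where "K = {l..u}" using K by (auto simp: p_def)
      then show ?thesis by (metis box_real(2))
    qed
    show "interior K \<inter> interior L = {}" if KL: "K \<in> p" "L \<in> p" "K \<noteq> L" for K L
    proof -
      obtain i j where ij: "i \<in> F" "j \<in> F" "K = (case i of (l,u) \<Rightarrow> {l..u})" "L = (case j of (l,u) \<Rightarrow> {l..u})"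
        using KL(1,2) unfolding p_def by (elim imageE)
      then have "i \<noteq> j" using KL(3) by metis
      then have "K \<inter> L = {}" unfolding ij(3,4) by (rule disjoint_family_onD [OF dis ij(1,2)])
      then show ?thesis using interior_subset [of K] interior_subset [of L] by blast
    qed
  qed (rule refl)
  have "\<Union>p \<subseteq> cbox A B"
  proof
    fix x assume "x \<in> \<Union>p"
    then obtain l u where lu: "(l,u) \<in> F" "x \<in> {l..u}" by (auto simp: p_def)
    then show "x \<in> cbox A B" using F [OF lu(1)] by auto
  qed
  then obtain q where pq: "p \<subseteq> q" and q: "q division_of cbox A B"
    using partial_division_extend_interval [OF pd] by metis
  have K: "\<exists>l u. K = {l..u} \<and> l \<le> u \<and> A \<le> l \<and> u \<le> B" if Kq: "K \<in> q" for K
  proof -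
    obtain l u where "K = cbox l u" "K \<noteq> {}" "K \<subseteq> cbox A B"
      using division_ofD(2-4) [OF q Kq] by blast
    then have "K = {l..u} \<and> l \<le> u \<and> A \<le> l \<and> u \<le> B" by auto
    then show ?thesis by blast
  qed
  have IS: "A \<le> Inf K \<and> Inf K \<le> Sup K \<and> Sup K \<le> B \<and> K = {Inf K..Sup K}" if "K \<in> q" for K
  proof -
    have "\<exists>l u. K = {l..u} \<and> l \<le> u \<and> A \<le> l \<and> u \<le> B" using K [OF that] .
    then show ?thesis by (elim exE conjE) simp
  qed
  \<comment> \<open>Telescoping is applied in its version for tagged divisions; the left end points
    are arbitrary tags.\<close>
  define tq where "tq = (\<lambda>K. (Inf K, K)) ` q"
  have fin: "finite q" using q by blast
  have "tq tagged_division_of cbox A B"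
  proof (rule tagged_division_ofI)
    show "finite tq" using fin by (simp add: tq_def)
    fix x K assume "(x,K) \<in> tq"
    then have K': "K \<in> q" "x = Inf K" by (auto simp: tq_def)
    then show "x \<in> K" using IS by (metis atLeastAtMost_iff order_refl)
    show "K \<subseteq> cbox A B" using division_ofD(2) [OF q] K' by blast
    show "\<exists>a b. K = cbox a b" using division_ofD(4) [OF q] K' by blast
    fix y L assume "(y,L) \<in> tq" "(x,K) \<noteq> (y,L)"
    then have "L \<in> q" "K \<noteq> L" using K' by (auto simp: tq_def)
    then show "interior K \<inter> interior L = {}" using division_ofD(5) [OF q] K' by blast
  next
    show "\<Union>{K. \<exists>x. (x, K) \<in> tq} = cbox A B"
    proof -
      have "{K. \<exists>x. (x, K) \<in> tq} = q" by (auto simp: tq_def image_iff)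
      then show ?thesis using division_ofD(6) [OF q] by simp
    qed
  qed
  then have tq: "(\<Sum>(x,K)\<in>tq. g (Sup K) - g (Inf K)) = g B - g A" for g :: "real \<Rightarrow> real"
    using additive_tagged_division_1 [OF \<open>A \<le> B\<close>, of tq g] by simp
  have qs: "(\<Sum>K\<in>q. g (Sup K) - g (Inf K)) = g B - g A" for g :: "real \<Rightarrow> real"
    using tq [of g] unfolding tq_def by (subst (asm) sum.reindex) (auto simp: inj_on_def)
  have ps: "(\<Sum>K\<in>p. g (Sup K) - g (Inf K)) = (\<Sum>(l,u)\<in>F. g u - g l)" for g :: "real \<Rightarrow> real"
    unfolding p_def by (subst sum.reindex [OF inj]) (auto intro!: sum.cong dest: less_imp_le [OF conjunct1 [OF F]])
  have rs: "(\<Sum>K\<in>q - p. g (Sup K) - g (Inf K)) = g B - g A - (\<Sum>(l,u)\<in>F. g u - g l)" for g :: "real \<Rightarrow> real"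
    using sum_diff [OF fin pq, of "\<lambda>K. g (Sup K) - g (Inf K)"] qs ps by simp
  show ?thesis
  proof
    show "finite (q - p)" using fin by simp
    show "\<And>K. K \<in> q - p \<Longrightarrow> A \<le> Inf K \<and> Inf K \<le> Sup K \<and> Sup K \<le> B" using IS by blast
    show "disjoint_family_on (\<lambda>K. {Inf K<..<Sup K}) (q - p)"
      unfolding disjoint_family_on_def
    proof (intro ballI impI)
      fix K L assume KL: "K \<in> q - p" "L \<in> q - p" "K \<noteq> L"
      then have "interior K \<inter> interior L = {}" using division_ofD(5) [OF q] by blast
      moreover have "interior K = {Inf K<..<Sup K}" "interior L = {Inf L<..<Sup L}"
        using KL IS by (metis DiffD1 interior_atLeastAtMost_real)+
      ultimately show "{Inf K<..<Sup K} \<inter> {Inf L<..<Sup L} = {}" by simp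
    qed
    show "(\<Sum>K\<in>q - p. Sup K - Inf K) = B - A - (\<Sum>(l,u)\<in>F. u - l)" using rs [of "\<lambda>x. x"] by simp
    show "(\<Sum>K\<in>q - p. h (Sup K) - h (Inf K)) = h B - h A - (\<Sum>(l,u)\<in>F. h u - h l)" by (rule rs)
  qed
qed

lemma measure_disjoint_intervals:
  fixes F :: "(real \<times> real) set"
  assumes "finite F" "\<And>l u. (l,u) \<in> F \<Longrightarrow> l \<le> u" "disjoint_family_on (\<lambda>(l,u). {l..u}) F"
  shows "(\<Union>(l,u)\<in>F. {l..u}) \<in> lmeasurable"
    "measure lebesgue (\<Union>(l,u)\<in>F. {l..u}) = (\<Sum>(l,u)\<in>F. u - l)"
proof -
  show "(\<Union>(l,u)\<in>F. {l..u}) \<in> lmeasurable"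
    using assms(1) by (intro fmeasurable.finite_UN) auto
  have "measure lebesgue (\<Union>(l,u)\<in>F. {l..u}) = (\<Sum>i\<in>F. measure lebesgue (case i of (l,u) \<Rightarrow> {l..u}))"
    by (rule measure_finite_Union) (use assms in \<open>auto simp: split: prod.split\<close>)
  also have "\<dots> = (\<Sum>(l,u)\<in>F. u - l)"
    using assms(2) by (intro sum.cong) auto
  finally show "measure lebesgue (\<Union>(l,u)\<in>F. {l..u}) = (\<Sum>(l,u)\<in>F. u - l)" .
qed

text \<open>Cover \<open>E\<close> by disjoint intervals with slopes at least \<open>c\<close> and then, inside these, by disjoint intervals
  with slopes at most \<open>- c\<close>. Both families have nearly the same total length, so absolute continuity
  makes their total increments nearly equal, although these have opposite signs.\<close>

lemma negligible_opposite_increments: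
  fixes h :: "real \<Rightarrow> real"
  assumes ac: "absolutely_continuous_on_interval a b h" and "0 < c" and Eab: "E \<subseteq> {a<..<b}"
    and up: "\<And>x d. x \<in> E \<Longrightarrow> 0 < d \<Longrightarrow> \<exists>l u. l \<le> x \<and> x \<le> u \<and> l < u \<and> u - l < d \<and> h u - h l \<ge> c * (u - l)"
    and dn: "\<And>x d. x \<in> E \<Longrightarrow> 0 < d \<Longrightarrow> \<exists>l u. l \<le> x \<and> x \<le> u \<and> l < u \<and> u - l < d \<and> h u - h l \<le> - c * (u - l)"
  shows "negligible E"
proof (rule ccontr)
  assume "\<not> negligible E"
  then obtain e where "0 < e" and e: "\<And>T. E \<subseteq> T \<Longrightarrow> T \<in> lmeasurable \<Longrightarrow> e \<le> measure lebesgue T"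
    unfolding negligible_outer by (metis not_less)
  \<comment> \<open>\<open>m\<close> is the outer measure of \<open>E\<close>, which need not be
    measurable.\<close>
  define M where "M = {measure lebesgue T |T. E \<subseteq> T \<and> T \<in> lmeasurable}"
  define m where "m = Inf M"
  have bdd: "bdd_below M" unfolding M_def by (rule bdd_belowI [of _ e]) (use e in auto)
  have ne: "M \<noteq> {}"
    unfolding M_def using Eab by (auto intro!: exI [of _ "{a<..<b}"])
  have m: "m \<le> measure lebesgue T" if "E \<subseteq> T" "T \<in> lmeasurable" for T
    unfolding m_def by (rule cInf_lower [OF _ bdd]) (use that in \<open>auto simp: M_def\<close>)
  have "e \<le> m" unfolding m_def by (rule cInf_greatest [OF ne]) (use e in \<open>auto simp: M_def\<close>)
  then have "m > 0" using \<open>0 < e\<close> by linarith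
  obtain \<delta> where "0 < \<delta>" and \<delta>: "\<And>(I::((real \<times> real) \<times> real set) set) l u.
       \<lbrakk>finite I; \<And>i. i \<in> I \<Longrightarrow> a \<le> l i \<and> l i \<le> u i \<and> u i \<le> b;
       disjoint_family_on (\<lambda>i. {l i<..<u i}) I; (\<Sum>i\<in>I. u i - l i) < \<delta>\<rbrakk>
      \<Longrightarrow> (\<Sum>i\<in>I. norm (h (u i) - h (l i))) < c * m / 2"
    by (rule absolutely_continuous_finite_family [OF ac half_gt_zero [OF mult_pos_pos [OF \<open>0 < c\<close> \<open>0 < m\<close>]]])
       (erule that, blast)
  \<comment> \<open>The gaps will have total length below \<open>3 * \<eta>\<close>, hence below
    \<open>\<delta>\<close>, while \<open>S1 + S2\<close> exceeds \<open>2 * m - 3 * \<eta>\<close>,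
    hence \<open>m / 2\<close>.\<close>
  define \<eta> where "\<eta> = min (m/12) (\<delta>/4)"
  have \<eta>: "0 < \<eta>" "\<eta> \<le> m/12" "\<eta> \<le> \<delta>/4" using \<open>0 < m\<close> \<open>0 < \<delta>\<close> by (auto simp: \<eta>_def)
  have "\<exists>x\<in>M. x < m + \<eta>"
    using cInf_lessD [OF ne, of "m + \<eta>"] \<eta>(1) by (simp add: m_def)
  then obtain T0 where T0: "E \<subseteq> T0" "T0 \<in> lmeasurable" "measure lebesgue T0 < m + \<eta>"
    by (auto simp: M_def)
  define \<rho> where "\<rho> = m + \<eta> - measure lebesgue T0"
  have "\<rho> > 0" using T0(3) by (simp add: \<rho>_def)
  obtain U where U: "open U" "T0 \<subseteq> U" "U - T0 \<in> lmeasurable" "emeasure lebesgue (U - T0) < ennreal \<rho>"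
    by (rule sets_lebesgue_outer_open [OF fmeasurableD [OF T0(2)] \<open>\<rho> > 0\<close>])
  have UT: "U = T0 \<union> (U - T0)" using U(2) by blast
  have Um: "U \<in> lmeasurable" by (subst UT) (intro fmeasurable.Un T0(2) U(3))
  have "measure lebesgue (U - T0) < \<rho>"
    using U(4) \<open>\<rho> > 0\<close> by (simp add: emeasure_eq_measure2 [OF U(3)] ennreal_less_iff)
  moreover have "measure lebesgue U \<le> measure lebesgue T0 + measure lebesgue (U - T0)"
    by (subst UT) (intro measure_Un_le fmeasurableD T0(2) U(3))
  ultimately have mU: "measure lebesgue U < m + \<eta>" by (simp add: \<rho>_def)
  define W where "W = U \<inter> {a<..<b}"
  have W: "open W" "W \<in> lmeasurable" "E \<subseteq> W" "W \<subseteq> {a<..<b}"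
    using U Um T0 Eab by (auto simp: W_def)
  have mW: "measure lebesgue W < m + \<eta>"
    using measure_mono_fmeasurable [of W U lebesgue] mU Um W(2) by (auto simp: W_def)
  obtain F1 T1 where F1: "finite F1"
      "\<And>l u. (l,u) \<in> F1 \<Longrightarrow> l < u \<and> h u - h l \<ge> c * (u - l) \<and> {l..u} \<subseteq> W"
      "disjoint_family_on (\<lambda>(l,u). {l..u}) F1"
      "T1 \<in> lmeasurable" "measure lebesgue T1 < \<eta>" "E \<subseteq> T1 \<union> (\<Union>(l,u)\<in>F1. {l..u})"
    by (rule Vitali_finite_intervals [where P = "\<lambda>l u. h u - h l \<ge> c * (u - l)", OF W(1-3) \<eta>(1)])
       (use up in blast)+
  \<comment> \<open>Open intervals, so that each interval of the second family lies inside a single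
    one of the first; only the end points collected in \<open>Z\<close> are lost.\<close>
  define W2 where "W2 = (\<Union>(l,u)\<in>F1. {l<..<u})"
  have W2: "open W2" "W2 \<in> lmeasurable"
    unfolding W2_def using F1(1) by (auto intro!: fmeasurable.finite_UN split: prod.split)
  obtain F2 T2 where F2: "finite F2"
      "\<And>l u. (l,u) \<in> F2 \<Longrightarrow> l < u \<and> h u - h l \<le> - c * (u - l) \<and> {l..u} \<subseteq> W2"
      "disjoint_family_on (\<lambda>(l,u). {l..u}) F2"
      "T2 \<in> lmeasurable" "measure lebesgue T2 < \<eta>" "E \<inter> W2 \<subseteq> T2 \<union> (\<Union>(l,u)\<in>F2. {l..u})"
    by (rule Vitali_finite_intervals [where P = "\<lambda>l u. h u - h l \<le> - c * (u - l)" and E = "E \<inter> W2", OF W2 _ \<eta>(1)])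
       (use dn in blast)+
  have F1': "l < u" "c * (u - l) \<le> h u - h l" "{l..u} \<subseteq> W" "a \<le> l" "u \<le> b" if "(l,u) \<in> F1" for l u
  proof -
    show 1: "l < u" "c * (u - l) \<le> h u - h l" "{l..u} \<subseteq> W" using F1(2) [OF that] by auto
    then have "l \<in> W" "u \<in> W" by auto
    then show "a \<le> l" "u \<le> b" using W(4) by auto
  qed
  have F2': "l < u" "h u - h l \<le> - c * (u - l)" if "(l,u) \<in> F2" for l u
    using F2(2) [OF that] by auto
  define S1 where "S1 = (\<Sum>(l,u)\<in>F1. u - l)"
  define S2 where "S2 = (\<Sum>(l,u)\<in>F2. u - l)"
  have le1: "l \<le> u" if "(l,u) \<in> F1" for l u using F1'(1) [OF that] by simp
  have le2: "l \<le> u" if "(l,u) \<in> F2" for l u using F2'(1) [OF that] by simp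
  have m1: "(\<Union>(l,u)\<in>F1. {l..u}) \<in> lmeasurable" "measure lebesgue (\<Union>(l,u)\<in>F1. {l..u}) = S1"
    unfolding S1_def
    using measure_disjoint_intervals [OF F1(1) le1 F1(3)] by auto
  have m2: "(\<Union>(l,u)\<in>F2. {l..u}) \<in> lmeasurable" "measure lebesgue (\<Union>(l,u)\<in>F2. {l..u}) = S2"
    unfolding S2_def
    using measure_disjoint_intervals [OF F2(1) le2 F2(3)] by auto
  have "(\<Union>(l,u)\<in>F1. {l..u}) \<subseteq> W" using F1'(3) by blast
  then have "S1 \<le> measure lebesgue W"
    unfolding m1(2)[symmetric] by (rule measure_mono_fmeasurable [OF _ fmeasurableD [OF m1(1)] W(2)])
  then have S1u: "S1 < m + \<eta>" using mW by linarith
  have "m \<le> measure lebesgue (T1 \<union> (\<Union>(l,u)\<in>F1. {l..u}))"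
    by (rule m [OF F1(6)]) (intro fmeasurable.Un F1(4) m1(1))
  also have "\<dots> \<le> measure lebesgue T1 + measure lebesgue (\<Union>(l,u)\<in>F1. {l..u})"
    by (intro measure_Un_le fmeasurableD F1(4) m1(1))
  also have "\<dots> < \<eta> + S1" using F1(5) by (simp add: m1(2))
  finally have S1l: "m - \<eta> < S1" by linarith
  define Z where "Z = fst ` F1 \<union> snd ` F1"
  have Z: "Z \<in> lmeasurable" "measure lebesgue Z = 0"
    using F1(1) by (auto simp: Z_def intro!: negligible_imp_measurable negligible_imp_measure0 negligible_finite)
  have "E \<subseteq> T1 \<union> (T2 \<union> (Z \<union> (\<Union>(l,u)\<in>F2. {l..u})))"
  proof
    fix x assume x: "x \<in> E"
    show "x \<in> T1 \<union> (T2 \<union> (Z \<union> (\<Union>(l,u)\<in>F2. {l..u})))"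
    proof (cases "x \<in> T1 \<or> x \<in> Z")
      case False
      then obtain l u where lu: "(l,u) \<in> F1" "x \<in> {l..u}" using F1(6) x by auto
      have "l \<in> Z" "u \<in> Z" using lu(1) unfolding Z_def by force+
      then have "x \<in> {l<..<u}" using False lu(2) by (metis atLeastAtMost_iff greaterThanLessThan_iff order_le_less)
      then have "x \<in> W2" unfolding W2_def by (intro UN_I [OF lu(1)]) simp
      then show ?thesis using F2(6) x by blast
    qed blast
  qed
  then have "m \<le> measure lebesgue (T1 \<union> (T2 \<union> (Z \<union> (\<Union>(l,u)\<in>F2. {l..u}))))"
    by (rule m) (intro fmeasurable.Un F1(4) F2(4) Z(1) m2(1))
  also have "\<dots> \<le> measure lebesgue T1 + measure lebesgue (T2 \<union> (Z \<union> (\<Union>(l,u)\<in>F2. {l..u})))"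
    by (intro measure_Un_le fmeasurableD fmeasurable.Un F1(4) F2(4) Z(1) m2(1))
  also have "measure lebesgue (T2 \<union> (Z \<union> (\<Union>(l,u)\<in>F2. {l..u}))) \<le> measure lebesgue T2 + measure lebesgue (Z \<union> (\<Union>(l,u)\<in>F2. {l..u}))"
    by (intro measure_Un_le fmeasurableD fmeasurable.Un F1(4) F2(4) Z(1) m2(1))
  also have "measure lebesgue (Z \<union> (\<Union>(l,u)\<in>F2. {l..u})) \<le> measure lebesgue Z + measure lebesgue (\<Union>(l,u)\<in>F2. {l..u})"
    by (intro measure_Un_le fmeasurableD fmeasurable.Un F1(4) F2(4) Z(1) m2(1))
  finally have S2l: "m - 2 * \<eta> < S2"
    using F1(5) F2(5) Z(2) unfolding m2(2) by linarith

  define G where "G = (\<lambda>(l,u). {(l',u') \<in> F2. {l'..u'} \<subseteq> {l<..<u::real}})"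
  have F2G: "F2 = (\<Union>I\<in>F1. G I)"
  proof (intro set_eqI iffI)
    fix I assume I: "I \<in> F2"
    obtain l u where lu: "I = (l,u)" by force
    have lu2: "l < u" "{l..u} \<subseteq> W2" using F2(2) I lu by auto
    then have "l \<in> W2" by auto
    then obtain L U where LU: "(L,U) \<in> F1" "L < l" "l < U" by (auto simp: W2_def)
    \<comment> \<open>The end point \<open>U\<close> belongs to no open interval of
      \<open>F1\<close>, so an interval contained in \<open>W2\<close> cannot cross it.\<close>
    have "u < U"
    proof (rule ccontr)
      assume "\<not> u < U"
      then have "U \<in> W2" using LU lu2 by (intro subsetD [OF lu2(2)]) auto
      then obtain L' U' where LU': "(L',U') \<in> F1" "L' < U" "U < U'" by (auto simp: W2_def)
      then have "U \<in> {L..U} \<inter> {L'..U'}" using F1'(1) [OF LU(1)] by auto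
      moreover have "(L,U) \<noteq> (L',U')" using LU' by auto
      ultimately show False using F1(3) LU(1) LU'(1) unfolding disjoint_family_on_def by fastforce
    qed
    then have "I \<in> G (L,U)" using I lu LU by (auto simp: G_def)
    then show "I \<in> (\<Union>I\<in>F1. G I)" using LU(1) by blast
  qed (auto simp: G_def)
  have Gdis: "G I \<inter> G J = {}" if "I \<in> F1" "J \<in> F1" "I \<noteq> J" for I J
  proof (rule ccontr)
    assume "G I \<inter> G J \<noteq> {}"
    then obtain l u where lu: "(l,u) \<in> G I" "(l,u) \<in> G J" by auto
    obtain L U L' U' where IJ: "I = (L,U)" "J = (L',U')" by force
    have "l < u" using lu F2'(1) by (auto simp: G_def split: prod.splits)
    moreover have "{l..u} \<subseteq> {L<..<U}" "{l..u} \<subseteq> {L'<..<U'}" using lu IJ by (simp_all add: G_def)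
    ultimately have "l \<in> {L<..<U}" "l \<in> {L'<..<U'}" by (simp_all add: subset_iff)
    then have "l \<in> {L..U} \<inter> {L'..U'}" by simp
    then show False using F1(3) that IJ unfolding disjoint_family_on_def by fastforce
  qed
  have finG: "finite (G I)" for I using F2(1) by (rule rev_finite_subset) (auto simp: G_def)
  have sumG: "(\<Sum>I\<in>F2. g I) = (\<Sum>I\<in>F1. \<Sum>J\<in>G I. g J)" for g :: "real \<times> real \<Rightarrow> real"
    unfolding F2G by (rule sum.UNION_disjoint) (use F1(1) finG Gdis in auto)
  define good where "good I R \<longleftrightarrow> finite R \<and>
    (\<forall>K\<in>R. fst I \<le> Inf K \<and> Inf K \<le> Sup K \<and> Sup K \<le> snd I) \<and>
    disjoint_family_on (\<lambda>K. {Inf K<..<Sup K}) R \<and>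
    (\<Sum>K\<in>R. Sup K - Inf K) = snd I - fst I - (\<Sum>(l,u)\<in>G I. u - l) \<and>
    (\<Sum>K\<in>R. h (Sup K) - h (Inf K)) = h (snd I) - h (fst I) - (\<Sum>(l,u)\<in>G I. h u - h l)" for I and R :: "real set set"
  have "\<exists>R. good I R"
    if "I \<in> F1" for I
  proof -
    obtain l u where I: "I = (l,u)" by force
    show ?thesis unfolding good_def
    proof (rule sum_interval_increments_extend [of "G I" l u h])
      show "finite (G I)" by (rule finG)
      show "l' < u' \<and> {l'..u'} \<subseteq> {l..u}" if "(l',u') \<in> G I" for l' u'
      proof -
        have lu: "(l',u') \<in> F2" "{l'..u'} \<subseteq> {l<..<u}" using that I by (simp_all add: G_def)
        have "{l<..<u} \<subseteq> {l..u}" by auto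
        then show ?thesis using F2'(1) [OF lu(1)] lu(2) by (metis order_trans)
      qed
      show "disjoint_family_on (\<lambda>(l,u). {l..u}) (G I)"
        by (rule disjoint_family_on_mono [OF _ F2(3)]) (auto simp: G_def)
      show "l \<le> u" using F1'(1) that I by force
    qed (use I in auto)
  qed
  then obtain R where "\<And>I. I \<in> F1 \<Longrightarrow> good I (R I)" by metis
  then have R: "finite (R I)"
    "K \<in> R I \<Longrightarrow> fst I \<le> Inf K \<and> Inf K \<le> Sup K \<and> Sup K \<le> snd I"
    "disjoint_family_on (\<lambda>K. {Inf K<..<Sup K}) (R I)"
    "(\<Sum>K\<in>R I. Sup K - Inf K) = snd I - fst I - (\<Sum>(l,u)\<in>G I. u - l)"
    "(\<Sum>K\<in>R I. h (Sup K) - h (Inf K)) = h (snd I) - h (fst I) - (\<Sum>(l,u)\<in>G I. h u - h l)"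
    if "I \<in> F1" for I K
    using that unfolding good_def by blast+
  \<comment> \<open>The gaps left by the second family inside the first. Their total length
    \<open>S1 - S2\<close> is small, but their total increment is at least
    \<open>c * (S1 + S2)\<close>, because the increments that were removed are negative.\<close>
  define Q where "Q = Sigma F1 R"
  have finQ: "finite Q" unfolding Q_def by (rule finite_SigmaI [OF F1(1) R(1)])
  have sumQ: "(\<Sum>i\<in>Q. g (snd i)) = (\<Sum>I\<in>F1. \<Sum>K\<in>R I. g K)" for g :: "real set \<Rightarrow> real"
    unfolding Q_def by (subst sum.Sigma) (use F1(1) R(1) in \<open>auto intro!: sum.cong\<close>)
  have len: "(\<Sum>i\<in>Q. Sup (snd i) - Inf (snd i)) = S1 - S2"
  proof -
    have "(\<Sum>i\<in>Q. Sup (snd i) - Inf (snd i)) = (\<Sum>I\<in>F1. (snd I - fst I) - (\<Sum>(l,u)\<in>G I. u - l))"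
      unfolding sumQ [of "\<lambda>K. Sup K - Inf K"] by (rule sum.cong [OF refl R(4)])
    also have "\<dots> = (\<Sum>I\<in>F1. snd I - fst I) - (\<Sum>I\<in>F1. \<Sum>(l,u)\<in>G I. u - l)" by (rule sum_subtractf)
    finally show ?thesis unfolding S1_def S2_def sumG [of "\<lambda>(l,u). u - l"] by (simp only: case_prod_unfold)
  qed
  have inc: "(\<Sum>i\<in>Q. h (Sup (snd i)) - h (Inf (snd i))) = (\<Sum>(l,u)\<in>F1. h u - h l) - (\<Sum>(l,u)\<in>F2. h u - h l)"
  proof -
    have "(\<Sum>i\<in>Q. h (Sup (snd i)) - h (Inf (snd i)))
        = (\<Sum>I\<in>F1. (h (snd I) - h (fst I)) - (\<Sum>(l,u)\<in>G I. h u - h l))"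
      unfolding sumQ [of "\<lambda>K. h (Sup K) - h (Inf K)"] by (rule sum.cong [OF refl R(5)])
    also have "\<dots> = (\<Sum>I\<in>F1. h (snd I) - h (fst I)) - (\<Sum>I\<in>F1. \<Sum>(l,u)\<in>G I. h u - h l)" by (rule sum_subtractf)
    finally show ?thesis unfolding sumG [of "\<lambda>(l,u). h u - h l"] by (simp only: case_prod_unfold)
  qed
  have "(\<Sum>i\<in>Q. norm (h (Sup (snd i)) - h (Inf (snd i)))) < c * m / 2"
  proof (rule \<delta> [OF finQ])
    fix i assume "i \<in> Q"
    then obtain l u K where "i = ((l,u),K)" "(l,u) \<in> F1" "K \<in> R (l,u)" by (auto simp: Q_def)
    then show "a \<le> Inf (snd i) \<and> Inf (snd i) \<le> Sup (snd i) \<and> Sup (snd i) \<le> b"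
      using R(2) [of "(l,u)" K] F1'(4,5) [of l u] by auto
  next
    show "disjoint_family_on (\<lambda>i. {Inf (snd i)<..<Sup (snd i)}) Q"
      unfolding disjoint_family_on_def
    proof (intro ballI impI)
      fix i j assume ij: "i \<in> Q" "j \<in> Q" "i \<noteq> j"
      obtain l u K l' u' K' where e: "i = ((l,u),K)" "j = ((l',u'),K')" by (metis prod.collapse)
      have F: "(l,u) \<in> F1" "(l',u') \<in> F1" "K \<in> R (l,u)" "K' \<in> R (l',u')" using ij e by (auto simp: Q_def)
      show "{Inf (snd i)<..<Sup (snd i)} \<inter> {Inf (snd j)<..<Sup (snd j)} = {}"
      proof (cases "(l,u) = (l',u')")
        case True
        then have "K \<noteq> K'" using ij e by auto
        then show ?thesis using R(3) [OF F(1)] F True e unfolding disjoint_family_on_def by auto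
      next
        case False
        then have "{l..u} \<inter> {l'..u'} = {}" using F1(3) F unfolding disjoint_family_on_def by fastforce
        moreover have "{Inf K<..<Sup K} \<subseteq> {l..u}" "{Inf K'<..<Sup K'} \<subseteq> {l'..u'}"
          using R(2) [OF F(1,3)] R(2) [OF F(2,4)] by auto
        ultimately have "{Inf K<..<Sup K} \<inter> {Inf K'<..<Sup K'} = {}" by blast
        then show ?thesis unfolding e by (simp only: snd_conv)
      qed
    qed
    show "(\<Sum>i\<in>Q. Sup (snd i) - Inf (snd i)) < \<delta>"
      unfolding len using S1u S2l \<eta> by linarith
  qed
  then have "(\<Sum>i\<in>Q. h (Sup (snd i)) - h (Inf (snd i))) < c * m / 2"
    by (rule le_less_trans [rotated]) (auto intro: sum_mono)
  then have "(\<Sum>(l,u)\<in>F1. h u - h l) - (\<Sum>(l,u)\<in>F2. h u - h l) < c * m / 2" by (simp add: inc)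
  moreover have "c * S1 \<le> (\<Sum>(l,u)\<in>F1. h u - h l)"
    unfolding S1_def sum_distrib_left using F1'(2) by (auto intro!: sum_mono)
  moreover have "(\<Sum>(l,u)\<in>F2. h u - h l) \<le> - c * S2"
    unfolding S2_def sum_distrib_left using F2'(2) by (auto intro!: sum_mono)
  ultimately have "c * (S1 + S2) < c * (m / 2)" by (simp add: algebra_simps)
  then have "S1 + S2 < m / 2" using \<open>0 < c\<close> by (simp only: mult_less_cancel_left_pos)
  then show False using S1l S2l \<eta> \<open>0 < m\<close> by linarith
qed

text \<open>Disjoint intervals whose slopes have modulus at least \<open>n\<close> and whose total
  increment is below 1 have total length below \<open>1 / n\<close>.\<close>

lemma absolutely_continuous_unbounded_quotients_negligible:
  fixes f :: "real \<Rightarrow> real"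
  assumes ac: "absolutely_continuous_on_interval a b f" and Eab: "E \<subseteq> {a<..<b}"
    and E: "\<And>x d n. x \<in> E \<Longrightarrow> 0 < d \<Longrightarrow>
      \<exists>l u. l \<le> x \<and> x \<le> u \<and> l < u \<and> u - l < d \<and> \<bar>f u - f l\<bar> \<ge> real n * (u - l)"
  shows "negligible E"
proof -
  obtain \<delta> where "0 < \<delta>" and \<delta>: "\<And>(I::(real \<times> real) set) l u.
       \<lbrakk>finite I; \<And>i. i \<in> I \<Longrightarrow> a \<le> l i \<and> l i \<le> u i \<and> u i \<le> b;
       disjoint_family_on (\<lambda>i. {l i<..<u i}) I; (\<Sum>i\<in>I. u i - l i) < \<delta>\<rbrakk>
      \<Longrightarrow> (\<Sum>i\<in>I. norm (f (u i) - f (l i))) < 1"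
    by (rule absolutely_continuous_finite_family [OF ac zero_less_one]) (erule that, blast)
  \<comment> \<open>The bound 1 on increments is available only for families of total length below
    \<open>\<delta>\<close>, so \<open>E\<close> is treated in windows of length
    \<open>\<delta>/2\<close>; countably many of them, with rational left ends, cover
    \<open>E\<close>.\<close>
  have loc: "negligible (E \<inter> {s<..<s + \<delta>/2})" for s
    unfolding negligible_outer
  proof (intro allI impI)
    fix e :: real assume "e > 0"
    define W where "W = {a<..<b} \<inter> {s<..<s + \<delta>/2}"
    have W: "open W" "W \<in> lmeasurable" "E \<inter> {s<..<s + \<delta>/2} \<subseteq> W"
      using Eab fmeasurable.Int [of "{a<..<b}" lebesgue "{s<..<s + \<delta>/2}"] by (auto simp: W_def)
    have mW: "measure lebesgue W < \<delta>"
    proof -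
      have "measure lebesgue W \<le> measure lebesgue {s<..<s + \<delta>/2}"
        by (rule measure_mono_fmeasurable) (use W in \<open>auto simp: W_def\<close>)
      then show ?thesis using \<open>0 < \<delta>\<close> by simp
    qed
    obtain n :: nat where n: "1 / (e/2) < real n" using reals_Archimedean2 by blast
    then have n0: "0 < real n" using \<open>e > 0\<close> by (smt (verit) divide_pos_pos half_gt_zero)
    obtain F T where F: "finite F"
      "\<And>l u. (l,u) \<in> F \<Longrightarrow> l < u \<and> \<bar>f u - f l\<bar> \<ge> real n * (u - l) \<and> {l..u} \<subseteq> W"
      "disjoint_family_on (\<lambda>(l,u). {l..u}) F"
      "T \<in> lmeasurable" "measure lebesgue T < e/2" "E \<inter> {s<..<s + \<delta>/2} \<subseteq> T \<union> (\<Union>(l,u)\<in>F. {l..u})"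
      by (rule Vitali_finite_intervals [where P = "\<lambda>l u. \<bar>f u - f l\<bar> \<ge> real n * (u - l)", OF W half_gt_zero [OF \<open>e > 0\<close>]])
         (use E in blast)+
    have F': "l \<le> u" "real n * (u - l) \<le> \<bar>f u - f l\<bar>" "a \<le> l" "u \<le> b" if "(l,u) \<in> F" for l u
    proof -
      have "l < u" "{l..u} \<subseteq> W" using F(2) [OF that] by auto
      then have "l \<in> W" "u \<in> W" by auto
      then show "l \<le> u" "real n * (u - l) \<le> \<bar>f u - f l\<bar>" "a \<le> l" "u \<le> b"
        using F(2) [OF that] by (auto simp: W_def)
    qed
    define U where "U = (\<Union>(l,u)\<in>F. {l..u})"
    have mU: "U \<in> lmeasurable" "measure lebesgue U = (\<Sum>(l,u)\<in>F. u - l)"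
      unfolding U_def using measure_disjoint_intervals [OF F(1) F'(1) F(3)] by auto
    have "U \<subseteq> W" unfolding U_def using F(2) by blast
    then have "(\<Sum>(l,u)\<in>F. u - l) < \<delta>"
      using measure_mono_fmeasurable [OF _ fmeasurableD [OF mU(1)] W(2)] mU(2) mW by fastforce
    then have len: "(\<Sum>i\<in>F. snd i - fst i) < \<delta>" by (simp add: case_prod_beta)
    have "(\<Sum>i\<in>F. norm (f (snd i) - f (fst i))) < 1"
    proof (rule \<delta> [OF F(1) _ _ len])
      show "a \<le> fst i \<and> fst i \<le> snd i \<and> snd i \<le> b" if "i \<in> F" for i
        using F' [of "fst i" "snd i"] that by simp
      show "disjoint_family_on (\<lambda>i. {fst i<..<snd i}) F"
        unfolding disjoint_family_on_def
      proof (intro ballI impI)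
        fix i j assume "i \<in> F" "j \<in> F" "i \<noteq> j"
        then have "{fst i..snd i} \<inter> {fst j..snd j} = {}"
          using F(3) unfolding disjoint_family_on_def by (simp add: case_prod_beta)
        then show "{fst i<..<snd i} \<inter> {fst j<..<snd j} = {}" by fastforce
      qed
    qed
    moreover have "real n * (\<Sum>i\<in>F. snd i - fst i) \<le> (\<Sum>i\<in>F. norm (f (snd i) - f (fst i)))"
      unfolding sum_distrib_left using F'(2) by (intro sum_mono) auto
    ultimately have "real n * measure lebesgue U < 1" by (simp add: mU(2) case_prod_beta)
    then have "measure lebesgue U < 1 / real n" using n0 by (simp add: pos_less_divide_eq mult.commute)
    also have "1 / real n < e/2" using n n0 \<open>e > 0\<close> by (simp add: field_simps)
    finally have "measure lebesgue U < e/2" .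
    moreover have "measure lebesgue (T \<union> U) \<le> measure lebesgue T + measure lebesgue U"
      by (intro measure_Un_le fmeasurableD F(4) mU(1))
    ultimately have "measure lebesgue (T \<union> U) < e" using F(5) by linarith
    then show "\<exists>T. E \<inter> {s<..<s + \<delta>/2} \<subseteq> T \<and> T \<in> lmeasurable \<and> measure lebesgue T < e"
      using F(4,6) mU(1) by (intro exI [of _ "T \<union> U"]) (auto simp: U_def)
  qed
  have "negligible (\<Union>s\<in>\<rat>. E \<inter> {s<..<s + \<delta>/2})"
    by (rule negligible_countable_Union) (auto simp: countable_rat loc)
  moreover have "E \<subseteq> (\<Union>s\<in>\<rat>. E \<inter> {s<..<s + \<delta>/2})"
  proof
    fix x assume x: "x \<in> E"
    obtain s where s: "s \<in> \<rat>" "x - \<delta>/2 < s" "s < x"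
      using Rats_dense_in_real [of "x - \<delta>/2" x] \<open>0 < \<delta>\<close> by auto
    then have "x \<in> E \<inter> {s<..<s + \<delta>/2}" using x by auto
    then show "x \<in> (\<Union>s\<in>\<rat>. E \<inter> {s<..<s + \<delta>/2})" using s(1) by blast
  qed
  ultimately show ?thesis by (rule negligible_subset)
qed

text \<open>Where the derivative fails to exist, either the difference quotients are unbounded
  (\<open>B\<close>), or two rationals \<open>\<alpha> < \<beta>\<close> fit between their lower and
  upper limits (\<open>E \<alpha> \<beta>\<close>); there are countably many such pairs.\<close>

lemma absolutely_continuous_differentiable_ae:
  fixes f :: "real \<Rightarrow> real"
  assumes ac: "absolutely_continuous_on_interval a b f"
  obtains N where "negligible N" "\<And>x. x \<in> {a<..<b} - N \<Longrightarrow> \<exists>D. (f has_real_derivative D) (at x)"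
proof -
  define Q where "Q P x \<longleftrightarrow> (\<forall>d>0. \<exists>l u. l \<le> x \<and> x \<le> u \<and> l < u \<and> u - l < d \<and> P l u)"
    for P :: "real \<Rightarrow> real \<Rightarrow> bool" and x
  define B where "B = {x \<in> {a<..<b}. \<forall>n::nat. Q (\<lambda>l u. \<bar>f u - f l\<bar> \<ge> real n * (u - l)) x}"
  define E where "E \<alpha> \<beta> = {x \<in> {a<..<b}. Q (\<lambda>l u. f u - f l \<ge> \<beta> * (u - l)) x \<and> Q (\<lambda>l u. f u - f l \<le> \<alpha> * (u - l)) x}"
    for \<alpha> \<beta>
  have nB: "negligible B"
    by (rule absolutely_continuous_unbounded_quotients_negligible [OF ac]) (auto simp: B_def Q_def)
  \<comment> \<open>Shearing by the mean slope turns slopes above \<open>\<beta>\<close> and below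
    \<open>\<alpha>\<close> into slopes of opposite sign and modulus at least
    \<open>(\<beta> - \<alpha>)/2\<close>.\<close>
  have nE: "negligible (E \<alpha> \<beta>)" if "\<alpha> < \<beta>" for \<alpha> \<beta>
  proof (rule negligible_opposite_increments [of a b "\<lambda>x. f x + (- ((\<alpha> + \<beta>)/2)) * x" "(\<beta> - \<alpha>)/2"])
    have "absolutely_continuous_on_interval a b (\<lambda>x::real. (- ((\<alpha> + \<beta>)/2)) * x)"
    proof (rule absolutely_continuous_on_interval_lipschitz [of _ _ _ "\<bar>(\<alpha> + \<beta>)/2\<bar>"])
      fix s t :: real assume "s \<le> t"
      have "(- ((\<alpha> + \<beta>)/2)) * t - (- ((\<alpha> + \<beta>)/2)) * s = (- ((\<alpha> + \<beta>)/2)) * (t - s)" by (rule right_diff_distrib [symmetric])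
      then show "norm ((- ((\<alpha> + \<beta>)/2)) * t - (- ((\<alpha> + \<beta>)/2)) * s) \<le> \<bar>(\<alpha> + \<beta>)/2\<bar> * (t - s)"
        using \<open>s \<le> t\<close> by (simp only: real_norm_def abs_mult) simp
    qed
    then show "absolutely_continuous_on_interval a b (\<lambda>x. f x + (- ((\<alpha> + \<beta>)/2)) * x)"
      by (rule absolutely_continuous_on_interval_add [OF ac])
    show "0 < (\<beta> - \<alpha>)/2" using that by simp
    show "E \<alpha> \<beta> \<subseteq> {a<..<b}" by (auto simp: E_def)
    fix x d :: real assume x: "x \<in> E \<alpha> \<beta>" and "0 < d"
    then obtain l u where lu: "l \<le> x" "x \<le> u" "l < u" "u - l < d" "f u - f l \<ge> \<beta> * (u - l)"
      unfolding E_def Q_def by blast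
    have "(\<beta> - \<alpha>)/2 * (u - l) = \<beta> * (u - l) + (- ((\<alpha> + \<beta>)/2)) * u - (- ((\<alpha> + \<beta>)/2)) * l"
      by (simp add: field_simps)
    then show "\<exists>l u. l \<le> x \<and> x \<le> u \<and> l < u \<and> u - l < d \<and>
      f u + (- ((\<alpha> + \<beta>)/2)) * u - (f l + (- ((\<alpha> + \<beta>)/2)) * l) \<ge> (\<beta> - \<alpha>)/2 * (u - l)"
      using lu by (intro exI [of _ l] exI [of _ u] conjI) linarith+
    obtain l u where lu: "l \<le> x" "x \<le> u" "l < u" "u - l < d" "f u - f l \<le> \<alpha> * (u - l)"
      using x \<open>0 < d\<close> unfolding E_def Q_def by blast
    have "- ((\<beta> - \<alpha>)/2) * (u - l) = \<alpha> * (u - l) + (- ((\<alpha> + \<beta>)/2)) * u - (- ((\<alpha> + \<beta>)/2)) * l"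
      by (simp add: field_simps)
    then show "\<exists>l u. l \<le> x \<and> x \<le> u \<and> l < u \<and> u - l < d \<and>
      f u + (- ((\<alpha> + \<beta>)/2)) * u - (f l + (- ((\<alpha> + \<beta>)/2)) * l) \<le> - ((\<beta> - \<alpha>)/2) * (u - l)"
      using lu by (intro exI [of _ l] exI [of _ u] conjI) linarith+
  qed
  define I where "I = {(\<alpha>,\<beta>). \<alpha> \<in> \<rat> \<and> \<beta> \<in> \<rat> \<and> \<alpha> < (\<beta>::real)}"
  have cI: "countable I"
    by (rule countable_subset [of _ "\<rat> \<times> \<rat>"]) (auto simp: I_def countable_rat)
  have "negligible (\<Union>((\<lambda>(\<alpha>,\<beta>). E \<alpha> \<beta>) ` I))"
    by (rule negligible_countable_Union) (use cI nE in \<open>auto simp: I_def\<close>)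
  then have neg: "negligible (B \<union> \<Union>((\<lambda>(\<alpha>,\<beta>). E \<alpha> \<beta>) ` I))" using nB by (rule negligible_Un [rotated])
  show ?thesis
  proof (rule that [OF neg])
    fix x assume x: "x \<in> {a<..<b} - (B \<union> \<Union>((\<lambda>(\<alpha>,\<beta>). E \<alpha> \<beta>) ` I))"
    define q where "q y = (f y - f x) / (y - x)" for y
    \<comment> \<open>Intervals with \<open>x\<close> as an end point witness \<open>Q\<close>. The
      difference quotient is symmetric in its two points, which covers both sides of
      \<open>x\<close>.\<close>
    have freq: "Q P x" if fr: "frequently (\<lambda>y. R (q y)) (at x)"
      and RP: "\<And>l u. l < u \<Longrightarrow> R ((f u - f l) / (u - l)) \<Longrightarrow> P l u" for P R
      unfolding Q_def
    proof (intro allI impI)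
      fix d :: real assume "d > 0"
      then have "\<forall>\<^sub>F y in at x. \<bar>y - x\<bar> < d \<and> y \<noteq> x"
        by (auto simp: eventually_at dist_real_def intro!: exI [of _ d])
      then obtain y where y: "R (q y)" "\<bar>y - x\<bar> < d" "y \<noteq> x"
        using frequently_eventually_frequently [OF fr] frequently_ex by blast
      show "\<exists>l u. l \<le> x \<and> x \<le> u \<and> l < u \<and> u - l < d \<and> P l u"
      proof (cases "x < y")
        case True
        then show ?thesis using y RP [of x y] by (intro exI [of _ x] exI [of _ y]) (auto simp: q_def)
      next
        case False
        then have "y < x" using y by simp
        moreover have "q y = (f x - f y) / (x - y)"
          unfolding q_def by (metis minus_diff_eq minus_divide_divide)
        ultimately show ?thesis using y RP [of y x] by (intro exI [of _ y] exI [of _ x]) auto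
      qed
    qed
    obtain n :: nat where n: "\<not> Q (\<lambda>l u. \<bar>f u - f l\<bar> \<ge> real n * (u - l)) x"
      using x unfolding B_def by blast
    have "\<not> frequently (\<lambda>y. \<bar>q y\<bar> \<ge> real n) (at x)"
    proof
      assume "frequently (\<lambda>y. \<bar>q y\<bar> \<ge> real n) (at x)"
      then have "Q (\<lambda>l u. \<bar>f u - f l\<bar> \<ge> real n * (u - l)) x"
        by (rule freq) (simp add: pos_le_divide_eq)
      then show False using n by simp
    qed
    then have bd: "\<forall>\<^sub>F y in at x. \<bar>q y\<bar> < real n" by (simp add: frequently_def not_le)
    define F where "F = at x"
    have Fb: "F \<noteq> bot" by (simp add: F_def)
    let ?q = "\<lambda>y. ereal (q y)"
    have Lb: "ereal (- real n) \<le> Liminf F ?q" "Limsup F ?q \<le> ereal (real n)"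
      unfolding F_def by (intro Liminf_bounded Limsup_bounded; use bd in eventually_elim; auto)+
    have LS: "Liminf F ?q \<le> Limsup F ?q" using Fb by (rule Liminf_le_Limsup)
    have "\<not> Liminf F ?q < Limsup F ?q"
    proof
      assume lt: "Liminf F ?q < Limsup F ?q"
      obtain \<alpha>' where \<alpha>': "Liminf F ?q < ereal (real_of_rat \<alpha>')" "ereal (real_of_rat \<alpha>') < Limsup F ?q"
        using ereal_dense3 [OF lt] by auto
      obtain \<beta>' where \<beta>': "ereal (real_of_rat \<alpha>') < ereal (real_of_rat \<beta>')" "ereal (real_of_rat \<beta>') < Limsup F ?q"
        using ereal_dense3 [OF \<alpha>'(2)] by auto
      define \<alpha> \<beta> where "\<alpha> = real_of_rat \<alpha>'" and "\<beta> = real_of_rat \<beta>'"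
      have "frequently (\<lambda>y. q y \<le> \<alpha>) F"
      proof (rule ccontr)
        assume "\<not> frequently (\<lambda>y. q y \<le> \<alpha>) F"
        then have "\<forall>\<^sub>F y in F. ereal \<alpha> \<le> ?q y" by (auto simp: frequently_def elim: eventually_mono)
        then have "ereal \<alpha> \<le> Liminf F ?q" by (rule Liminf_bounded)
        then show False using \<alpha>'(1) by (simp add: \<alpha>_def)
      qed
      then have 1: "Q (\<lambda>l u. f u - f l \<le> \<alpha> * (u - l)) x"
        unfolding F_def by (rule freq) (simp add: pos_divide_le_eq)
      have "frequently (\<lambda>y. \<beta> \<le> q y) F"
      proof (rule ccontr)
        assume "\<not> frequently (\<lambda>y. \<beta> \<le> q y) F"
        then have "\<forall>\<^sub>F y in F. ?q y \<le> ereal \<beta>" by (auto simp: frequently_def elim: eventually_mono)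
        then have "Limsup F ?q \<le> ereal \<beta>" by (rule Limsup_bounded)
        then show False using \<beta>'(2) by (simp add: \<beta>_def)
      qed
      then have 2: "Q (\<lambda>l u. f u - f l \<ge> \<beta> * (u - l)) x"
        unfolding F_def by (rule freq) (simp add: pos_le_divide_eq)
      have "(\<alpha>,\<beta>) \<in> I" using \<beta>'(1) by (simp add: I_def \<alpha>_def \<beta>_def)
      moreover have "x \<in> E \<alpha> \<beta>" using 1 2 x by (auto simp: E_def)
      ultimately show False using x by blast
    qed
    then have eq: "Liminf F ?q = Limsup F ?q" using LS by simp
    have "\<bar>Liminf F ?q\<bar> \<noteq> \<infinity>" using Lb eq by (auto simp: abs_eq_infinity_cases)
    then obtain D where D: "Liminf F ?q = ereal D" by auto
    have "(?q \<longlongrightarrow> ereal D) F"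
      by (rule Liminf_eq_Limsup [OF Fb]) (use D eq in auto)
    then have "(q \<longlongrightarrow> D) F" by simp
    then have "(f has_real_derivative D) (at x)"
      unfolding has_field_derivative_iff F_def q_def .
    then show "\<exists>D. (f has_real_derivative D) (at x)" by blast
  qed
qed

section \<open>The fundamental theorem of calculus for absolutely continuous functions\<close>

text \<open>The gauge confines intervals tagged in \<open>N\<close> to an open set of small measure,
  where absolute continuity bounds the increments. On the other intervals differentiability at the
  tag compares the increment with the Riemann term.\<close>

lemma absolutely_continuous_has_integral_derivative:
  fixes f :: "real \<Rightarrow> real"
  assumes ac: "absolutely_continuous_on_interval a b f" and "a \<le> b" and N: "negligible N"
    and der: "\<And>x. x \<in> {a..b} - N \<Longrightarrow> (f has_real_derivative D x) (at x)"
  shows "((\<lambda>x. if x \<in> N then 0 else D x) has_integral (f b - f a)) {a..b}"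
  unfolding has_integral_real
proof (intro allI impI)
  fix e :: real assume "e > 0"
  \<comment> \<open>The summand 1 keeps the denominator positive when \<open>a = b\<close>.\<close>
  define e1 where "e1 = e / (2 * (b - a + 1))"
  have e1: "0 < e1" "e1 * (b - a) < e/2" using \<open>e > 0\<close> \<open>a \<le> b\<close> by (auto simp: e1_def field_simps)
  define g where "g x = (if x \<in> N then 0 else D x)" for x
  obtain \<delta> where "0 < \<delta>" and \<delta>: "\<And>(I::(real \<times> real set) set) l u.
       \<lbrakk>finite I; \<And>i. i \<in> I \<Longrightarrow> a \<le> l i \<and> l i \<le> u i \<and> u i \<le> b;
       disjoint_family_on (\<lambda>i. {l i<..<u i}) I; (\<Sum>i\<in>I. u i - l i) < \<delta>\<rbrakk>
      \<Longrightarrow> (\<Sum>i\<in>I. norm (f (u i) - f (l i))) < e/2"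
    by (rule absolutely_continuous_finite_family [OF ac half_gt_zero [OF \<open>e > 0\<close>]]) (erule that, blast)
  obtain W where W: "open W" "N \<subseteq> W" "W - N \<in> lmeasurable" "emeasure lebesgue (W - N) < ennreal \<delta>"
    by (rule sets_lebesgue_outer_open [OF negligible_imp_sets [OF N] \<open>\<delta> > 0\<close>])
  have WN: "W = N \<union> (W - N)" using W(2) by blast
  have Wm: "W \<in> lmeasurable" by (subst WN) (intro fmeasurable.Un negligible_imp_measurable N W(3))
  have "measure lebesgue (W - N) < \<delta>"
    using W(4) \<open>\<delta> > 0\<close> by (simp add: emeasure_eq_measure2 [OF W(3)] ennreal_less_iff)
  moreover have "measure lebesgue W \<le> measure lebesgue N + measure lebesgue (W - N)"
    by (subst WN) (intro measure_Un_le fmeasurableD negligible_imp_measurable N W(3))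
  ultimately have mW: "measure lebesgue W < \<delta>" using negligible_imp_measure0 [OF N] by simp
  have "\<exists>d>0. \<forall>y. \<bar>y - x\<bar> < d \<longrightarrow> \<bar>f y - f x - D x * (y - x)\<bar> \<le> e1 * \<bar>y - x\<bar>" if "x \<in> {a..b} - N" for x
    using der [OF that] e1(1) unfolding has_field_derivative_def has_derivative_at_alt by auto
  then obtain d where d: "\<And>x. x \<in> {a..b} - N \<Longrightarrow> 0 < d x"
    "\<And>x y. x \<in> {a..b} - N \<Longrightarrow> \<bar>y - x\<bar> < d x \<Longrightarrow> \<bar>f y - f x - D x * (y - x)\<bar> \<le> e1 * \<bar>y - x\<bar>"
    by metis
  define \<gamma> where "\<gamma> x = (if x \<in> N then W else if x \<in> {a..b} then ball x (d x) else ball x 1)" for x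
  show "\<exists>\<gamma>. gauge \<gamma> \<and> (\<forall>p. p tagged_division_of {a..b} \<and> \<gamma> fine p \<longrightarrow>
      norm ((\<Sum>(x,K)\<in>p. measure lborel K *\<^sub>R (if x \<in> N then 0 else D x)) - (f b - f a)) < e)"
  proof (intro exI [of _ \<gamma>] conjI allI impI)
    show "gauge \<gamma>" unfolding gauge_def \<gamma>_def using W d(1) by auto
    fix p assume p: "p tagged_division_of {a..b} \<and> \<gamma> fine p"
    then have ptag: "p tagged_division_of {a..b}" and fine: "\<gamma> fine p" by auto
    note pD = tagged_division_ofD [OF ptag]
    have sm: "f b - f a = (\<Sum>(x,K)\<in>p. f (Sup K) - f (Inf K))" "b - a = (\<Sum>(x,K)\<in>p. Sup K - Inf K)"
      using additive_tagged_division_1 [OF \<open>a \<le> b\<close> ptag, of f]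
        additive_tagged_division_1 [OF \<open>a \<le> b\<close> ptag, of "\<lambda>x. x"] by auto
    have K: "Inf K \<le> x \<and> x \<le> Sup K \<and> a \<le> Inf K \<and> Sup K \<le> b \<and> K = {Inf K..Sup K} \<and> measure lborel K = Sup K - Inf K"
      if xK: "(x,K) \<in> p" for x K
    proof -
      obtain u v where uv: "K = cbox u v" using pD(4) [OF xK] by blast
      have "x \<in> K" "K \<subseteq> {a..b}" using pD(2,3) [OF xK] by auto
      then have "u \<le> x" "x \<le> v" "a \<le> u" "v \<le> b" using uv by auto
      then show ?thesis using uv by simp
    qed
    define pN where "pN = {i \<in> p. fst i \<in> N}"
    have fin: "finite p" "finite pN" using pD(1) by (auto simp: pN_def)
    have disj: "disjoint_family_on (\<lambda>i. {Inf (snd i)<..<Sup (snd i)}) p"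
      unfolding disjoint_family_on_def
    proof (intro ballI impI)
      fix i j assume ij: "i \<in> p" "j \<in> p" "i \<noteq> j"
      obtain x K y L where e: "i = (x,K)" "j = (y,L)" by (metis prod.collapse)
      have "interior K \<inter> interior L = {}" using pD(5) ij e by auto
      moreover have "interior K = {Inf K<..<Sup K}" "interior L = {Inf L<..<Sup L}"
        using K ij e by (metis interior_atLeastAtMost_real)+
      ultimately show "{Inf (snd i)<..<Sup (snd i)} \<inter> {Inf (snd j)<..<Sup (snd j)} = {}" using e by (simp only: snd_conv)
    qed
    then have disjN: "disjoint_family_on (\<lambda>i. {Inf (snd i)<..<Sup (snd i)}) pN"
      by (rule disjoint_family_on_mono [rotated]) (auto simp: pN_def)
    have KN: "a \<le> Inf (snd i) \<and> Inf (snd i) \<le> Sup (snd i) \<and> Sup (snd i) \<le> b" if "i \<in> p" for i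
      using K [of "fst i" "snd i"] that by auto
    have lenN: "(\<Sum>i\<in>pN. Sup (snd i) - Inf (snd i)) < \<delta>"
    proof -
      have "(\<Sum>i\<in>pN. Sup (snd i) - Inf (snd i)) = (\<Sum>i\<in>pN. measure lebesgue {Inf (snd i)<..<Sup (snd i)})"
        by (rule sum.cong [OF refl]) (use KN in \<open>auto simp: pN_def\<close>)
      also have "\<dots> = measure lebesgue (\<Union>i\<in>pN. {Inf (snd i)<..<Sup (snd i)})"
      proof (rule measure_finite_Union [symmetric])
        show "emeasure lebesgue {Inf (snd i)<..<Sup (snd i)} \<noteq> \<infinity>" for i :: "real \<times> real set"
          using fmeasurableD2 [OF lmeasurable_box, of "Inf (snd i)" "Sup (snd i)"] by simp
      qed (use fin disjN in auto)
      also have "\<dots> \<le> measure lebesgue W"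
      proof (rule measure_mono_fmeasurable)
        show "(\<Union>i\<in>pN. {Inf (snd i)<..<Sup (snd i)}) \<subseteq> W"
        proof (rule UN_least)
          fix i assume i: "i \<in> pN"
          obtain x L where e: "i = (x,L)" by (metis prod.collapse)
          have "L \<subseteq> \<gamma> x" using fine i e by (auto simp: pN_def fine_def)
          moreover have "\<gamma> x = W" using i e by (simp add: \<gamma>_def pN_def)
          moreover have "{Inf L<..<Sup L} \<subseteq> {Inf L..Sup L}" by auto
          moreover have "L = {Inf L..Sup L}" using K [of x L] i e by (simp add: pN_def)
          ultimately show "{Inf (snd i)<..<Sup (snd i)} \<subseteq> W" using e by (metis order_trans snd_conv)
        qed
      qed (use fin Wm in auto)
      finally show ?thesis using mW by simp
    qed
    have SN: "(\<Sum>i\<in>pN. norm (f (Sup (snd i)) - f (Inf (snd i)))) < e/2"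
      by (rule \<delta> [OF fin(2) _ disjN lenN]) (use KN in \<open>auto simp: pN_def\<close>)
    define T where "T i = measure lborel (snd i) * g (fst i) - (f (Sup (snd i)) - f (Inf (snd i)))" for i
    have TN: "(\<Sum>i\<in>pN. \<bar>T i\<bar>) < e/2"
    proof -
      have "(\<Sum>i\<in>pN. \<bar>T i\<bar>) = (\<Sum>i\<in>pN. norm (f (Sup (snd i)) - f (Inf (snd i))))"
        by (rule sum.cong [OF refl]) (auto simp: T_def g_def pN_def abs_minus_commute)
      then show ?thesis using SN by simp
    qed
    have "(\<Sum>i\<in>p - pN. \<bar>T i\<bar>) \<le> (\<Sum>i\<in>p - pN. e1 * (Sup (snd i) - Inf (snd i)))"
    proof (rule sum_mono)
      fix i assume i: "i \<in> p - pN"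
      obtain x L where e: "i = (x,L)" by (metis prod.collapse)
      have xL: "(x,L) \<in> p" "x \<notin> N" using i e by (auto simp: pN_def)
      note KL = K [OF xL(1)]
      have xab: "x \<in> {a..b} - N" using KL xL(2) by auto
      have "L \<subseteq> \<gamma> x" using fine xL(1) unfolding fine_def by blast
      then have "L \<subseteq> ball x (d x)" using xL(2) xab by (simp add: \<gamma>_def)
      moreover have "Inf L \<in> L" "Sup L \<in> L" using KL by (metis atLeastAtMost_iff order_refl order_trans)+
      ultimately have "\<bar>Inf L - x\<bar> < d x" "\<bar>Sup L - x\<bar> < d x" by (auto simp: dist_real_def abs_minus_commute)
      then have A: "\<bar>f (Inf L) - f x - D x * (Inf L - x)\<bar> \<le> e1 * \<bar>Inf L - x\<bar>"
        "\<bar>f (Sup L) - f x - D x * (Sup L - x)\<bar> \<le> e1 * \<bar>Sup L - x\<bar>" using d(2) [OF xab] by auto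
      have "T i = (f (Inf L) - f x - D x * (Inf L - x)) - (f (Sup L) - f x - D x * (Sup L - x))"
      proof -
        have m: "measure lborel L = Sup L - Inf L" using KL by blast
        show ?thesis unfolding T_def e g_def fst_conv snd_conv m using xL(2) by (simp add: algebra_simps)
      qed
      then have "\<bar>T i\<bar> \<le> \<bar>f (Inf L) - f x - D x * (Inf L - x)\<bar> + \<bar>f (Sup L) - f x - D x * (Sup L - x)\<bar>" by linarith
      also have "\<dots> \<le> e1 * \<bar>Inf L - x\<bar> + e1 * \<bar>Sup L - x\<bar>" using A by linarith
      also have "\<dots> = e1 * (Sup L - Inf L)" using KL by (simp add: algebra_simps)
      finally show "\<bar>T i\<bar> \<le> e1 * (Sup (snd i) - Inf (snd i))" using e by simp
    qed
    also have "\<dots> \<le> (\<Sum>i\<in>p. e1 * (Sup (snd i) - Inf (snd i)))"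
      by (rule sum_mono2) (use fin e1 KN in auto)
    also have "\<dots> = e1 * (b - a)" unfolding sm(2) by (simp only: sum_distrib_left case_prod_unfold)
    finally have TR: "(\<Sum>i\<in>p - pN. \<bar>T i\<bar>) < e/2" using e1(2) by linarith
    have "(\<Sum>(x,K)\<in>p. measure lborel K *\<^sub>R (if x \<in> N then 0 else D x)) - (f b - f a) = (\<Sum>i\<in>p. T i)"
      unfolding sm(1) sum_subtractf [symmetric] by (rule sum.cong [OF refl]) (auto simp: T_def g_def)
    moreover have "\<bar>\<Sum>i\<in>p. T i\<bar> \<le> (\<Sum>i\<in>p. \<bar>T i\<bar>)" by (rule sum_abs)
    moreover have "(\<Sum>i\<in>p. \<bar>T i\<bar>) = (\<Sum>i\<in>pN. \<bar>T i\<bar>) + (\<Sum>i\<in>p - pN. \<bar>T i\<bar>)"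
    proof -
      have "pN \<subseteq> p" by (auto simp: pN_def)
      then show ?thesis using sum.subset_diff [of pN p "\<lambda>i. \<bar>T i\<bar>"] fin by simp
    qed
    ultimately show "norm ((\<Sum>(x,K)\<in>p. measure lborel K *\<^sub>R (if x \<in> N then 0 else D x)) - (f b - f a)) < e"
      using TN TR by simp
  qed
qed

text \<open>Stated for an arbitrary \<open>\<phi>\<close> because it will be the Kobayashi metric
  along a curve: \<open>nn_integral\<close> is monotone for all functions, and the measurability
  used is that of the derivative, which the gauge integral supplies.\<close>

lemma absolutely_continuous_increment_le_nn_integral:
  fixes f :: "real \<Rightarrow> real" and \<phi> :: "real \<Rightarrow> ennreal"
  assumes ac: "absolutely_continuous_on_interval a b f" and "a \<le> b" and N: "negligible N"
    and der: "\<And>x. x \<in> {a<..<b} - N \<Longrightarrow> \<exists>D. (f has_real_derivative D) (at x) \<and> ennreal \<bar>D\<bar> \<le> \<phi> x"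
  shows "ennreal \<bar>f b - f a\<bar> \<le> (\<integral>\<^sup>+ x\<in>{a..b}. \<phi> x \<partial>lebesgue)"
proof -
  obtain D where D: "\<And>x. x \<in> {a<..<b} - N \<Longrightarrow> (f has_real_derivative D x) (at x) \<and> ennreal \<bar>D x\<bar> \<le> \<phi> x"
    using der by metis
  \<comment> \<open>The gauge version asks for two-sided derivatives on the closed interval, so the
    end points join the exceptional set.\<close>
  define N' where "N' = insert a (insert b N)"
  have N': "negligible N'" using N by (simp add: N'_def)
  define g where "g x = (if x \<in> N' then 0 else D x)" for x
  have in': "x \<in> {a<..<b} - N" if "x \<in> {a..b} - N'" for x using that by (auto simp: N'_def)
  have hi: "(g has_integral (f b - f a)) {a..b}"
    unfolding g_def [abs_def]
    by (rule absolutely_continuous_has_integral_derivative [OF ac \<open>a \<le> b\<close> N']) (use D in' in blast)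
  have meas: "(\<lambda>x. indicator {a..b} x *\<^sub>R g x) \<in> borel_measurable lebesgue"
    using has_integral_implies_lebesgue_measurable [OF hi] .
  define J where "J = (\<integral>\<^sup>+ x. ennreal (norm (indicator {a..b} x *\<^sub>R g x)) \<partial>lebesgue)"
  have "J \<le> (\<integral>\<^sup>+ x\<in>{a..b}. \<phi> x \<partial>lebesgue)"
    unfolding J_def
  proof (rule nn_integral_mono)
    fix x :: real
    show "ennreal (norm (indicator {a..b} x *\<^sub>R g x)) \<le> \<phi> x * indicator {a..b} x"
      using D in' [of x] by (auto simp: g_def indicator_def)
  qed
  moreover have "ennreal \<bar>f b - f a\<bar> \<le> J"
  proof (cases "J = \<infinity>")
    case False
    have int: "integrable lebesgue (\<lambda>x. indicator {a..b} x *\<^sub>R g x)"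
      by (rule integrableI_bounded [OF meas]) (use False in \<open>simp add: J_def less_top\<close>)
    then have "set_integrable lebesgue {a..b} g" by (simp add: set_integrable_def)
    then have "(LINT x:{a..b}|lebesgue. g x) = f b - f a"
      using set_lebesgue_integral_eq_integral(2) integral_unique [OF hi] by metis
    then have "(LINT x|lebesgue. indicator {a..b} x *\<^sub>R g x) = f b - f a"
      by (simp add: set_lebesgue_integral_def)
    then show ?thesis using integral_norm_bound_ennreal [OF int] by (simp add: J_def)
  qed simp
  ultimately show ?thesis by (rule order_trans [rotated])
qed

section \<open>Complex convexity\<close>

text \<open>The tube lemma in metric form: finitely many neighbourhoods cover \<open>K\<close>, and
  the least of their radii serves all \<open>s\<close>.\<close>

lemma compact_uniform_neighbourhood:
  fixes K :: "'b::metric_space set" and y :: "'a::metric_space"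
  assumes "compact K"
    and loc: "\<And>t. t \<in> K \<Longrightarrow> \<exists>e>0. \<forall>x s. dist x y < e \<and> s \<in> K \<and> dist s t < e \<longrightarrow> P x s"
  shows "\<exists>e>0. \<forall>x s. dist x y < e \<and> s \<in> K \<longrightarrow> P x s"
proof -
  obtain e where e: "\<And>t. t \<in> K \<Longrightarrow> 0 < e t"
    "\<And>t x s. \<lbrakk>t \<in> K; dist x y < e t; s \<in> K; dist s t < e t\<rbrakk> \<Longrightarrow> P x s"
    using loc by metis
  obtain D where D: "D \<subseteq> K" "finite D" "K \<subseteq> (\<Union>t\<in>D. ball t (e t))"
    by (rule compactE_image [OF \<open>compact K\<close>, of K "\<lambda>t. ball t (e t)"]) (use e(1) in auto)
  \<comment> \<open>\<open>insert 1\<close> gives \<open>Min\<close> a nonempty argument when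
    \<open>D\<close> is empty.\<close>
  show ?thesis
  proof (intro exI [of _ "Min (insert 1 (e ` D))"] conjI allI impI)
    show "0 < Min (insert 1 (e ` D))" using D e(1) by (subst Min_gr_iff) auto
    fix x s assume xs: "dist x y < Min (insert 1 (e ` D)) \<and> s \<in> K"
    then obtain t where t: "t \<in> D" "dist s t < e t" using D(3) by (auto simp: dist_commute)
    have "Min (insert 1 (e ` D)) \<le> e t" using t D(2) by (intro Min_le) auto
    then show "P x s" using e(2) [of t x s] t xs D(1) by auto
  qed
qed

text \<open>Differences of logarithms of one number are integer multiples of
  \<open>2 * pi * \<i>\<close>, a discrete set, and a continuous function with discrete values on a
  connected set is constant.\<close>

lemma exp_eq_imp_constant_difference:
  fixes f g :: "'a::topological_space \<Rightarrow> complex"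
  assumes "connected S" "continuous_on S f" "continuous_on S g"
    and eq: "\<And>z. z \<in> S \<Longrightarrow> exp (f z) = exp (g z)" and xy: "x \<in> S" "y \<in> S"
  shows "f x - g x = f y - g y"
proof -
  have "(\<lambda>z. f z - g z) constant_on S"
  proof (rule continuous_discrete_range_constant [OF \<open>connected S\<close>])
    show "continuous_on S (\<lambda>z. f z - g z)" using assms by (intro continuous_intros)
    fix z assume z: "z \<in> S"
    show "\<exists>e>0. \<forall>w. w \<in> S \<and> f w - g w \<noteq> f z - g z \<longrightarrow> e \<le> norm (f w - g w - (f z - g z))"
    proof (intro exI [of _ "2 * pi"] conjI allI impI)
      fix w assume w: "w \<in> S \<and> f w - g w \<noteq> f z - g z"
      obtain m where m: "f w = g w + of_int (2 * m) * pi * \<i>" using eq w exp_eq by blast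
      obtain n where n: "f z = g z + of_int (2 * n) * pi * \<i>" using eq z exp_eq by blast
      have d: "f w - g w - (f z - g z) = of_int (m - n) * (2 * pi * \<i>)"
        using m n by (simp add: algebra_simps)
      have "m \<noteq> n" using w d by auto
      then have "1 \<le> \<bar>real_of_int (m - n)\<bar>" by linarith
      then have "2 * pi * 1 \<le> 2 * pi * \<bar>real_of_int (m - n)\<bar>" by (intro mult_left_mono) auto
      then show "2 * pi \<le> norm (f w - g w - (f z - g z))"
        unfolding d norm_mult by (simp add: norm_mult mult.commute flip: of_int_diff)
    qed simp
  qed
  then show ?thesis using xy unfolding constant_on_def by metis
qed

text \<open>\<open>\<theta> x\<close> is the logarithm on \<open>S x\<close> normalised at \<open>c0 x\<close> and evaluated at \<open>c1 x\<close>; it is continuous because a path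
  from \<open>c0\<close> to \<open>c1\<close> in one fibre can be pushed to nearby fibres.\<close>

lemma continuous_logarithm_along_fibres:
  fixes S :: "'a::metric_space \<Rightarrow> complex set" and G :: "'a \<Rightarrow> complex \<Rightarrow> complex"
  assumes op: "\<And>x c. \<lbrakk>x \<in> X; c \<in> S x\<rbrakk> \<Longrightarrow> \<exists>e>0. \<forall>x'\<in>X. \<forall>c'. dist x' x < e \<and> dist c' c < e \<longrightarrow> c' \<in> S x'"
    and contr: "\<And>x. x \<in> X \<Longrightarrow> contractible (S x)"
    and G: "continuous_on (Sigma X S) (\<lambda>(x,c). G x c)"
    and nz: "\<And>x c. \<lbrakk>x \<in> X; c \<in> S x\<rbrakk> \<Longrightarrow> G x c \<noteq> 0"
    and c0: "continuous_on X c0" "\<And>x. x \<in> X \<Longrightarrow> c0 x \<in> S x"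
    and c1: "continuous_on X c1" "\<And>x. x \<in> X \<Longrightarrow> c1 x \<in> S x"
    and base: "\<And>x. x \<in> X \<Longrightarrow> G x (c0 x) = g0"
  obtains \<theta> where "continuous_on X \<theta>" "\<And>x. x \<in> X \<Longrightarrow> exp (\<theta> x) = G x (c1 x)"
proof -
  have Gx: "continuous_on (S x) (G x)" if "x \<in> X" for x
    by (rule continuous_on_compose2 [OF G, of _ "\<lambda>c. (x,c)", simplified]) (use that in \<open>auto intro!: continuous_intros\<close>)
  \<comment> \<open>The value at the base point is \<open>g0\<close> in every fibre, so
    \<open>Ln g0\<close> normalises all the logarithms at once.\<close>
  have "\<exists>l. continuous_on (S x) l \<and> (\<forall>c\<in>S x. exp (l c) = G x c) \<and> l (c0 x) = Ln g0" if x: "x \<in> X" for x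
  proof -
    obtain l where l: "continuous_on (S x) l" "\<And>c. c \<in> S x \<Longrightarrow> G x c = exp (l c)"
      using continuous_logarithm_on_contractible [OF Gx [OF x] contr [OF x]] nz [OF x] by blast
    have g0: "g0 \<noteq> 0" "exp (l (c0 x)) = g0" using base [OF x] nz [OF x c0(2) [OF x]] l(2) [OF c0(2) [OF x]] by auto
    show ?thesis
    proof (intro exI [of _ "\<lambda>c. l c - l (c0 x) + Ln g0"] conjI ballI)
      show "continuous_on (S x) (\<lambda>c. l c - l (c0 x) + Ln g0)" by (intro continuous_intros l(1))
      show "exp (l c - l (c0 x) + Ln g0) = G x c" if "c \<in> S x" for c
        using g0 l(2) [OF that] by (simp add: exp_add exp_diff)
    qed simp
  qed
  then obtain l where l: "\<And>x. x \<in> X \<Longrightarrow> continuous_on (S x) (l x)"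
    "\<And>x c. x \<in> X \<Longrightarrow> c \<in> S x \<Longrightarrow> exp (l x c) = G x c" "\<And>x. x \<in> X \<Longrightarrow> l x (c0 x) = Ln g0"
    by metis
  define \<theta> where "\<theta> x = l x (c1 x)" for x
  have step: "\<exists>e>0. \<forall>x\<in>X. dist x y < e \<longrightarrow> \<theta> x = \<theta> y + Ln (G x (c1 x) / G y (c1 y))" if y: "y \<in> X" for y
  proof -
    obtain \<gamma> where \<gamma>: "path \<gamma>" "path_image \<gamma> \<subseteq> S y" "pathstart \<gamma> = c0 y" "pathfinish \<gamma> = c1 y"
      using contractible_imp_path_connected [OF contr [OF y]] c0(2) c1(2) y unfolding path_connected_def by metis
    have \<gamma>S: "\<gamma> t \<in> S y" if "t \<in> {0..1}" for t using \<gamma>(2) that by (auto simp: path_image_def)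
    have \<gamma>c: "continuous_on {0..1} \<gamma>" using \<gamma>(1) by (simp add: path_def)
    \<comment> \<open>\<open>p x\<close> deforms the path over \<open>y\<close> into one that joins
      \<open>c0 x\<close> to \<open>c1 x\<close>.\<close>
    define p where "p x t = \<gamma> t + (1 - complex_of_real t) * (c0 x - c0 y) + complex_of_real t * (c1 x - c1 y)" for x t
    have p01: "p x 0 = c0 x" "p x 1 = c1 x" for x
      using \<gamma>(3,4) by (auto simp: p_def pathstart_def pathfinish_def)
    \<comment> \<open>The estimate keeps the quotient \<open>G x (p x t) / G y (\<gamma> t)\<close>
      in the unit disc around 1, where \<open>Ln\<close> is continuous.\<close>
    define P where "P x t \<longleftrightarrow> (x \<in> X \<longrightarrow> p x t \<in> S x \<and> norm (G x (p x t) - G y (\<gamma> t)) < norm (G y (\<gamma> t)))" for x t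
    have "\<exists>e>0. \<forall>x s. dist x y < e \<and> s \<in> {0..1} \<longrightarrow> P x s"
    proof (rule compact_uniform_neighbourhood)
      fix t :: real assume t: "t \<in> {0..1}"
      define \<epsilon> where "\<epsilon> = norm (G y (\<gamma> t)) / 3"
      have \<epsilon>: "0 < \<epsilon>" using nz [OF y \<gamma>S [OF t]] by (simp add: \<epsilon>_def)
      obtain e1 where e1: "0 < e1" "\<And>x c. \<lbrakk>x \<in> X; dist x y < e1; dist c (\<gamma> t) < e1\<rbrakk> \<Longrightarrow> c \<in> S x"
        using op [OF y \<gamma>S [OF t]] by blast
      have "\<exists>d>0. \<forall>z\<in>Sigma X S. dist z (y, \<gamma> t) < d \<longrightarrow> dist (case z of (x,c) \<Rightarrow> G x c) (case (y, \<gamma> t) of (x,c) \<Rightarrow> G x c) < \<epsilon>"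
        using G \<epsilon> y \<gamma>S [OF t] unfolding continuous_on_iff by blast
      then obtain e2 where e2: "0 < e2"
        "\<And>x c. \<lbrakk>x \<in> X; c \<in> S x; dist (x,c) (y, \<gamma> t) < e2\<rbrakk> \<Longrightarrow> dist (G x c) (G y (\<gamma> t)) < \<epsilon>"
        by auto
      define e3 where "e3 = min e1 e2 / 4"
      have e3: "0 < e3" "e3 < e1" "4 * e3 \<le> e1" "4 * e3 \<le> e2" using e1(1) e2(1) by (auto simp: e3_def min_def)
      obtain d1 where d1: "0 < d1" "\<And>s. \<lbrakk>s \<in> {0..1}; dist s t < d1\<rbrakk> \<Longrightarrow> dist (\<gamma> s) (\<gamma> t) < e3"
        using \<gamma>c t e3(1) unfolding continuous_on_iff by meson
      obtain d2 where d2: "0 < d2" "\<And>x. \<lbrakk>x \<in> X; dist x y < d2\<rbrakk> \<Longrightarrow> dist (c0 x) (c0 y) < e3"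
        using c0(1) y e3(1) unfolding continuous_on_iff by meson
      obtain d3 where d3: "0 < d3" "\<And>x. \<lbrakk>x \<in> X; dist x y < d3\<rbrakk> \<Longrightarrow> dist (c1 x) (c1 y) < e3"
        using c1(1) y e3(1) unfolding continuous_on_iff by meson
      define d where "d = min (min d1 d2) (min d3 e3)"
      have d: "0 < d" "d \<le> d1" "d \<le> d2" "d \<le> d3" "d \<le> e3"
        using d1 d2 d3 e3 by (auto simp: d_def)
      show "\<exists>e>0. \<forall>x s. dist x y < e \<and> s \<in> {0..1} \<and> dist s t < e \<longrightarrow> P x s"
      proof (intro exI [of _ d] conjI allI impI)
        fix x s assume xs: "dist x y < d \<and> s \<in> {0..1} \<and> dist s t < d"
        show "P x s" unfolding P_def
        proof
          assume x: "x \<in> X"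
          have s: "0 \<le> s" "s \<le> 1" using xs by auto
          have g: "dist (\<gamma> s) (\<gamma> t) < e3" using d1(2) [of s] xs d by auto
          have "norm ((1 - complex_of_real s) * (c0 x - c0 y)) \<le> 1 * norm (c0 x - c0 y)"
          proof -
            have "norm (1 - complex_of_real s) = \<bar>1 - s\<bar>" by (metis norm_of_real of_real_1 of_real_diff)
            then show ?thesis unfolding norm_mult using s by (intro mult_right_mono) auto
          qed
          moreover have "norm (complex_of_real s * (c1 x - c1 y)) \<le> 1 * norm (c1 x - c1 y)"
            unfolding norm_mult using s by (intro mult_right_mono) auto
          moreover have "norm (c0 x - c0 y) < e3" "norm (c1 x - c1 y) < e3"
            using d2(2) [OF x] d3(2) [OF x] xs d by (auto simp: dist_norm)
          moreover have "norm (p x s - \<gamma> t) \<le> norm (\<gamma> s - \<gamma> t) + norm ((1 - complex_of_real s) * (c0 x - c0 y))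
              + norm (complex_of_real s * (c1 x - c1 y))"
          proof -
            have "p x s - \<gamma> t = (\<gamma> s - \<gamma> t) + (1 - complex_of_real s) * (c0 x - c0 y) + complex_of_real s * (c1 x - c1 y)"
              by (simp add: p_def)
            then show ?thesis by (simp only:) (intro norm_triangle_le add_mono order_refl norm_triangle_ineq)
          qed
          ultimately have pg: "dist (p x s) (\<gamma> t) < 3 * e3" using g by (simp add: dist_norm)
          then have pS: "p x s \<in> S x" using e1(2) [OF x] xs d e3 by auto
          have "dist (x, p x s) (y, \<gamma> t) \<le> dist x y + dist (p x s) (\<gamma> t)"
            unfolding dist_Pair_Pair by (rule sqrt_sum_squares_le_sum) auto
          then have 1: "dist (G x (p x s)) (G y (\<gamma> t)) < \<epsilon>" using e2(2) [OF x pS] pg xs d e3 by auto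
          have "dist (y, \<gamma> s) (y, \<gamma> t) \<le> dist y y + dist (\<gamma> s) (\<gamma> t)"
            unfolding dist_Pair_Pair by (rule sqrt_sum_squares_le_sum) auto
          then have 2: "dist (G y (\<gamma> s)) (G y (\<gamma> t)) < \<epsilon>" using e2(2) [OF y \<gamma>S] g xs e3 by auto
          have "norm (G x (p x s) - G y (\<gamma> s)) < 2 * \<epsilon>"
            using 1 2 dist_triangle2 [of "G x (p x s)" "G y (\<gamma> s)" "G y (\<gamma> t)"] by (simp add: dist_norm)
          moreover have "3 * \<epsilon> \<le> norm (G y (\<gamma> s)) + \<epsilon>"
            using 2 norm_triangle_ineq2 [of "G y (\<gamma> t)" "G y (\<gamma> s)"] by (simp add: \<epsilon>_def dist_norm norm_minus_commute)
          ultimately show "p x s \<in> S x \<and> norm (G x (p x s) - G y (\<gamma> s)) < norm (G y (\<gamma> s))"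
            using pS by auto
        qed
      qed (use d in auto)
    qed simp
    then obtain e where e: "0 < e" "\<And>x s. dist x y < e \<Longrightarrow> s \<in> {0..1} \<Longrightarrow> P x s" by blast
    show ?thesis
    proof (intro exI [of _ e] conjI ballI impI)
      fix x assume x: "x \<in> X" and dx: "dist x y < e"
      have pS: "p x t \<in> S x" and nr: "norm (G x (p x t) - G y (\<gamma> t)) < norm (G y (\<gamma> t))" if "t \<in> {0..1}" for t
        using e(2) [OF dx that] x by (auto simp: P_def)
      have nzy: "G y (\<gamma> t) \<noteq> 0" if "t \<in> {0..1}" for t using nz [OF y \<gamma>S [OF that]] .
      have pc: "continuous_on {0..1} (p x)"
        unfolding p_def [abs_def] by (intro continuous_intros \<gamma>c)
      have c1': "continuous_on {0..1} (\<lambda>t. G x (p x t))"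
        by (rule continuous_on_compose2 [OF Gx [OF x] pc]) (use pS in auto)
      have c2': "continuous_on {0..1} (\<lambda>t. G y (\<gamma> t))"
        by (rule continuous_on_compose2 [OF Gx [OF y] \<gamma>c]) (use \<gamma>S in auto)
      have nonpos: "G x (p x t) / G y (\<gamma> t) \<notin> \<real>\<^sub>\<le>\<^sub>0" if t: "t \<in> {0..1}" for t
      proof
        assume "G x (p x t) / G y (\<gamma> t) \<in> \<real>\<^sub>\<le>\<^sub>0"
        then have "Re (G x (p x t) / G y (\<gamma> t)) \<le> 0" by (simp add: complex_nonpos_Reals_iff)
        then have "1 \<le> \<bar>Re (G x (p x t) / G y (\<gamma> t) - 1)\<bar>" by simp
        also have "\<dots> \<le> norm (G x (p x t) / G y (\<gamma> t) - 1)" by (rule abs_Re_le_cmod)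
        also have "G x (p x t) / G y (\<gamma> t) - 1 = (G x (p x t) - G y (\<gamma> t)) / G y (\<gamma> t)"
          using nzy [OF t] by (simp add: diff_divide_distrib)
        also have "norm \<dots> < 1" using nr [OF t] nzy [OF t] by (simp add: norm_divide)
        finally show False by simp
      qed
      \<comment> \<open>Both functions are logarithms of \<open>G x (p x t)\<close>. They agree at
        \<open>t = 0\<close> by the normalisation, hence at \<open>t = 1\<close>, which expresses
        \<open>\<theta> x\<close> through \<open>\<theta> y\<close>.\<close>
      have "(\<lambda>t. l x (p x t)) 0 - (\<lambda>t. l y (\<gamma> t) + Ln (G x (p x t) / G y (\<gamma> t))) 0
          = (\<lambda>t. l x (p x t)) 1 - (\<lambda>t. l y (\<gamma> t) + Ln (G x (p x t) / G y (\<gamma> t))) 1"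
      proof (rule exp_eq_imp_constant_difference [of "{0..1::real}"])
        show "continuous_on {0..1} (\<lambda>t. l x (p x t))"
          by (rule continuous_on_compose2 [OF l(1) [OF x] pc]) (use pS in auto)
        have "continuous_on {0..1} (\<lambda>t. l y (\<gamma> t))"
          by (rule continuous_on_compose2 [OF l(1) [OF y] \<gamma>c]) (use \<gamma>S in auto)
        then show "continuous_on {0..1} (\<lambda>t. l y (\<gamma> t) + Ln (G x (p x t) / G y (\<gamma> t)))"
          using c1' c2' nzy nonpos by (intro continuous_on_add continuous_on_Ln' continuous_on_divide) auto
        show "exp (l x (p x t)) = exp (l y (\<gamma> t) + Ln (G x (p x t) / G y (\<gamma> t)))" if t: "t \<in> {0..1}" for t
          using l(2) [OF x pS [OF t]] l(2) [OF y \<gamma>S [OF t]] nzy [OF t] nz [OF x pS [OF t]] by (simp add: exp_add)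
      qed auto
      moreover have "\<gamma> 0 = c0 y" "\<gamma> 1 = c1 y" using \<gamma>(3,4) by (auto simp: pathstart_def pathfinish_def)
      moreover have "g0 \<noteq> 0" using base [OF y] nz [OF y c0(2) [OF y]] by auto
      ultimately show "\<theta> x = \<theta> y + Ln (G x (c1 x) / G y (c1 y))"
        using l(3) [OF x] l(3) [OF y] base [OF x] base [OF y] by (simp add: p01 \<theta>_def)
    qed fact
  qed
  have Gc1: "continuous_on X (\<lambda>x. G x (c1 x))"
    by (rule continuous_on_compose2 [OF G, of _ "\<lambda>x. (x, c1 x)", simplified]) (use c1 in \<open>auto intro!: continuous_intros\<close>)
  have "continuous_on X \<theta>"
    unfolding continuous_on_def
  proof
    fix y assume y: "y \<in> X"
    obtain e where e: "0 < e" "\<And>x. x \<in> X \<Longrightarrow> dist x y < e \<Longrightarrow> \<theta> x = \<theta> y + Ln (G x (c1 x) / G y (c1 y))"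
      using step [OF y] by blast
    have ny: "G y (c1 y) \<noteq> 0" using nz [OF y c1(2) [OF y]] .
    have "((\<lambda>x. G x (c1 x)) \<longlongrightarrow> G y (c1 y)) (at y within X)" using Gc1 y by (auto simp: continuous_on_def)
    then have "((\<lambda>x. G x (c1 x) / G y (c1 y)) \<longlongrightarrow> G y (c1 y) / G y (c1 y)) (at y within X)"
      using ny by (intro tendsto_intros)
    then have "((\<lambda>x. \<theta> y + Ln (G x (c1 x) / G y (c1 y))) \<longlongrightarrow> \<theta> y + Ln 1) (at y within X)"
      using ny by (intro tendsto_intros) auto
    moreover have "\<forall>\<^sub>F x in at y within X. \<theta> y + Ln (G x (c1 x) / G y (c1 y)) = \<theta> x"
      unfolding eventually_at using e by (intro exI [of _ e]) auto
    ultimately show "(\<theta> \<longlongrightarrow> \<theta> y) (at y within X)"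
      by (simp add: tendsto_cong)
  qed
  then show ?thesis using that [of \<theta>] l(2) c1(2) by (auto simp: \<theta>_def)
qed

section \<open>Complex linear functionals and slices by complex lines\<close>

text \<open>Bilinear rather than Hermitian: \<open>complex_dot a\<close> is complex linear, so its
  composition with a holomorphic map is holomorphic.\<close>

definition complex_dot :: "complex^'n \<Rightarrow> complex^'n \<Rightarrow> complex" where
  "complex_dot a z = (\<Sum>i\<in>UNIV. a $ i * z $ i)"

lemma complex_dot_add: "complex_dot a (x + y) = complex_dot a x + complex_dot a y"
  by (simp add: complex_dot_def distrib_left sum.distrib)

lemma complex_dot_scale: "complex_dot a (c *s x) = c * complex_dot a x"
  by (simp add: complex_dot_def sum_distrib_left ac_simps)

lemma complex_dot_scaleR: "complex_dot a (r *\<^sub>R x) = r *\<^sub>R complex_dot a x"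
  by (simp add: complex_dot_def scaleR_right.sum)

lemma bounded_linear_complex_dot: "bounded_linear (complex_dot a)"
proof -
  have "linear (complex_dot a)" by (rule linearI) (auto simp: complex_dot_add complex_dot_scaleR)
  then show ?thesis by (simp add: linear_conv_bounded_linear)
qed

lemma complex_dot_diff: "complex_dot a (x - y) = complex_dot a x - complex_dot a y"
  using linear_diff [OF bounded_linear.linear [OF bounded_linear_complex_dot]] .

lemma complex_dot_0: "complex_dot a 0 = 0"
  by (simp add: complex_dot_def)

lemma continuous_on_complex_dot [continuous_intros]:
  "continuous_on S f \<Longrightarrow> continuous_on S (\<lambda>x. complex_dot a (f x))"
  by (rule bounded_linear.continuous_on [OF bounded_linear_complex_dot])

lemma norm_scale_complex_vec: "norm (c *s (x::complex^'n)) = norm c * norm x"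
proof -
  have "(\<lambda>i. cmod ((c *s x) $ i)) = (\<lambda>i. cmod c * cmod (x $ i))"
    by (simp add: norm_mult)
  then show ?thesis
    unfolding norm_vec_def by (simp add: norm_mult L2_set_right_distrib)
qed

lemma bounded_bilinear_complex_scale: "bounded_bilinear (\<lambda>c (x::complex^'n). c *s x)"
proof (unfold_locales)
  show "(a + a') *s b = a *s b + a' *s b" for a a' :: complex and b :: "complex^'n"
    by (simp add: vec_eq_iff distrib_right)
  show "a *s (b + b') = a *s b + a *s b'" for a :: complex and b b' :: "complex^'n"
    by (simp add: vec_eq_iff distrib_left)
  show "r *\<^sub>R a *s b = r *\<^sub>R (a *s b)" for r and a :: complex and b :: "complex^'n"
    by (simp add: vec_eq_iff)
  show "a *s r *\<^sub>R b = r *\<^sub>R (a *s b)" for r and a :: complex and b :: "complex^'n"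
    by (simp add: vec_eq_iff)
  show "\<exists>K. \<forall>a b. norm (a *s (b::complex^'n)) \<le> norm a * norm b * K"
    by (intro exI [of _ 1]) (simp add: norm_scale_complex_vec)
qed

lemmas continuous_on_complex_scale [continuous_intros] =
  bounded_bilinear.continuous_on [OF bounded_bilinear_complex_scale]

text \<open>In the complex parameter the slices of all lines become subsets of one plane, in which a
  logarithm can be followed from slice to slice. The degenerate direction \<open>w = 0\<close>,
  whose slice is the whole plane or empty, occurs when the base point is joined to itself.\<close>

lemma contractible_slice:
  fixes \<Omega> :: "(complex^'n) set"
  assumes "C_convex \<Omega>" "\<Omega> \<noteq> {}"
  shows "contractible {c. x + c *s w \<in> \<Omega>}"
proof (cases "w = 0")
  case True
  then have "{c. x + c *s w \<in> \<Omega>} = UNIV \<or> {c. x + c *s w \<in> \<Omega>} = {}" by auto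
  then show ?thesis by auto
next
  case False
  define L where "L = {x + c *s w | c. c \<in> UNIV}"
  have "complex_line L" unfolding complex_line_def L_def using False by blast
  then have "contractible (\<Omega> \<inter> L)"
    using assms(1) unfolding C_convex_def by (metis contractible_empty)
  moreover have "\<Omega> \<inter> L homeomorphic {c. x + c *s w \<in> \<Omega>}"
  proof -
    obtain i where i: "w $ i \<noteq> 0" using False by (auto simp: vec_eq_iff)
    show ?thesis
    proof (rule homeomorphicI [where f = "\<lambda>z. (z $ i - x $ i) / w $ i" and g = "\<lambda>c. x + c *s w"])
      show "(\<lambda>z. (z $ i - x $ i) / w $ i) ` (\<Omega> \<inter> L) = {c. x + c *s w \<in> \<Omega>}"
      proof (intro set_eqI iffI)
        fix c assume "c \<in> {c. x + c *s w \<in> \<Omega>}"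
        then show "c \<in> (\<lambda>z. (z $ i - x $ i) / w $ i) ` (\<Omega> \<inter> L)"
          using i by (intro image_eqI [of _ _ "x + c *s w"]) (auto simp: L_def)
      qed (use i in \<open>auto simp: L_def\<close>)
      show "(\<lambda>c. x + c *s w) ` {c. x + c *s w \<in> \<Omega>} = \<Omega> \<inter> L" by (auto simp: L_def)
      show "continuous_on (\<Omega> \<inter> L) (\<lambda>z. (z $ i - x $ i) / w $ i)" using i by (intro continuous_intros) auto
      show "continuous_on {c. x + c *s w \<in> \<Omega>} (\<lambda>c. x + c *s w)" by (intro continuous_intros)
    qed (use i in \<open>auto simp: L_def\<close>)
  qed
  ultimately show ?thesis by (metis homeomorphic_contractible)
qed

lemma slice_jointly_open:
  fixes \<Omega> :: "(complex^'n) set" and f :: "'a::metric_space \<Rightarrow> complex \<Rightarrow> complex^'n"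
  assumes "open \<Omega>" and f: "continuous_on (X \<times> UNIV) (\<lambda>(x,c). f x c)" and x: "x \<in> X" "f x c \<in> \<Omega>"
  shows "\<exists>e>0. \<forall>x'\<in>X. \<forall>c'. dist x' x < e \<and> dist c' c < e \<longrightarrow> f x' c' \<in> \<Omega>"
proof -
  obtain r where r: "0 < r" "ball (f x c) r \<subseteq> \<Omega>" using assms(1) x(2) by (meson open_contains_ball)
  have "\<exists>d>0. \<forall>z\<in>X \<times> UNIV. dist z (x,c) < d \<longrightarrow> dist (case z of (x,c) \<Rightarrow> f x c) (case (x,c) of (x,c) \<Rightarrow> f x c) < r"
    using f r(1) x(1) unfolding continuous_on_iff by blast
  then obtain d where d: "0 < d" "\<And>x' c'. x' \<in> X \<Longrightarrow> dist (x',c') (x,c) < d \<Longrightarrow> dist (f x' c') (f x c) < r"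
    by auto
  show ?thesis
  proof (intro exI [of _ "d/2"] conjI ballI allI impI)
    fix x' c' assume x': "x' \<in> X" and D: "dist x' x < d/2 \<and> dist c' c < d/2"
    have "dist (x',c') (x,c) \<le> dist x' x + dist c' c"
      unfolding dist_Pair_Pair by (rule sqrt_sum_squares_le_sum) auto
    then have "dist (f x' c') (f x c) < r" using d(2) [OF x'] D by auto
    then show "f x' c' \<in> \<Omega>" using r(2) by (auto simp: dist_commute)
  qed (use d in simp)
qed

section \<open>Hyperplanes omitted by \<complex>-convex sets\<close>

text \<open>Along the circle \<open>z t\<close> the sum of \<open>\<theta> (z t)\<close> and
  \<open>\<i> * t\<close> is a continuous logarithm of a constant, hence constant; after a full turn
  the first summand returns to its value and the second does not.\<close>

lemma no_continuous_logarithm_of_inverse_on_circle: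
  fixes \<theta> :: "complex \<Rightarrow> complex"
  assumes "0 < r" "k \<noteq> 0" "continuous_on (sphere 0 r) \<theta>" "\<And>z. z \<in> sphere 0 r \<Longrightarrow> exp (\<theta> z) = k / z"
  shows False
proof -
  define z where "z t = complex_of_real r * exp (\<i> * complex_of_real t)" for t
  have z: "z t \<in> sphere 0 r" for t using \<open>0 < r\<close> by (simp add: z_def norm_mult)
  have "(\<lambda>t. \<theta> (z t) + \<i> * complex_of_real t) 0 - (\<lambda>t. Ln (k / complex_of_real r)) 0
      = (\<lambda>t. \<theta> (z t) + \<i> * complex_of_real t) (2 * pi) - (\<lambda>t. Ln (k / complex_of_real r)) (2 * pi)"
  proof (rule exp_eq_imp_constant_difference [of "{0..2*pi}"])
    have "continuous_on {0..2*pi} z" unfolding z_def [abs_def] by (intro continuous_intros)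
    then have "continuous_on {0..2*pi} (\<lambda>t. \<theta> (z t))"
      by (rule continuous_on_compose2 [OF assms(3)]) (use z in blast)
    then show "continuous_on {0..2*pi} (\<lambda>t. \<theta> (z t) + \<i> * complex_of_real t)" by (intro continuous_intros)
    show "exp (\<theta> (z t) + \<i> * complex_of_real t) = exp (Ln (k / complex_of_real r))" if "t \<in> {0..2*pi}" for t
      using assms(1,2) by (simp add: exp_add assms(4) [OF z]) (simp add: z_def)
  qed auto
  moreover have "z (2 * pi) = z 0"
  proof -
    have "\<i> * complex_of_real (2 * pi) = 2 * complex_of_real pi * \<i>" by simp
    then show ?thesis unfolding z_def by (simp only: exp_two_pi_i) simp
  qed
  ultimately show False by simp
qed

text \<open>If the hyperplane \<open>complex_dot a (z - p) = 0\<close> met \<open>\<Omega>\<close> in \<open>p + v\<close>, consider the pencil of complex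
  lines through \<open>p\<close> with directions \<open>v + \<epsilon> n\<close>, where \<open>n\<close> points into \<open>\<Omega>\<close> and \<open>\<bar>\<epsilon>\<bar>\<close> is small and fixed. Their
  slices of \<open>\<Omega>\<close> are contractible, omit the parameter \<open>0\<close>, and contain both \<open>1\<close> and \<open>\<tau>/\<epsilon>\<close>. Following
  the logarithm of the parameter from \<open>1\<close> to \<open>\<tau>/\<epsilon>\<close> gives a continuous logarithm of \<open>\<tau>/\<epsilon>\<close> on a circle.\<close>

lemma C_convex_tangent_hyperplane:
  fixes \<Omega> :: "(complex^'n) set" and r :: "complex^'n \<Rightarrow> real"
  assumes \<Omega>: "open \<Omega>" "C_convex \<Omega>" and p: "p \<notin> \<Omega>"
    and r: "(r has_derivative (\<lambda>v. Re (complex_dot a v))) (at p)" "r p = 0"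
    and inside: "0 < \<rho>" "\<And>z. \<lbrakk>dist z p < \<rho>; 0 < r z\<rbrakk> \<Longrightarrow> z \<in> \<Omega>"
    and n: "0 < Re (complex_dot a n)" and z: "z \<in> \<Omega>"
  shows "complex_dot a (z - p) \<noteq> 0"
proof
  assume a0: "complex_dot a (z - p) = 0"
  define v where "v = z - p"
  have v: "complex_dot a v = 0" "p + v \<in> \<Omega>" using a0 z by (auto simp: v_def)
  obtain e where e: "0 < e" "ball (p + v) e \<subseteq> \<Omega>" using \<Omega>(1) v(2) by (meson open_contains_ball)
  have n0: "n \<noteq> 0" using n by (auto simp: complex_dot_0)
  define \<epsilon>0 where "\<epsilon>0 = e / (2 * norm n)"
  have \<epsilon>0: "0 < \<epsilon>0" using e n0 by (simp add: \<epsilon>0_def)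
  have near1: "p + 1 *s (v + \<epsilon> *s n) \<in> \<Omega>" if "\<epsilon> \<in> sphere 0 \<epsilon>0" for \<epsilon>
  proof -
    have "dist (p + v) (p + 1 *s (v + \<epsilon> *s n)) = \<epsilon>0 * norm n"
      using that by (simp add: dist_norm norm_scale_complex_vec)
    also have "\<dots> < e" using e n0 by (simp add: \<epsilon>0_def)
    finally show ?thesis using e(2) by auto
  qed
  define K where "K = norm v / \<epsilon>0 + norm n"
  have K: "0 < K" using n0 \<epsilon>0 by (simp add: K_def add_nonneg_pos)
  define d where "d = Re (complex_dot a n)"
  have d: "0 < d" using n by (simp add: d_def)
  \<comment> \<open>The linear gain of \<open>r\<close> will be \<open>\<tau> * d\<close>, and the
    error is at most \<open>\<eta> * \<tau> * K\<close>, half of that gain.\<close>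
  define \<eta> where "\<eta> = d / (2 * K)"
  have \<eta>: "0 < \<eta>" using d K by (simp add: \<eta>_def)
  obtain \<delta> where \<delta>: "0 < \<delta>" "\<And>y. norm (y - p) < \<delta> \<Longrightarrow> norm (r y - r p - Re (complex_dot a (y - p))) \<le> \<eta> * norm (y - p)"
    using r(1) \<eta> unfolding has_derivative_at_alt by blast
  define \<tau> where "\<tau> = min \<delta> \<rho> / (2 * K)"
  have \<tau>: "0 < \<tau>" "\<tau> * K < \<delta>" "\<tau> * K < \<rho>"
    using \<delta>(1) inside(1) K by (auto simp: \<tau>_def min_def)
  \<comment> \<open>\<open>v\<close> lies in the complex tangent hyperplane, so its multiple by
    \<open>\<tau>/\<epsilon>\<close> leaves \<open>r\<close> unchanged to first order whatever the
    argument of \<open>\<epsilon>\<close>; the rest of the displacement is \<open>\<tau>\<close>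
    times \<open>n\<close>, which points inwards.\<close>
  have near2: "p + (complex_of_real \<tau> / \<epsilon>) *s (v + \<epsilon> *s n) \<in> \<Omega>" if "\<epsilon> \<in> sphere 0 \<epsilon>0" for \<epsilon>
  proof -
    have \<epsilon>: "\<epsilon> \<noteq> 0" "norm \<epsilon> = \<epsilon>0" using that \<epsilon>0 by auto
    define w where "w = (complex_of_real \<tau> / \<epsilon>) *s (v + \<epsilon> *s n)"
    have w: "w = (complex_of_real \<tau> / \<epsilon>) *s v + complex_of_real \<tau> *s n"
      using \<epsilon> by (simp add: w_def vec_eq_iff distrib_left)
    have "norm w \<le> norm ((complex_of_real \<tau> / \<epsilon>) *s v) + norm (complex_of_real \<tau> *s n)"
      unfolding w by (rule norm_triangle_ineq)
    also have "\<dots> = \<tau> * K" using \<epsilon> \<tau> by (simp add: norm_scale_complex_vec norm_divide K_def field_simps)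
    finally have nw: "norm w \<le> \<tau> * K" .
    have dw: "Re (complex_dot a w) = \<tau> * d"
      unfolding w by (simp add: complex_dot_add complex_dot_scale v(1) d_def)
    have "norm (r (p + w) - r p - Re (complex_dot a (p + w - p))) \<le> \<eta> * norm (p + w - p)"
      by (rule \<delta>(2)) (use nw \<tau> in simp)
    then have "\<bar>r (p + w) - \<tau> * d\<bar> \<le> \<eta> * norm w" by (simp add: r(2) dw)
    also have "\<dots> \<le> \<eta> * (\<tau> * K)" using nw \<eta> by (intro mult_left_mono) auto
    also have "\<dots> = \<tau> * d / 2" using K by (simp add: \<eta>_def)
    finally have "0 < r (p + w)" using d \<tau>(1) mult_pos_pos [OF \<tau>(1) d] by linarith
    then show ?thesis unfolding w_def [symmetric] by (intro inside(2)) (use nw \<tau> in \<open>auto simp: dist_norm\<close>)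
  qed
  define S where "S \<epsilon> = {c. p + c *s (v + \<epsilon> *s n) \<in> \<Omega>}" for \<epsilon>
  have cont: "continuous_on (sphere 0 \<epsilon>0 \<times> UNIV) (\<lambda>(\<epsilon>,c). p + c *s (v + \<epsilon> *s n))"
    unfolding case_prod_unfold by (intro continuous_intros)
  obtain \<theta> where \<theta>: "continuous_on (sphere 0 \<epsilon>0) \<theta>"
    "\<And>\<epsilon>. \<epsilon> \<in> sphere 0 \<epsilon>0 \<Longrightarrow> exp (\<theta> \<epsilon>) = complex_of_real \<tau> / \<epsilon>"
  proof (rule continuous_logarithm_along_fibres [of "sphere 0 \<epsilon>0" S "\<lambda>_ c. c" "\<lambda>_. 1" "\<lambda>\<epsilon>. complex_of_real \<tau> / \<epsilon>" 1])
    show "\<exists>e>0. \<forall>x'\<in>sphere 0 \<epsilon>0. \<forall>c'. dist x' x < e \<and> dist c' c < e \<longrightarrow> c' \<in> S x'"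
      if "x \<in> sphere 0 \<epsilon>0" "c \<in> S x" for x c
      using slice_jointly_open [OF \<Omega>(1) cont that(1)] that(2) by (simp add: S_def)
    show "contractible (S \<epsilon>)" for \<epsilon> unfolding S_def using \<Omega>(2) z by (intro contractible_slice) auto
    show "continuous_on (Sigma (sphere 0 \<epsilon>0) S) (\<lambda>(x, c). c)"
      unfolding case_prod_unfold by (intro continuous_intros)
    show "c \<noteq> 0" if "c \<in> S x" for x c using that p by (auto simp: S_def)
    show "continuous_on (sphere 0 \<epsilon>0) (\<lambda>\<epsilon>. complex_of_real \<tau> / \<epsilon>)"
      using \<epsilon>0 by (intro continuous_intros) auto
  qed (use near1 near2 in \<open>auto simp: S_def\<close>)
  show False
    by (rule no_continuous_logarithm_of_inverse_on_circle [OF \<epsilon>0 _ \<theta>]) (use \<tau> in auto)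
qed

text \<open>Stands in for simple connectivity of the image of \<open>\<Omega>\<close> under the
  functional. Lines through a fixed \<open>x0\<close> define \<open>\<Lambda>\<close>. It depends on
  the value of the functional alone, because the slice through \<open>z\<close> and \<open>w\<close>
  is connected and the functional is constant on it.\<close>

lemma C_convex_logarithm_of_affine:
  fixes \<Omega> :: "(complex^'n) set"
  assumes \<Omega>: "open \<Omega>" "C_convex \<Omega>" and nz: "\<And>z. z \<in> \<Omega> \<Longrightarrow> complex_dot a z \<noteq> b"
  obtains \<Lambda> where "continuous_on \<Omega> \<Lambda>" "\<And>z. z \<in> \<Omega> \<Longrightarrow> exp (\<Lambda> z) = complex_dot a z - b"
    "\<And>z w. \<lbrakk>z \<in> \<Omega>; w \<in> \<Omega>; complex_dot a z = complex_dot a w\<rbrakk> \<Longrightarrow> \<Lambda> z = \<Lambda> w"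
proof (cases "\<Omega> = {}")
  case True then show ?thesis using that [of "\<lambda>_. 0"] by simp
next
  case False
  then obtain x0 where x0: "x0 \<in> \<Omega>" by blast
  define S where "S x = {c. x0 + c *s (x - x0) \<in> \<Omega>}" for x
  have cont: "continuous_on (\<Omega> \<times> UNIV) (\<lambda>(x,c). x0 + c *s (x - x0))"
    unfolding case_prod_unfold by (intro continuous_intros)
  obtain \<Lambda> where \<Lambda>: "continuous_on \<Omega> \<Lambda>"
    "\<And>x. x \<in> \<Omega> \<Longrightarrow> exp (\<Lambda> x) = complex_dot a (x0 + 1 *s (x - x0)) - b"
  proof (rule continuous_logarithm_along_fibres [of \<Omega> S "\<lambda>x c. complex_dot a (x0 + c *s (x - x0)) - b" "\<lambda>_. 0" "\<lambda>_. 1" "complex_dot a x0 - b"])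
    show "\<exists>e>0. \<forall>x'\<in>\<Omega>. \<forall>c'. dist x' x < e \<and> dist c' c < e \<longrightarrow> c' \<in> S x'"
      if "x \<in> \<Omega>" "c \<in> S x" for x c
      using slice_jointly_open [OF \<Omega>(1) cont that(1)] that(2) by (simp add: S_def)
    show "contractible (S x)" for x unfolding S_def using \<Omega>(2) x0 by (intro contractible_slice) auto
    show "continuous_on (Sigma \<Omega> S) (\<lambda>(x, c). complex_dot a (x0 + c *s (x - x0)) - b)"
      unfolding case_prod_unfold by (intro continuous_intros)
    show "complex_dot a (x0 + c *s (x - x0)) - b \<noteq> 0" if "c \<in> S x" for x c
      using nz [of "x0 + c *s (x - x0)"] that by (simp add: S_def)
    show "0 \<in> S x" "1 \<in> S x" if "x \<in> \<Omega>" for x using x0 that by (simp_all add: S_def)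
    show "complex_dot a (x0 + 0 *s (x - x0)) - b = complex_dot a x0 - b" for x by simp
  qed (rule continuous_on_const, rule continuous_on_const, rule that, assumption, blast)
  have e\<Lambda>: "exp (\<Lambda> z) = complex_dot a z - b" if "z \<in> \<Omega>" for z using \<Lambda>(2) [OF that] by simp
  show ?thesis
  proof (rule that [OF \<Lambda>(1) e\<Lambda>])
    fix z w assume zw: "z \<in> \<Omega>" "w \<in> \<Omega>" "complex_dot a z = complex_dot a w"
    define T where "T = {c. z + c *s (w - z) \<in> \<Omega>}"
    have "connected T" unfolding T_def
      using contractible_slice [OF \<Omega>(2) False] by (intro contractible_imp_connected)
    moreover have "continuous_on T (\<lambda>c. \<Lambda> (z + c *s (w - z)))"
      by (rule continuous_on_compose2 [OF \<Lambda>(1)]) (auto simp: T_def intro!: continuous_intros)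
    ultimately have "(\<lambda>c. \<Lambda> (z + c *s (w - z))) 0 - (\<lambda>c. \<Lambda> z) 0 = (\<lambda>c. \<Lambda> (z + c *s (w - z))) 1 - (\<lambda>c. \<Lambda> z) 1"
    proof (rule exp_eq_imp_constant_difference)
      show "exp (\<Lambda> (z + c *s (w - z))) = exp (\<Lambda> z)" if "c \<in> T" for c
      proof -
        have "complex_dot a (z + c *s (w - z)) = complex_dot a z"
          using zw(3) by (simp add: complex_dot_add complex_dot_scale complex_dot_diff)
        then show ?thesis using e\<Lambda> [of "z + c *s (w - z)"] e\<Lambda> [OF zw(1)] that by (simp add: T_def)
      qed
    qed (use zw in \<open>auto simp: T_def\<close>)
    then show "\<Lambda> z = \<Lambda> w" by simp
  qed auto
qed

section \<open>Boundaries of class C1\<close>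

text \<open>\<open>\<nu>\<close> is a direction of increase, uniformly over the ball: moving by a
  \<open>w\<close> in the cone of aperture \<open>c\<close> around it raises \<open>r\<close> at
  rate at least 1. The sign of \<open>r\<close> does not yet tell on which side
  \<open>\<Omega>\<close> lies.\<close>

definition boundary_chart :: "'a::euclidean_space set \<Rightarrow> 'a \<Rightarrow> ('a \<Rightarrow> real) \<Rightarrow> 'a \<Rightarrow> real \<Rightarrow> real \<Rightarrow> bool" where
  "boundary_chart \<Omega> q r \<nu> c \<rho> \<longleftrightarrow> 0 < c \<and> 0 < \<rho> \<and> continuous_on (ball q \<rho>) r \<and>
     (\<forall>x\<in>ball q \<rho>. r x = 0 \<longleftrightarrow> x \<in> frontier \<Omega>) \<and>
     (\<forall>x w s. x \<in> ball q \<rho> \<and> x + w \<in> ball q \<rho> \<and> 0 < s \<and> norm (w - s *\<^sub>R \<nu>) \<le> c * s \<longrightarrow> r x + s \<le> r (x + w))"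

lemma boundary_chart_increase:
  assumes "boundary_chart \<Omega> q r \<nu> c \<rho>" "x \<in> ball q \<rho>" "x + w \<in> ball q \<rho>" "0 < s" "norm (w - s *\<^sub>R \<nu>) \<le> c * s"
  shows "r x + s \<le> r (x + w)"
  using assms unfolding boundary_chart_def by blast

lemma C1_hypersurface_boundary_chart:
  fixes \<Omega> :: "'a::euclidean_space set"
  assumes "C1_hypersurface (frontier \<Omega>)" and q: "q \<in> frontier \<Omega>"
  obtains r D \<nu> c \<rho> where "boundary_chart \<Omega> q r \<nu> c \<rho>" "(r has_derivative D) (at q)" "0 < D \<nu>"
proof -
  obtain U r and r' :: "'a \<Rightarrow> 'a \<Rightarrow>\<^sub>L real" where U: "open U" "q \<in> U"
    and r: "\<And>x. x \<in> U \<Longrightarrow> (r has_derivative blinfun_apply (r' x)) (at x)"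
    and r': "continuous_on U r'" "\<And>x. x \<in> U \<Longrightarrow> r' x \<noteq> 0" and z: "frontier \<Omega> \<inter> U = {x \<in> U. r x = 0}"
    using assms(1)[unfolded C1_hypersurface_def, rule_format, OF q] by blast
  obtain v where v: "blinfun_apply (r' q) v \<noteq> 0" using r'(2) [OF U(2)] by (metis blinfun_eqI blinfun.zero_left)
  \<comment> \<open>Scaled so that the differential at \<open>q\<close> gains \<open>2 * s\<close>.
    By the choices of \<open>c\<close> and \<open>\<eta>\<close>, the deviation of \<open>w\<close>
    from \<open>\<nu>\<close> and the variation of the differential each cost at most
    \<open>s / 2\<close>, which leaves \<open>s\<close>.\<close>
  define \<nu> where "\<nu> = (2 / blinfun_apply (r' q) v) *\<^sub>R v"
  have \<nu>: "blinfun_apply (r' q) \<nu> = 2" using v by (simp add: \<nu>_def blinfun.scaleR_right)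
  define M where "M = norm (r' q) + 1"
  have M: "0 < M" "norm (r' q) \<le> M" by (auto simp: M_def add_nonneg_pos)
  define c where "c = 1 / (2 * M)"
  have c: "0 < c" "M * c = 1/2" using M by (auto simp: c_def)
  define \<eta> where "\<eta> = 1 / (2 * (norm \<nu> + c))"
  have nc: "0 < norm \<nu> + c" using c by (simp add: add_nonneg_pos)
  have \<eta>: "0 < \<eta>" "\<eta> * (norm \<nu> + c) = 1/2" using nc by (auto simp: \<eta>_def)
  obtain \<rho>1 where \<rho>1: "0 < \<rho>1" "ball q \<rho>1 \<subseteq> U" using U by (meson open_contains_ball)
  obtain \<rho>2 where \<rho>2: "0 < \<rho>2" "\<And>x. \<lbrakk>x \<in> U; dist x q < \<rho>2\<rbrakk> \<Longrightarrow> dist (r' x) (r' q) < \<eta>"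
    using r'(1)[unfolded continuous_on_iff, rule_format, OF U(2) \<eta>(1)] by blast
  define \<rho> where "\<rho> = min \<rho>1 \<rho>2"
  have \<rho>: "0 < \<rho>" "ball q \<rho> \<subseteq> U"
    using \<rho>1 \<rho>2(1) by (auto simp: \<rho>_def)
  have r'\<eta>: "norm (r' x - r' q) \<le> \<eta>" if "x \<in> ball q \<rho>" for x
  proof -
    have "dist x q < \<rho>2" using that by (simp add: \<rho>_def dist_commute)
    then have "dist (r' x) (r' q) < \<eta>" using \<rho>(2) that by (intro \<rho>2(2)) auto
    then show ?thesis by (simp add: dist_norm)
  qed
  have "boundary_chart \<Omega> q r \<nu> c \<rho>"
    unfolding boundary_chart_def
  proof (intro conjI allI impI ballI)
    show "0 < c" "0 < \<rho>" by fact+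
    show "continuous_on (ball q \<rho>) r"
      using r \<rho>(2) by (meson continuous_at_imp_continuous_on has_derivative_continuous subsetD)
    show "(r x = 0) = (x \<in> frontier \<Omega>)" if "x \<in> ball q \<rho>" for x using z \<rho>(2) that by blast
    fix x w s assume A: "x \<in> ball q \<rho> \<and> x + w \<in> ball q \<rho> \<and> 0 < s \<and> norm (w - s *\<^sub>R \<nu>) \<le> c * s"
    have seg: "x + t *\<^sub>R w \<in> ball q \<rho>" if "0 \<le> t" "t \<le> 1" for t
    proof -
      have "(1 - t) *\<^sub>R x + t *\<^sub>R (x + w) \<in> ball q \<rho>"
        using A that by (intro convexD [OF convex_ball]) auto
      then show ?thesis by (simp add: algebra_simps)
    qed
    have "\<exists>t>0. t < 1 \<and> r (x + 1 *\<^sub>R w) - r (x + 0 *\<^sub>R w) = (1 - 0) * blinfun_apply (r' (x + t *\<^sub>R w)) w"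
    proof (rule MVT2 [of 0 1 "\<lambda>t. r (x + t *\<^sub>R w)" "\<lambda>t. blinfun_apply (r' (x + t *\<^sub>R w)) w"])
      fix t :: real assume t: "0 \<le> t" "t \<le> 1"
      have "((\<lambda>t. x + t *\<^sub>R w) has_derivative (\<lambda>h. h *\<^sub>R w)) (at t)"
        by (auto intro!: derivative_eq_intros)
      from has_derivative_compose [OF this r [OF subsetD [OF \<rho>(2) seg [OF t]]]]
      have "((\<lambda>t. r (x + t *\<^sub>R w)) has_derivative (\<lambda>h. blinfun_apply (r' (x + t *\<^sub>R w)) (h *\<^sub>R w))) (at t)" .
      then show "((\<lambda>t. r (x + t *\<^sub>R w)) has_real_derivative blinfun_apply (r' (x + t *\<^sub>R w)) w) (at t)"
        unfolding has_field_derivative_def by (simp add: blinfun.scaleR_right mult.commute [of _ "blinfun_apply _ _"])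
    qed simp
    then obtain t where t: "0 < t" "t < 1" "r (x + w) - r x = blinfun_apply (r' (x + t *\<^sub>R w)) w" by auto
    define \<xi> where "\<xi> = x + t *\<^sub>R w"
    have \<xi>: "norm (r' \<xi> - r' q) \<le> \<eta>" unfolding \<xi>_def using seg t by (intro r'\<eta>) auto
    have nw: "norm w \<le> s * (norm \<nu> + c)"
    proof -
      have "norm w \<le> norm (s *\<^sub>R \<nu>) + norm (w - s *\<^sub>R \<nu>)" by (metis add.commute diff_add_cancel norm_triangle_ineq)
      then show ?thesis using A by (simp add: algebra_simps)
    qed
    have "\<bar>blinfun_apply (r' \<xi> - r' q) w\<bar> \<le> norm (r' \<xi> - r' q) * norm w"
      using norm_blinfun [of "r' \<xi> - r' q" w] by simp
    also have "\<dots> \<le> \<eta> * (s * (norm \<nu> + c))" using \<xi> nw \<eta> by (intro mult_mono) auto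
    also have "\<dots> = s / 2" by (simp only: mult.left_commute [of \<eta> s] \<eta>(2) times_divide_eq_right mult_1_right)
    finally have 1: "\<bar>blinfun_apply (r' \<xi> - r' q) w\<bar> \<le> s / 2" .
    have "\<bar>blinfun_apply (r' q) (w - s *\<^sub>R \<nu>)\<bar> \<le> norm (r' q) * norm (w - s *\<^sub>R \<nu>)"
      using norm_blinfun [of "r' q" "w - s *\<^sub>R \<nu>"] by simp
    also have "\<dots> \<le> M * (c * s)" using A M by (intro mult_mono) auto
    also have "\<dots> = s / 2" by (simp only: mult.assoc [symmetric] c(2) times_divide_eq_left mult_1_left)
    finally have 2: "\<bar>blinfun_apply (r' q) (w - s *\<^sub>R \<nu>)\<bar> \<le> s / 2" .
    have "blinfun_apply (r' \<xi>) w = blinfun_apply (r' \<xi> - r' q) w + blinfun_apply (r' q) (w - s *\<^sub>R \<nu>) + s * 2"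
      by (simp add: blinfun.diff_left blinfun.diff_right blinfun.scaleR_right \<nu>)
    then have "s \<le> blinfun_apply (r' \<xi>) w" using 1 2 by linarith
    then show "r x + s \<le> r (x + w)" using t(3) by (simp add: \<xi>_def)
  qed
  then show ?thesis using that r [OF U(2)] \<nu> by force
qed

lemma boundary_chart_uminus:
  assumes "boundary_chart \<Omega> q r \<nu> c \<rho>"
  shows "boundary_chart \<Omega> q (\<lambda>x. - r x) (- \<nu>) c \<rho>"
  unfolding boundary_chart_def
proof (intro conjI allI impI ballI)
  show "0 < c" "0 < \<rho>" "continuous_on (ball q \<rho>) (\<lambda>x. - r x)"
    using assms by (auto simp: boundary_chart_def intro: continuous_on_minus)
  show "(- r x = 0) = (x \<in> frontier \<Omega>)" if "x \<in> ball q \<rho>" for x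
    using assms that by (auto simp: boundary_chart_def)
  fix x w s assume A: "x \<in> ball q \<rho> \<and> x + w \<in> ball q \<rho> \<and> 0 < s \<and> norm (w - s *\<^sub>R - \<nu>) \<le> c * s"
  have "- w - s *\<^sub>R \<nu> = - (w - s *\<^sub>R - \<nu>)" by simp
  then have "norm (- w - s *\<^sub>R \<nu>) \<le> c * s" using A by (metis norm_minus_cancel)
  then have "r (x + w) + s \<le> r ((x + w) + (- w))"
    using A by (intro boundary_chart_increase [OF assms]) auto
  then show "- r x + s \<le> - r (x + w)" by simp
qed

section \<open>Interior cones at the frontier\<close>

text \<open>An open cone without its apex, written as a union of balls so that the inscribed balls,
  which bound the Kobayashi metric from above, can be read off.\<close>

definition truncated_cone :: "'a::euclidean_space \<Rightarrow> 'a \<Rightarrow> real \<Rightarrow> real \<Rightarrow> 'a set" where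
  "truncated_cone x \<nu> c t = (\<Union>s\<in>{0<..t}. ball (x + s *\<^sub>R \<nu>) (c * s))"

lemma convex_truncated_cone: "convex (truncated_cone x \<nu> c t)"
proof (rule convexI)
  fix y z u v assume y: "y \<in> truncated_cone x \<nu> c t" and z: "z \<in> truncated_cone x \<nu> c t"
    and uv: "(0::real) \<le> u" "0 \<le> v" "u + v = 1"
  obtain s1 where s1: "0 < s1" "s1 \<le> t" "norm (x + s1 *\<^sub>R \<nu> - y) < c * s1"
    using y by (auto simp: truncated_cone_def dist_norm)
  obtain s2 where s2: "0 < s2" "s2 \<le> t" "norm (x + s2 *\<^sub>R \<nu> - z) < c * s2"
    using z by (auto simp: truncated_cone_def dist_norm)
  define s where "s = u * s1 + v * s2"
  have "u * s1 + v * s2 \<le> u * t + v * t" using s1 s2 uv by (intro add_mono mult_left_mono) auto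
  then have st: "s \<le> t" using uv(3) by (simp add: s_def distrib_right [symmetric])
  have s0: "0 < s"
    unfolding s_def using convexD [of "{0<..}" s1 s2 u v] s1 s2 uv by (auto simp: convex_real_interval)
  have "x + s *\<^sub>R \<nu> - (u *\<^sub>R y + v *\<^sub>R z) = (u + v) *\<^sub>R x + s *\<^sub>R \<nu> - (u *\<^sub>R y + v *\<^sub>R z)" using uv(3) by simp
  also have "\<dots> = u *\<^sub>R (x + s1 *\<^sub>R \<nu> - y) + v *\<^sub>R (x + s2 *\<^sub>R \<nu> - z)"
    by (simp add: s_def algebra_simps)
  finally have "norm (x + s *\<^sub>R \<nu> - (u *\<^sub>R y + v *\<^sub>R z)) \<le> u * norm (x + s1 *\<^sub>R \<nu> - y) + v * norm (x + s2 *\<^sub>R \<nu> - z)"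
    using uv norm_triangle_ineq [of "u *\<^sub>R (x + s1 *\<^sub>R \<nu> - y)" "v *\<^sub>R (x + s2 *\<^sub>R \<nu> - z)"] by simp
  also have "\<dots> < c * s"
  proof (cases "u = 0")
    case True then show ?thesis using s2 uv by (simp add: s_def)
  next
    case False
    then have "u * norm (x + s1 *\<^sub>R \<nu> - y) < u * (c * s1)" using s1 uv by (intro mult_strict_left_mono) auto
    moreover have "v * norm (x + s2 *\<^sub>R \<nu> - z) \<le> v * (c * s2)" using s2 uv by (intro mult_left_mono) auto
    ultimately show ?thesis by (simp add: s_def algebra_simps)
  qed
  finally show "u *\<^sub>R y + v *\<^sub>R z \<in> truncated_cone x \<nu> c t"
    using st s0 by (auto simp: truncated_cone_def dist_norm)
qed

lemma truncated_cone_axis: "\<lbrakk>0 < c; 0 < s; s \<le> t\<rbrakk> \<Longrightarrow> x + s *\<^sub>R \<nu> \<in> truncated_cone x \<nu> c t"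
  by (auto simp: truncated_cone_def intro!: bexI [of _ s])

text \<open>On the cone \<open>r\<close> exceeds \<open>r x\<close>, which is nonnegative, so this
  connected set avoids the frontier.\<close>

lemma boundary_chart_cone:
  assumes ch: "boundary_chart \<Omega> q r \<nu> c \<rho>" and x: "dist x q < \<rho> / 2" "0 \<le> r x"
    and t: "t * (norm \<nu> + c) \<le> \<rho> / 2" and meets: "truncated_cone x \<nu> c t \<inter> \<Omega> \<noteq> {}"
  shows "truncated_cone x \<nu> c t \<subseteq> \<Omega>"
proof (rule ccontr)
  assume "\<not> truncated_cone x \<nu> c t \<subseteq> \<Omega>"
  then have "truncated_cone x \<nu> c t \<inter> frontier \<Omega> \<noteq> {}"
    using meets convex_connected [OF convex_truncated_cone] by (intro connected_Int_frontier) auto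
  then obtain z where z: "z \<in> truncated_cone x \<nu> c t" "z \<in> frontier \<Omega>" by blast
  obtain s where s: "0 < s" "s \<le> t" "norm (z - (x + s *\<^sub>R \<nu>)) < c * s"
    using z(1) by (auto simp: truncated_cone_def dist_norm norm_minus_commute)
  have c: "0 < c" using ch by (simp add: boundary_chart_def)
  have "norm (z - x) \<le> norm (s *\<^sub>R \<nu>) + norm (z - (x + s *\<^sub>R \<nu>))"
    using norm_triangle_ineq [of "s *\<^sub>R \<nu>" "z - (x + s *\<^sub>R \<nu>)"] by (simp add: algebra_simps)
  also have "\<dots> \<le> s * norm \<nu> + c * s" using s by simp
  also have "\<dots> = s * (norm \<nu> + c)" by (simp add: algebra_simps)
  also have "\<dots> \<le> t * (norm \<nu> + c)" using s c by (intro mult_right_mono) auto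
  finally have "norm (z - x) \<le> \<rho> / 2" using t by linarith
  then have "dist x z \<le> \<rho> / 2" by (simp add: dist_norm norm_minus_commute)
  then have zq: "z \<in> ball q \<rho>" using x(1) dist_triangle [of q z x] dist_commute [of q x] by simp
  have xq: "x \<in> ball q \<rho>" using x(1) ch by (simp add: dist_commute boundary_chart_def)
  have "r x + s \<le> r (x + (z - x))"
    using zq s by (intro boundary_chart_increase [OF ch xq]) (auto simp: algebra_simps)
  then have "r z \<noteq> 0" using x(2) s(1) by simp
  then show False using ch zq z(2) by (auto simp: boundary_chart_def)
qed

text \<open>Going back along \<open>\<nu>\<close> lowers \<open>r\<close> at rate at least 1, so
  \<open>r\<close> vanishes after a step of at most \<open>r y\<close>. The cone over that foot
  point contains \<open>y\<close> and hence lies in \<open>\<Omega>\<close>.\<close>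

lemma boundary_chart_foot:
  assumes ch: "boundary_chart \<Omega> q r \<nu> c \<rho>" and y: "y \<in> \<Omega>" "dist y q < \<rho> / 4" "0 < r y" "r y * norm \<nu> < \<rho> / 4"
    and t: "t * (norm \<nu> + c) \<le> \<rho> / 2" "r y \<le> t"
  shows "\<exists>s. 0 < s \<and> s \<le> r y \<and> y - s *\<^sub>R \<nu> \<in> frontier \<Omega> \<and> truncated_cone (y - s *\<^sub>R \<nu>) \<nu> c t \<subseteq> \<Omega>"
proof -
  have c: "0 < c" "0 < \<rho>" using ch by (auto simp: boundary_chart_def)
  have near: "dist (y - s *\<^sub>R \<nu>) q < \<rho> / 2" if "0 \<le> s" "s \<le> r y" for s
  proof -
    have "dist (y - s *\<^sub>R \<nu>) y = s * norm \<nu>" using that by (simp add: dist_norm)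
    also have "\<dots> \<le> r y * norm \<nu>" using that by (intro mult_right_mono) auto
    finally show ?thesis using y(2,4) dist_triangle [of "y - s *\<^sub>R \<nu>" q y] by linarith
  qed
  then have inb: "y - s *\<^sub>R \<nu> \<in> ball q \<rho>" if "0 \<le> s" "s \<le> r y" for s
    using that c(2) by (force simp: dist_commute)
  have "r (y - r y *\<^sub>R \<nu>) + r y \<le> r ((y - r y *\<^sub>R \<nu>) + r y *\<^sub>R \<nu>)"
  proof -
    have "y - r y *\<^sub>R \<nu> + r y *\<^sub>R \<nu> \<in> ball q \<rho>" using inb [of 0] y(3) by simp
    then show ?thesis using inb [of "r y"] y(3) c(1) by (intro boundary_chart_increase [OF ch]) auto
  qed
  then have end0: "r (y - r y *\<^sub>R \<nu>) \<le> 0" by simp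
  have "continuous_on {0..r y} (\<lambda>s. r (y - s *\<^sub>R \<nu>))"
    by (rule continuous_on_compose2 [of "ball q \<rho>" r])
       (use ch inb in \<open>auto simp: boundary_chart_def intro!: continuous_intros\<close>)
  then obtain s where s: "0 \<le> s" "s \<le> r y" "r (y - s *\<^sub>R \<nu>) = 0"
    using IVT2' [of "\<lambda>s. r (y - s *\<^sub>R \<nu>)" "r y" 0 0] end0 y(3) by auto
  have s0: "0 < s" using s y(3) by (cases "s = 0") auto
  have fr: "y - s *\<^sub>R \<nu> \<in> frontier \<Omega>" using ch inb [OF s(1,2)] s(3) by (auto simp: boundary_chart_def)
  have "(y - s *\<^sub>R \<nu>) + s *\<^sub>R \<nu> \<in> truncated_cone (y - s *\<^sub>R \<nu>) \<nu> c t"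
    using c s0 s(2) t(2) by (intro truncated_cone_axis) auto
  then have "truncated_cone (y - s *\<^sub>R \<nu>) \<nu> c t \<inter> \<Omega> \<noteq> {}" using y(1) by auto
  then have "truncated_cone (y - s *\<^sub>R \<nu>) \<nu> c t \<subseteq> \<Omega>"
    using near [OF s(1,2)] s(3) by (intro boundary_chart_cone [OF ch _ _ t(1)]) auto
  then show ?thesis using s0 s fr by blast
qed

text \<open>Two directions, as \<open>\<Omega>\<close> could a priori lie on both sides of its frontier near \<open>q\<close>.\<close>

lemma C1_boundary_transversal_curves:
  fixes \<Omega> :: "'a::euclidean_space set"
  assumes \<Omega>: "open \<Omega>" "C1_hypersurface (frontier \<Omega>)" and q: "q \<in> frontier \<Omega>"
  obtains \<nu> c t where "0 < c" "0 < t"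
    "\<And>\<eta>. 0 < \<eta> \<Longrightarrow> \<exists>\<rho>>0. \<forall>y\<in>\<Omega>. dist y q < \<rho> \<longrightarrow>
       (\<exists>\<sigma>\<in>{\<nu>, - \<nu>}. \<exists>s. 0 < s \<and> s < \<eta> \<and> s \<le> t \<and> y - s *\<^sub>R \<sigma> \<in> frontier \<Omega> \<and>
          dist (y - s *\<^sub>R \<sigma>) q < \<eta> \<and> truncated_cone (y - s *\<^sub>R \<sigma>) \<sigma> c t \<subseteq> \<Omega>)"
proof -
  obtain r D \<nu> c \<rho> where ch: "boundary_chart \<Omega> q r \<nu> c \<rho>"
    using C1_hypersurface_boundary_chart [OF \<Omega>(2) q] by metis
  have c: "0 < c" "0 < \<rho>" using ch by (auto simp: boundary_chart_def)
  have rq: "r q = 0" using ch q c by (auto simp: boundary_chart_def)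
  define t where "t = \<rho> / 2 / (norm \<nu> + c)"
  have nc: "0 < norm \<nu> + c" using c by (simp add: add_nonneg_pos)
  have "t * (norm \<nu> + c) = \<rho> / 2"
    using nonzero_divide_eq_eq [of "norm \<nu> + c" "\<rho> / 2" t] nc t_def by auto
  then have t: "0 < t" "t * (norm \<nu> + c) \<le> \<rho> / 2" using nc c unfolding t_def by auto
  show ?thesis
  proof (rule that [OF c(1) t(1)])
    fix \<eta> :: real assume "0 < \<eta>"
    \<comment> \<open>\<open>\<epsilon>\<close> will bound \<open>r y\<close> up to sign and thereby
      the step to the foot point; multiplied by \<open>norm \<nu>\<close> it keeps the foot inside
      the chart and within \<open>\<eta>\<close> of \<open>q\<close>.\<close>
    define \<epsilon> where "\<epsilon> = min (min (\<eta>/2) t) (min (\<eta> / (2 * (norm \<nu> + 1))) (\<rho> / (4 * (norm \<nu> + 1)) / 2))"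
    have n1: "0 < norm \<nu> + 1" by (simp add: add_nonneg_pos)
    have \<epsilon>: "0 < \<epsilon>" "\<epsilon> < \<eta>" "\<epsilon> \<le> t" "\<epsilon> \<le> \<eta> / (2 * (norm \<nu> + 1))" "\<epsilon> \<le> \<rho> / (4 * (norm \<nu> + 1)) / 2"
      using \<open>0 < \<eta>\<close> t(1) c n1 by (auto simp: \<epsilon>_def)
    have en: "\<epsilon> * norm \<nu> < \<rho> / 4" "\<epsilon> * norm \<nu> \<le> \<eta> / 2"
    proof -
      have a: "\<epsilon> * norm \<nu> \<le> \<epsilon> * (norm \<nu> + 1)" using \<epsilon>(1) by simp
      have "\<epsilon> * (norm \<nu> + 1) \<le> \<rho> / 8" using \<epsilon>(5) n1 by (simp add: field_simps)
      then show "\<epsilon> * norm \<nu> < \<rho> / 4" using a c(2) by linarith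
      have "\<epsilon> * (norm \<nu> + 1) \<le> \<eta> / 2" using \<epsilon>(4) n1 by (simp add: field_simps)
      then show "\<epsilon> * norm \<nu> \<le> \<eta> / 2" using a by linarith
    qed
    have qb: "q \<in> ball q \<rho>" using c by simp
    have "continuous (at q) r" using ch qb by (simp add: boundary_chart_def continuous_on_eq_continuous_at)
    then obtain d where d: "0 < d" "\<And>y. dist y q < d \<Longrightarrow> \<bar>r y\<bar> < \<epsilon>"
      using \<epsilon>(1) rq unfolding continuous_at_eps_delta by (auto simp: dist_real_def)
    show "\<exists>\<rho>>0. \<forall>y\<in>\<Omega>. dist y q < \<rho> \<longrightarrow>
       (\<exists>\<sigma>\<in>{\<nu>, - \<nu>}. \<exists>s. 0 < s \<and> s < \<eta> \<and> s \<le> t \<and> y - s *\<^sub>R \<sigma> \<in> frontier \<Omega> \<and>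
          dist (y - s *\<^sub>R \<sigma>) q < \<eta> \<and> truncated_cone (y - s *\<^sub>R \<sigma>) \<sigma> c t \<subseteq> \<Omega>)"
    proof (intro exI [of _ "min d (min (\<rho>/4) (\<eta>/2))"] conjI ballI impI)
      show "0 < min d (min (\<rho>/4) (\<eta>/2))" using d(1) c \<open>0 < \<eta>\<close> by simp
      fix y assume y: "y \<in> \<Omega>" and yq: "dist y q < min d (min (\<rho>/4) (\<eta>/2))"
      have ry: "\<bar>r y\<bar> < \<epsilon>" using d(2) yq by simp
      have "y \<notin> frontier \<Omega>" using y \<Omega>(1) by (simp add: frontier_def interior_open)
      then have "r y \<noteq> 0" using ch yq by (auto simp: boundary_chart_def dist_commute)
      have key: "\<exists>s. 0 < s \<and> s < \<eta> \<and> s \<le> t \<and> y - s *\<^sub>R \<sigma> \<in> frontier \<Omega> \<and>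
          dist (y - s *\<^sub>R \<sigma>) q < \<eta> \<and> truncated_cone (y - s *\<^sub>R \<sigma>) \<sigma> c t \<subseteq> \<Omega>"
        if ch': "boundary_chart \<Omega> q f \<sigma> c \<rho>" and f: "0 < f y" "f y < \<epsilon>" and ns: "norm \<sigma> = norm \<nu>" for f \<sigma>
      proof -
        have "f y * norm \<sigma> \<le> \<epsilon> * norm \<nu>" using f ns by (intro mult_mono) auto
        then have fn: "f y * norm \<sigma> < \<rho> / 4" using en(1) by linarith
        obtain s where s: "0 < s" "s \<le> f y" "y - s *\<^sub>R \<sigma> \<in> frontier \<Omega>" "truncated_cone (y - s *\<^sub>R \<sigma>) \<sigma> c t \<subseteq> \<Omega>"
          using boundary_chart_foot [OF ch' y _ f(1) fn, of t] t(2) ns yq f \<epsilon>(3) by auto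
        have "dist (y - s *\<^sub>R \<sigma>) y = s * norm \<nu>" using s ns by (simp add: dist_norm)
        also have "\<dots> \<le> \<epsilon> * norm \<nu>" using s f by (intro mult_right_mono) auto
        finally have "dist (y - s *\<^sub>R \<sigma>) q < \<eta>"
          using en(2) yq dist_triangle [of "y - s *\<^sub>R \<sigma>" q y] by linarith
        then show ?thesis using s f \<epsilon> by (intro exI [of _ s]) auto
      qed
      show "\<exists>\<sigma>\<in>{\<nu>, - \<nu>}. \<exists>s. 0 < s \<and> s < \<eta> \<and> s \<le> t \<and> y - s *\<^sub>R \<sigma> \<in> frontier \<Omega> \<and>
          dist (y - s *\<^sub>R \<sigma>) q < \<eta> \<and> truncated_cone (y - s *\<^sub>R \<sigma>) \<sigma> c t \<subseteq> \<Omega>"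
      proof (cases "0 < r y")
        case True
        then show ?thesis using key [OF ch] ry by (intro bexI [of _ \<nu>]) auto
      next
        case False
        then show ?thesis using key [OF boundary_chart_uminus [OF ch]] ry \<open>r y \<noteq> 0\<close>
          by (intro bexI [of _ "- \<nu>"]) auto
      qed
    qed
  qed
qed

text \<open>The sign of \<open>r\<close> is fixed by one point \<open>y\<close> of
  \<open>\<Omega>\<close> near \<open>q\<close>. The cone over \<open>y\<close> puts
  \<open>y + t *\<^sub>R \<nu>\<close> into \<open>\<Omega>\<close>; the cones over all nearby
  points with nonnegative \<open>r\<close> contain this point and therefore lie in
  \<open>\<Omega>\<close> too.\<close>

lemma C1_boundary_inner_side:
  fixes \<Omega> :: "'a::euclidean_space set"
  assumes \<Omega>: "open \<Omega>" "C1_hypersurface (frontier \<Omega>)" and q: "q \<in> frontier \<Omega>"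
  obtains r :: "'a \<Rightarrow> real" and D \<nu> c t \<rho> where "0 < c" "0 < t" "0 < \<rho>"
    "(r has_derivative D) (at q)" "r q = 0" "0 < D \<nu>" "\<And>z. \<lbrakk>dist z q < \<rho>; 0 < r z\<rbrakk> \<Longrightarrow> z \<in> \<Omega>"
    "\<And>x. \<lbrakk>x \<in> frontier \<Omega>; dist x q < \<rho>\<rbrakk> \<Longrightarrow> truncated_cone x \<nu> c t \<subseteq> \<Omega>"
proof -
  obtain r0 D0 \<nu>0 c \<rho> where ch0: "boundary_chart \<Omega> q r0 \<nu>0 c \<rho>" and r0: "(r0 has_derivative D0) (at q)" "0 < D0 \<nu>0"
    using C1_hypersurface_boundary_chart [OF \<Omega>(2) q] by metis
  have c: "0 < c" "0 < \<rho>" using ch0 by (auto simp: boundary_chart_def)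
  define t where "t = \<rho> / 2 / (norm \<nu>0 + c)"
  have nc: "0 < norm \<nu>0 + c" using c by (simp add: add_nonneg_pos)
  have "t * (norm \<nu>0 + c) = \<rho> / 2"
    using nonzero_divide_eq_eq [of "norm \<nu>0 + c" "\<rho> / 2" t] nc t_def by auto
  then have t: "0 < t" "t * (norm \<nu>0 + c) \<le> \<rho> / 2" using nc c unfolding t_def by auto
  \<comment> \<open>Both \<open>z\<close> and \<open>y\<close> will be this close to
    \<open>q\<close>, so the bound \<open>c * t / 2\<close> places
    \<open>y + t *\<^sub>R \<nu>\<close> in the top ball of the cone over \<open>z\<close>.\<close>
  define \<rho>1 where "\<rho>1 = min (\<rho>/2) (c * t / 2)"
  have \<rho>1: "0 < \<rho>1" "\<rho>1 \<le> \<rho>/2" "\<rho>1 \<le> c * t / 2" using c t by (auto simp: \<rho>1_def)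
  have "q \<in> closure \<Omega>" using q by (simp add: frontier_def)
  then obtain y where y: "y \<in> \<Omega>" "dist y q < \<rho>1" using \<rho>1(1) by (auto simp: closure_approachable)
  have "y \<notin> frontier \<Omega>" using y \<Omega>(1) by (simp add: frontier_def interior_open)
  then have ry: "r0 y \<noteq> 0" using ch0 y(2) \<rho>1(2) c by (auto simp: boundary_chart_def dist_commute)
  have "\<exists>r D \<nu>. boundary_chart \<Omega> q r \<nu> c \<rho> \<and> (r has_derivative D) (at q) \<and> 0 < D \<nu> \<and> norm \<nu> = norm \<nu>0 \<and> 0 < r y"
  proof (cases "0 < r0 y")
    case True then show ?thesis using ch0 r0 by blast
  next
    case False
    have "(- D0 (- \<nu>0)) = D0 \<nu>0" using linear_neg [OF has_derivative_linear [OF r0(1)]] by simp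
    then show ?thesis using boundary_chart_uminus [OF ch0] has_derivative_minus [OF r0(1)] r0(2) False ry
      by (intro exI [of _ "\<lambda>x. - r0 x"] exI [of _ "\<lambda>x. - D0 x"] exI [of _ "- \<nu>0"]) auto
  qed
  then obtain r D \<nu> where ch: "boundary_chart \<Omega> q r \<nu> c \<rho>" and r: "(r has_derivative D) (at q)" "0 < D \<nu>"
    and n: "norm \<nu> = norm \<nu>0" and ry: "0 < r y" by blast
  have t2: "t * (norm \<nu> + c) \<le> \<rho> / 2" using t n by simp
  have "truncated_cone y \<nu> c t \<inter> \<Omega> \<noteq> {}"
  proof -
    obtain e where e: "0 < e" "ball y e \<subseteq> \<Omega>" using \<Omega>(1) y(1) by (meson open_contains_ball)
    define s where "s = min t (e / (2 * (norm \<nu> + 1)))"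
    have n1: "0 < norm \<nu> + 1" by (simp add: add_nonneg_pos)
    have s: "0 < s" "s \<le> t" "s \<le> e / (2 * (norm \<nu> + 1))" using t e n1 by (auto simp: s_def)
    have "s * norm \<nu> \<le> s * (norm \<nu> + 1)" using s by simp
    also have "\<dots> \<le> e / 2" using s(3) n1 by (simp add: field_simps)
    finally have "y + s *\<^sub>R \<nu> \<in> \<Omega>" using e s by (intro subsetD [OF e(2)]) (auto simp: dist_norm)
    then show ?thesis using truncated_cone_axis [OF c(1) s(1,2), of y \<nu>] by blast
  qed
  then have "truncated_cone y \<nu> c t \<subseteq> \<Omega>"
    using y(2) \<rho>1 ry by (intro boundary_chart_cone [OF ch _ _ t2]) auto
  then have top: "y + t *\<^sub>R \<nu> \<in> \<Omega>" using truncated_cone_axis [OF c(1) t(1) order_refl, of y \<nu>] by blast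
  have cone: "truncated_cone z \<nu> c t \<subseteq> \<Omega>" if z: "dist z q < \<rho>1" "0 \<le> r z" for z
  proof (rule boundary_chart_cone [OF ch _ z(2) t2])
    show "dist z q < \<rho> / 2" using z(1) \<rho>1 by simp
    have "dist (z + t *\<^sub>R \<nu>) (y + t *\<^sub>R \<nu>) < c * t"
      using z(1) y(2) \<rho>1(3) dist_triangle [of z y q] by (simp add: dist_commute)
    then have "y + t *\<^sub>R \<nu> \<in> truncated_cone z \<nu> c t"
      using t(1) unfolding truncated_cone_def by (intro UN_I [of t]) auto
    then show "truncated_cone z \<nu> c t \<inter> \<Omega> \<noteq> {}" using top by blast
  qed
  have rq: "r q = 0" using ch q c by (auto simp: boundary_chart_def)
  show ?thesis
  proof (rule that [OF c(1) t(1) \<rho>1(1) r(1) rq r(2)])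
    show "truncated_cone x \<nu> c t \<subseteq> \<Omega>" if x: "x \<in> frontier \<Omega>" "dist x q < \<rho>1" for x
    proof -
      have "x \<in> ball q \<rho>" using x(2) \<rho>1 c by (auto simp: dist_commute)
      then have "r x = 0" using ch x(1) by (auto simp: boundary_chart_def)
      then show ?thesis using cone [OF x(2)] by simp
    qed
    show "z \<in> \<Omega>" if z: "dist z q < \<rho>1" "0 < r z" for z
    proof -
      have sub: "truncated_cone z \<nu> c t \<subseteq> \<Omega>" using cone z by simp
      \<comment> \<open>The cone omits its apex, so \<open>z\<close> is reached as a limit along the
        axis; being in the closure and off the frontier, it is interior.\<close>
      have lim: "((\<lambda>s. z + s *\<^sub>R \<nu>) \<longlongrightarrow> z + 0 *\<^sub>R \<nu>) (at_right 0)" by (intro tendsto_intros)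
      have ev: "\<forall>\<^sub>F s in at_right 0. z + s *\<^sub>R \<nu> \<in> closure \<Omega>"
      proof -
        have "\<forall>\<^sub>F s in at_right 0. 0 < s \<and> s < t"
          using t(1) by (auto simp: eventually_at_right intro!: exI [of _ t])
        then show ?thesis
        proof eventually_elim
          case (elim s)
          then show ?case using sub truncated_cone_axis [OF c(1), of s t z \<nu>] closure_subset by force
        qed
      qed
      have "z + 0 *\<^sub>R \<nu> \<in> closure \<Omega>"
        by (rule Lim_in_closed_set [OF closed_closure ev trivial_limit_at_right_real lim])
      then have "z \<in> closure \<Omega>" by simp
      moreover have "z \<notin> frontier \<Omega>"
      proof -
        have "z \<in> ball q \<rho>" using z(1) \<rho>1 c by (auto simp: dist_commute)
        then have "r z = 0 \<longleftrightarrow> z \<in> frontier \<Omega>" using ch unfolding boundary_chart_def by blast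
        then show ?thesis using z(2) by linarith
      qed
      ultimately show ?thesis using interior_subset by (auto simp: frontier_def)
    qed
  qed
qed

section \<open>Quasi-geodesics in hyperbolic spaces\<close>

context Metric_space
begin

lemma geodesic_segmentD:
  assumes "geodesic_segment x y S"
  shows "x \<in> M" "y \<in> M" "S \<subseteq> M" "u \<in> S \<Longrightarrow> d x u + d u y = d x y"
proof -
  obtain a b \<sigma> where s: "a \<le> b" "geodesic {a..b} \<sigma>" "\<sigma> a = x" "\<sigma> b = y" "S = \<sigma> ` {a..b}"
    using assms by (auto simp: geodesic_segment_def)
  have M: "\<sigma> t \<in> M" if "t \<in> {a..b}" for t using s that by (auto simp: geodesic_def)
  have D: "d (\<sigma> t1) (\<sigma> t2) = \<bar>t1 - t2\<bar>" if "t1 \<in> {a..b}" "t2 \<in> {a..b}" for t1 t2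
    using s(2) that by (auto simp: geodesic_def)
  show "x \<in> M" "y \<in> M" "S \<subseteq> M" using M s by auto
  show "d x u + d u y = d x y" if "u \<in> S"
  proof -
    obtain t where t: "t \<in> {a..b}" "u = \<sigma> t" using \<open>u \<in> S\<close> s(5) by auto
    then show ?thesis using D [of a t] D [of t b] D [of a b] s by auto
  qed
qed

lemma geodesic_segment_sym:
  assumes "geodesic_segment x y S"
  shows "geodesic_segment y x S"
proof -
  obtain a b \<sigma> where s: "a \<le> b" "geodesic {a..b} \<sigma>" "\<sigma> a = x" "\<sigma> b = y" "S = \<sigma> ` {a..b}"
    using assms by (auto simp: geodesic_segment_def)
  have im: "(\<lambda>t. a + b - t) ` {a..b} = {a..b}"
  proof (intro set_eqI iffI)
    fix t assume "t \<in> {a..b}"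
    then show "t \<in> (\<lambda>t. a + b - t) ` {a..b}" by (intro image_eqI [of _ _ "a + b - t"]) auto
  qed auto
  have "geodesic {a..b} (\<lambda>t. \<sigma> (a + b - t))"
    using s(2) unfolding geodesic_def by (auto simp: image_subset_iff)
  moreover have "S = (\<lambda>t. \<sigma> (a + b - t)) ` {a..b}"
    using s(5) im by (metis (no_types) image_image)
  ultimately show ?thesis
    unfolding geodesic_segment_def using s
    by (intro exI [of _ a] exI [of _ b] exI [of _ "\<lambda>t. \<sigma> (a + b - t)"]) auto
qed

lemma hyperbolic_thin:
  assumes "delta_hyperbolic \<delta>" "geodesic_segment x z C" "geodesic_segment x y A" "geodesic_segment y z B" "u \<in> C"
  shows "\<exists>w\<in>A \<union> B. d u w \<le> \<delta>"
proof -
  have "geodesic_triangle A B C"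
    unfolding geodesic_triangle_def
    using assms geodesic_segmentD(1,2) geodesic_segment_sym by blast
  then show ?thesis
    using assms(1,5) unfolding delta_hyperbolic_def thin_triangle_def by blast
qed

lemma hyperbolic_segment:
  assumes "delta_hyperbolic \<delta>" "x \<in> M" "y \<in> M"
  obtains S where "geodesic_segment x y S"
  using assms unfolding delta_hyperbolic_def geodesic_space_def by blast

text \<open>Two thin triangles on either side of the diagonal from \<open>x'\<close> to
  \<open>y\<close>, each costing \<open>\<delta>\<close>.\<close>

lemma hyperbolic_quadrilateral:
  assumes hyp: "delta_hyperbolic \<delta>" and S: "geodesic_segment x y S" "u \<in> S"
    and P: "geodesic_segment x x' P" and Q: "geodesic_segment x' y' Q" and R: "geodesic_segment y y' R"
  shows "\<exists>w\<in>P \<union> Q \<union> R. d u w \<le> 2 * \<delta>"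
proof -
  obtain T where T: "geodesic_segment x' y T"
    using hyperbolic_segment [OF hyp] geodesic_segmentD P S by metis
  obtain v where v: "v \<in> P \<union> T" "d u v \<le> \<delta>"
    using hyperbolic_thin [OF hyp S(1) P T S(2)] by blast
  have MM: "u \<in> M" "v \<in> M" "P \<union> Q \<union> R \<subseteq> M"
    using S P T Q R v(1) geodesic_segmentD(3) by blast+
  have "0 \<le> \<delta>" using v(2) nonneg [of u v] by linarith
  show ?thesis
  proof (cases "v \<in> P")
    case True then show ?thesis using v \<open>0 \<le> \<delta>\<close> by force
  next
    case False
    then have "v \<in> T" using v by blast
    then obtain w where w: "w \<in> Q \<union> R" "d v w \<le> \<delta>"
      using hyperbolic_thin [OF hyp T Q geodesic_segment_sym [OF R]] by blast
    then have "d u w \<le> 2 * \<delta>" using v(2) triangle [of u v w] MM by auto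
    then show ?thesis using w by blast
  qed
qed

text \<open>Bisecting the chain costs \<open>\<delta>\<close> per level, so the bound grows with the
  logarithm of the number of links.\<close>

lemma geodesic_near_dyadic_chain:
  assumes hyp: "delta_hyperbolic \<delta>"
  shows "\<lbrakk>\<And>i. i \<le> 2^N \<Longrightarrow> x i \<in> M; \<And>i. i < 2^N \<Longrightarrow> d (x i) (x (Suc i)) \<le> l;
     geodesic_segment (x 0) (x (2^N)) S; u \<in> S\<rbrakk> \<Longrightarrow> \<exists>i\<le>2^N. d u (x i) \<le> \<delta> * real N + l"
proof (induction N arbitrary: x S u)
  case 0
  have "d (x 0) u + d u (x (Suc 0)) = d (x 0) (x (Suc 0))"
    using geodesic_segmentD(4) [OF 0(3,4)] by simp
  moreover have "d (x 0) (x (Suc 0)) \<le> l" using 0(2) [of 0] by simp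
  ultimately have "d u (x 0) \<le> l" using nonneg [of u "x (Suc 0)"] commute [of u "x 0"] by linarith
  then show ?case by (intro exI [of _ 0]) simp
next
  case (Suc N)
  let ?m = "2^N :: nat"
  have m: "x 0 \<in> M" "x ?m \<in> M" "x (2 ^ Suc N) \<in> M" using Suc.prems(1) by auto
  obtain A where A: "geodesic_segment (x 0) (x ?m) A" using hyperbolic_segment [OF hyp m(1,2)] .
  obtain B where B: "geodesic_segment (x ?m) (x (2 ^ Suc N)) B" using hyperbolic_segment [OF hyp m(2,3)] .
  obtain w where w: "w \<in> A \<union> B" "d u w \<le> \<delta>" using hyperbolic_thin [OF hyp Suc.prems(3) A B Suc.prems(4)] by blast
  have "\<exists>i\<le>2 ^ Suc N. d w (x i) \<le> \<delta> * real N + l"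
  proof (cases "w \<in> A")
    case True
    have "\<exists>i\<le>?m. d w (x i) \<le> \<delta> * real N + l"
      by (rule Suc.IH [OF _ _ A True]) (use Suc.prems in auto)
    then obtain i where "i \<le> ?m" "d w (x i) \<le> \<delta> * real N + l" by blast
    then show ?thesis by (intro exI [of _ i]) auto
  next
    case False
    then have wB: "w \<in> B" using w by blast
    have "\<exists>i\<le>?m. d w (x (?m + i)) \<le> \<delta> * real N + l"
    proof (rule Suc.IH [of "\<lambda>i. x (?m + i)", OF _ _ _ wB])
      show "geodesic_segment (x (2 ^ N + 0)) (x (2 ^ N + 2 ^ N)) B" using B by (simp add: mult_2)
    qed (use Suc.prems in auto)
    then obtain i where "i \<le> ?m" "d w (x (?m + i)) \<le> \<delta> * real N + l" by blast
    then show ?thesis by (intro exI [of _ "?m + i"]) auto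
  qed
  then obtain i where i: "i \<le> 2 ^ Suc N" "d w (x i) \<le> \<delta> * real N + l" by blast
  have "u \<in> M" "w \<in> M" "x i \<in> M"
    using geodesic_segmentD(3) Suc.prems A B w i by blast+
  then have "d u (x i) \<le> \<delta> * real (Suc N) + l"
    using triangle [of u w "x i"] w i by (simp add: algebra_simps)
  then show ?case using i by blast
qed

section \<open>Stability of bilipschitz paths\<close>

definition bilipschitz_path :: "real \<Rightarrow> real \<Rightarrow> (real \<Rightarrow> 'a) \<Rightarrow> bool" where
  "bilipschitz_path A L c \<longleftrightarrow> 0 \<le> L \<and> c ` {0..L} \<subseteq> M \<and>
     (\<forall>s\<in>{0..L}. \<forall>t\<in>{0..L}. d (c s) (c t) \<le> A * \<bar>s - t\<bar> \<and> \<bar>s - t\<bar> \<le> A * d (c s) (c t))"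

lemma bilipschitz_pathD:
  assumes "bilipschitz_path A L c"
  shows "0 \<le> L" "t \<in> {0..L} \<Longrightarrow> c t \<in> M"
    "s \<in> {0..L} \<Longrightarrow> t \<in> {0..L} \<Longrightarrow> d (c s) (c t) \<le> A * \<bar>s - t\<bar>"
    "s \<in> {0..L} \<Longrightarrow> t \<in> {0..L} \<Longrightarrow> \<bar>s - t\<bar> \<le> A * d (c s) (c t)"
  using assms unfolding bilipschitz_path_def by blast+

text \<open>Sampling the path in \<open>2 ^ N\<close> equal parameter steps of length at most 1
  gives a chain with links of length at most \<open>A\<close>.\<close>

lemma chord_near_bilipschitz_path:
  assumes hyp: "delta_hyperbolic \<delta>" and c: "bilipschitz_path A L c" and "0 \<le> A"
    and t: "t1 \<in> {0..L}" "t2 \<in> {0..L}" "\<bar>t1 - t2\<bar> \<le> 2 ^ N"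
    and S: "geodesic_segment (c t1) (c t2) S" "u \<in> S"
  shows "\<exists>t\<in>{0..L}. d u (c t) \<le> \<delta> * real N + A"
proof -
  define p where "p i = t1 + (t2 - t1) * (real i / 2 ^ N)" for i :: nat
  have p: "p i \<in> {0..L}" if "i \<le> 2 ^ N" for i
  proof -
    have "real i \<le> 2 ^ N" using that by (metis of_nat_le_iff of_nat_numeral of_nat_power)
    then have q: "0 \<le> real i / 2^N" "real i / 2^N \<le> 1" by auto
    have "p i = (1 - real i / 2^N) * t1 + (real i / 2^N) * t2" by (simp add: p_def algebra_simps diff_divide_distrib)
    moreover have "(1 - real i / 2^N) * t1 + (real i / 2^N) * t2 \<in> {0..L}"
      using convexD [OF convex_real_interval(5) t(1,2), of "1 - real i / 2^N" "real i / 2^N"] q by simp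
    ultimately show ?thesis by simp
  qed
  have "\<exists>i\<le>2^N. d u ((c \<circ> p) i) \<le> \<delta> * real N + A"
  proof (rule geodesic_near_dyadic_chain [OF hyp _ _ _ S(2)])
    show "(c \<circ> p) i \<in> M" if "i \<le> 2 ^ N" for i using bilipschitz_pathD(2) [OF c p [OF that]] by simp
    show "d ((c \<circ> p) i) ((c \<circ> p) (Suc i)) \<le> A" if "i < 2 ^ N" for i
    proof -
      have "p i - p (Suc i) = - ((t2 - t1) / 2^N)" by (simp add: p_def field_simps)
      then have "\<bar>p i - p (Suc i)\<bar> \<le> 1" using t(3) by (simp add: abs_minus_commute)
      then have "A * \<bar>p i - p (Suc i)\<bar> \<le> A * 1" using \<open>0 \<le> A\<close> by (rule mult_left_mono)
      then show ?thesis using bilipschitz_pathD(3) [OF c p p, of i "Suc i"] that by simp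
    qed
    show "geodesic_segment ((c \<circ> p) 0) ((c \<circ> p) (2 ^ N)) S" using S(1) by (simp add: p_def)
  qed
  then show ?thesis using p by auto
qed

end

text \<open>The threshold for the bootstrap below: \<open>6 * A * D\<close> will bound the parameter
  length of a chord, and its cost \<open>\<delta> * N\<close>, logarithmic in \<open>D\<close>, is
  eventually beaten by \<open>D\<close>.\<close>

lemma log_dominated_by_linear:
  fixes A \<delta> :: real
  assumes A: "0 < A" and \<delta>: "0 \<le> \<delta>"
  obtains D0 where "1 \<le> D0"
    "\<And>D. D0 \<le> D \<Longrightarrow> \<exists>N::nat. 6 * A * D \<le> 2 ^ N \<and> 2 * \<delta> + \<delta> * real N + A \<le> D - 1"
proof -
  \<comment> \<open>With this slope, the estimate of \<open>ln (\<kappa> * D)\<close> by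
    \<open>\<kappa> * D\<close> makes \<open>\<delta>\<close> times the binary logarithm at most
    \<open>D / 2\<close> plus a constant.\<close>
  define \<kappa> where "\<kappa> = ln 2 / (2 * (\<delta> + 1))"
  define C where "C = \<bar>ln (6 * A / \<kappa>)\<bar>"
  have \<kappa>: "0 < \<kappa>" using \<delta> by (simp add: \<kappa>_def)
  define D0 where "D0 = 2 * (1 + 3 * \<delta> + A + \<delta> * C / ln 2) + 1 / (6 * A) + 1"
  have pos: "0 \<le> \<delta> * C / ln 2" using \<delta> by (simp add: C_def)
  show ?thesis
  proof
    show "1 \<le> D0" using A \<delta> pos by (simp add: D0_def add_nonneg_nonneg)
    fix D assume D: "D0 \<le> D"
    have q: "0 \<le> 1 / (6 * A)" using A by simp
    have "1 / (6 * A) \<le> D" using D A \<delta> pos q unfolding D0_def by argo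
    then have D1: "1 \<le> 6 * A * D" using A by (simp add: divide_le_eq mult.commute)
    have "0 < D" using \<open>1 \<le> D0\<close> D by linarith
    define N where "N = nat \<lceil>log 2 (6 * A * D)\<rceil>"
    have l0: "0 \<le> log 2 (6 * A * D)" using D1 by simp
    have N1: "log 2 (6 * A * D) \<le> real N" "real N \<le> log 2 (6 * A * D) + 1"
      using l0 unfolding N_def by linarith+
    have "6 * A * D = 2 powr log 2 (6 * A * D)" using D1 by simp
    also have "\<dots> \<le> 2 powr real N" using N1(1) by simp
    also have "\<dots> = 2 ^ N" by (simp add: powr_realpow)
    finally have 1: "6 * A * D \<le> 2 ^ N" .
    have "ln (6 * A * D) = ln (\<kappa> * D) + ln (6 * A / \<kappa>)"
    proof -
      have "6 * A * D = (\<kappa> * D) * (6 * A / \<kappa>)" using \<kappa> by simp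
      moreover have "\<kappa> * D \<noteq> 0" "6 * A / \<kappa> \<noteq> 0" using \<kappa> A \<open>0 < D\<close> by auto
      ultimately show ?thesis by (simp only: ln_mult) simp
    qed
    also have "\<dots> \<le> \<kappa> * D + C"
      using ln_le_minus_one [of "\<kappa> * D"] \<kappa> \<open>0 < D\<close> by (simp add: C_def)
    finally have "log 2 (6 * A * D) \<le> (\<kappa> * D + C) / ln 2"
      by (simp add: log_def divide_right_mono)
    then have "\<delta> * log 2 (6 * A * D) \<le> \<delta> * ((\<kappa> * D + C) / ln 2)"
      using \<delta> by (rule mult_left_mono)
    also have "\<dots> = (\<delta> / (\<delta> + 1)) * (D / 2) + \<delta> * C / ln 2"
      using \<delta> by (simp add: \<kappa>_def field_simps)
    also have "\<dots> \<le> D / 2 + \<delta> * C / ln 2"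
    proof -
      have "\<delta> / (\<delta> + 1) \<le> 1" using \<delta> by (simp add: divide_le_eq)
      then have "(\<delta> / (\<delta> + 1)) * (D / 2) \<le> 1 * (D / 2)" using \<open>0 < D\<close> by (intro mult_right_mono) auto
      then show ?thesis by simp
    qed
    finally have "\<delta> * log 2 (6 * A * D) \<le> D / 2 + \<delta> * C / ln 2" .
    moreover have "\<delta> * real N \<le> \<delta> * log 2 (6 * A * D) + \<delta>"
      using mult_left_mono [OF N1(2) \<delta>] by (simp add: distrib_left)
    moreover have "2 * (1 + 3 * \<delta> + A + \<delta> * C / ln 2) \<le> D"
      using D q unfolding D0_def by linarith
    ultimately have "2 * \<delta> + \<delta> * real N + A \<le> D - 1" by argo
    then show "\<exists>N::nat. 6 * A * D \<le> 2 ^ N \<and> 2 * \<delta> + \<delta> * real N + A \<le> D - 1" using 1 by blast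
  qed
qed

context Metric_space
begin

text \<open>If \<open>u\<close> were farther than \<open>D - 1\<close> from the path, cut the
  geodesic at distance \<open>2 * D\<close> on either side of \<open>u\<close> and connect the cuts
  to the path. In the resulting quadrilateral the connections are too far from \<open>u\<close>, and
  the chord between their feet is within a logarithmic distance of the path.\<close>

lemma geodesic_segment_near_bilipschitz_path_step:
  assumes hyp: "delta_hyperbolic \<delta>" and c: "bilipschitz_path A L c" and "0 \<le> A"
    and S: "geodesic_segment (c 0) (c L) S"
    and near: "\<And>u. u \<in> S \<Longrightarrow> \<exists>t\<in>{0..L}. d u (c t) \<le> D" and "1 \<le> D"
    and N: "6 * A * D \<le> 2 ^ N" "2 * \<delta> + \<delta> * real N + A \<le> D - 1"
    and u: "u \<in> S"
  shows "\<exists>t\<in>{0..L}. d u (c t) \<le> D - 1"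
proof (rule ccontr)
  assume "\<not> (\<exists>t\<in>{0..L}. d u (c t) \<le> D - 1)"
  then have far: "D - 1 < d u (c t)" if "t \<in> {0..L}" for t using that by force
  obtain a b \<sigma> where s: "a \<le> b" "geodesic {a..b} \<sigma>" "\<sigma> a = c 0" "\<sigma> b = c L" "S = \<sigma> ` {a..b}"
    using S by (auto simp: geodesic_segment_def)
  have M: "\<sigma> t \<in> M" if "t \<in> {a..b}" for t using s that by (auto simp: geodesic_def)
  have \<sigma>: "d (\<sigma> t1) (\<sigma> t2) = \<bar>t1 - t2\<bar>" if "t1 \<in> {a..b}" "t2 \<in> {a..b}" for t1 t2
    using s(2) that by (auto simp: geodesic_def)
  obtain s0 where s0: "s0 \<in> {a..b}" "u = \<sigma> s0" using u s(5) by auto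
  have uM: "u \<in> M" using s0 M by simp
  note cD = bilipschitz_pathD [OF c]
  have L0: "0 \<in> {0..L}" "L \<in> {0..L}" using cD(1) by auto
  \<comment> \<open>A cut at distance \<open>2 * D\<close> has a connection of length at most
    \<open>D\<close>, which stays at least \<open>D\<close> away from \<open>u\<close>. If the
    geodesic ends earlier, its end is on the path and the connection is a single point of the
    path.\<close>
  have end_point: "\<exists>t\<in>{0..L}. d (\<sigma> s1) (c t) \<le> D \<and>
      (\<forall>P. geodesic_segment (\<sigma> s1) (c t) P \<longrightarrow> (\<forall>w\<in>P. D - 1 < d u w))"
    if s1: "s1 \<in> {a..b}" and alt: "s1 = a \<or> s1 = b \<or> \<bar>s1 - s0\<bar> = 2 * D" for s1
  proof -
    consider t where "t \<in> {0..L}" "\<sigma> s1 = c t" | "\<bar>s1 - s0\<bar> = 2 * D"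
      using alt s(3,4) L0 by auto
    then show ?thesis
    proof cases
      case 1
      show ?thesis
      proof (intro bexI [of _ t] conjI allI impI ballI)
        show "d (\<sigma> s1) (c t) \<le> D" using 1 cD(2) \<open>1 \<le> D\<close> by simp
        fix P w assume P: "geodesic_segment (\<sigma> s1) (c t) P" and w: "w \<in> P"
        have wM: "w \<in> M" using geodesic_segmentD(3) [OF P] w by blast
        have "d (c t) w + d w (c t) = 0"
          using geodesic_segmentD(4) [OF P w] 1 cD(2) by simp
        then have "d (c t) w = 0" using nonneg [of "c t" w] nonneg [of w "c t"] by linarith
        then have "c t = w" using zero [OF cD(2) [OF 1(1)] wM] by simp
        then show "D - 1 < d u w" using far [OF 1(1)] by simp
      qed (use 1 in simp)
    next
      case 2
      have "\<sigma> s1 \<in> S" using s1 s(5) by blast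
      then obtain t where t: "t \<in> {0..L}" "d (\<sigma> s1) (c t) \<le> D" using near by blast
      show ?thesis
      proof (intro bexI [of _ t] conjI allI impI ballI)
        show "d (\<sigma> s1) (c t) \<le> D" by fact
        fix P w assume P: "geodesic_segment (\<sigma> s1) (c t) P" and w: "w \<in> P"
        have wM: "w \<in> M" using geodesic_segmentD(3) [OF P] w by blast
        have "d (\<sigma> s1) w \<le> D"
          using geodesic_segmentD(4) [OF P w] t(2) nonneg [of w "c t"] by linarith
        moreover have "d u (\<sigma> s1) = 2 * D" using \<sigma> [OF s0(1) s1] s0(2) 2 by (simp add: abs_minus_commute)
        moreover have "d u (\<sigma> s1) \<le> d u w + d w (\<sigma> s1)" using triangle [OF uM wM M [OF s1]] .
        ultimately show "D - 1 < d u w" using commute [of w "\<sigma> s1"] by linarith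
      qed (use t in simp)
    qed
  qed
  define s1 where "s1 = max a (s0 - 2 * D)"
  define s2 where "s2 = min b (s0 + 2 * D)"
  have s12: "s1 \<in> {a..b}" "s2 \<in> {a..b}" "s1 \<le> s0" "s0 \<le> s2" "s2 - s1 \<le> 4 * D"
    using s0(1) \<open>1 \<le> D\<close> by (auto simp: s1_def s2_def)
  have alt: "s1 = a \<or> s1 = b \<or> \<bar>s1 - s0\<bar> = 2 * D" "s2 = a \<or> s2 = b \<or> \<bar>s2 - s0\<bar> = 2 * D"
    using \<open>1 \<le> D\<close> by (auto simp: s1_def s2_def max_def min_def)
  obtain t1 where t1: "t1 \<in> {0..L}" "d (\<sigma> s1) (c t1) \<le> D"
      "\<And>P w. geodesic_segment (\<sigma> s1) (c t1) P \<Longrightarrow> w \<in> P \<Longrightarrow> D - 1 < d u w"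
    using end_point [OF s12(1) alt(1)] by blast
  obtain t2 where t2: "t2 \<in> {0..L}" "d (\<sigma> s2) (c t2) \<le> D"
      "\<And>P w. geodesic_segment (\<sigma> s2) (c t2) P \<Longrightarrow> w \<in> P \<Longrightarrow> D - 1 < d u w"
    using end_point [OF s12(2) alt(2)] by blast
  have MM: "\<sigma> s1 \<in> M" "\<sigma> s2 \<in> M" "c t1 \<in> M" "c t2 \<in> M" using M s12 t1 t2 cD(2) by auto
  \<comment> \<open>Two connections of length \<open>D\<close> and a piece of geodesic of length
    \<open>4 * D\<close> account for the factor 6.\<close>
  have "d (c t1) (c t2) \<le> d (c t1) (\<sigma> s1) + d (\<sigma> s1) (\<sigma> s2) + d (\<sigma> s2) (c t2)"
    using triangle [OF MM(3) MM(1) MM(4)] triangle [OF MM(1,2,4)] by linarith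
  also have "\<dots> \<le> D + 4 * D + D"
    using t1(2) t2(2) s12 \<sigma> [OF s12(1,2)] commute [of "c t1" "\<sigma> s1"] by linarith
  finally have "A * d (c t1) (c t2) \<le> A * (6 * D)" using \<open>0 \<le> A\<close> by (intro mult_left_mono) auto
  then have tt: "\<bar>t1 - t2\<bar> \<le> 2 ^ N" using cD(4) [OF t1(1) t2(1)] N(1) by (simp add: ac_simps)
  have seg: "geodesic_segment (\<sigma> s1) (\<sigma> s2) (\<sigma> ` {s1..s2})"
    unfolding geodesic_segment_def geodesic_def
  proof (intro exI conjI)
    show "\<sigma> ` {s1..s2} \<subseteq> M" using M s12 by auto
    show "\<forall>x\<in>{s1..s2}. \<forall>y\<in>{s1..s2}. d (\<sigma> x) (\<sigma> y) = \<bar>x - y\<bar>"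
      using \<sigma> s12 by auto
  qed (use s12 in auto)
  have us: "u \<in> \<sigma> ` {s1..s2}" using s0 s12 by auto
  obtain P where P: "geodesic_segment (\<sigma> s1) (c t1) P" using hyperbolic_segment [OF hyp MM(1,3)] .
  obtain Q where Q: "geodesic_segment (c t1) (c t2) Q" using hyperbolic_segment [OF hyp MM(3,4)] .
  obtain R where R: "geodesic_segment (\<sigma> s2) (c t2) R" using hyperbolic_segment [OF hyp MM(2,4)] .
  obtain w where w: "w \<in> P \<union> Q \<union> R" "d u w \<le> 2 * \<delta>"
    using hyperbolic_quadrilateral [OF hyp seg us P Q R] by blast
  have \<delta>: "0 \<le> \<delta>" using w(2) nonneg [of u w] by linarith
  then have "0 \<le> \<delta> * real N" by simp
  then have small: "2 * \<delta> \<le> D - 1" using N(2) \<open>0 \<le> A\<close> by linarith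
  show False
  proof (cases "w \<in> Q")
    case True
    then obtain t where t: "t \<in> {0..L}" "d w (c t) \<le> \<delta> * real N + A"
      using chord_near_bilipschitz_path [OF hyp c \<open>0 \<le> A\<close> t1(1) t2(1) tt Q] by blast
    have "w \<in> M" using True geodesic_segmentD(3) [OF Q] by blast
    then have "d u (c t) \<le> d u w + d w (c t)" using triangle [OF uM _ cD(2) [OF t(1)]] by blast
    then show False using far [OF t(1)] t(2) w(2) N(2) by linarith
  next
    case False
    then have "D - 1 < d u w" using w(1) t1(3) [OF P] t2(3) [OF R] by blast
    then show False using w(2) small by linarith
  qed
qed

text \<open>The Morse lemma. Quasi-geodesics usually have to be tamed first; bilipschitz paths do not.\<close>

lemma geodesic_near_bilipschitz_path:
  assumes hyp: "delta_hyperbolic \<delta>" and "0 < A" "0 \<le> \<delta>"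
  obtains D0 where "0 \<le> D0"
    "\<And>c L S u. \<lbrakk>bilipschitz_path A L c; geodesic_segment (c 0) (c L) S; u \<in> S\<rbrakk>
       \<Longrightarrow> \<exists>t\<in>{0..L}. d u (c t) \<le> D0"
proof -
  obtain D0 where D0: "1 \<le> D0"
    "\<And>D. D0 \<le> D \<Longrightarrow> \<exists>N::nat. 6 * A * D \<le> 2 ^ N \<and> 2 * \<delta> + \<delta> * real N + A \<le> D - 1"
    using log_dominated_by_linear [OF \<open>0 < A\<close> \<open>0 \<le> \<delta>\<close>] by metis
  show ?thesis
  proof
    show "0 \<le> D0" using D0(1) by simp
    fix c L S u assume c: "bilipschitz_path A L c" and S: "geodesic_segment (c 0) (c L) S" and u: "u \<in> S"
    \<comment> \<open>Descent by 1 from the crude bound given by the distance of the end points, so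
      that the final bound does not depend on the path.\<close>
    have key: "(\<forall>u\<in>S. \<exists>t\<in>{0..L}. d u (c t) \<le> D0 + real n) \<Longrightarrow> (\<forall>u\<in>S. \<exists>t\<in>{0..L}. d u (c t) \<le> D0)" for n
    proof (induction n)
      case (Suc n)
      obtain N :: nat where N: "6 * A * (D0 + real (Suc n)) \<le> 2 ^ N"
          "2 * \<delta> + \<delta> * real N + A \<le> (D0 + real (Suc n)) - 1"
        using D0(2) [of "D0 + real (Suc n)"] by auto
      have "\<exists>t\<in>{0..L}. d v (c t) \<le> D0 + real (Suc n) - 1" if "v \<in> S" for v
        by (rule geodesic_segment_near_bilipschitz_path_step [OF hyp c _ S _ _ N that])
           (use Suc.prems D0(1) \<open>0 < A\<close> in auto)
      then show ?case using Suc.IH by simp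
    qed simp
    have c0: "0 \<in> {0..L}" using bilipschitz_pathD(1) [OF c] by simp
    obtain n :: nat where n: "d (c 0) (c L) \<le> real n" using real_arch_simple by blast
    have "d v (c 0) \<le> D0 + real n" if "v \<in> S" for v
      using geodesic_segmentD(4) [OF S that] nonneg [of v "c L"] commute [of v "c 0"] n D0(1) by linarith
    then have "\<forall>u\<in>S. \<exists>t\<in>{0..L}. d u (c t) \<le> D0 + real n" using c0 by blast
    then show "\<exists>t\<in>{0..L}. d u (c t) \<le> D0" using key u by blast
  qed
qed

text \<open>The geodesic starts near the part of the path before \<open>t\<close> and ends near the
  part after it. Where it changes over, two points of the path on either side of \<open>t\<close>
  are close together, so their parameters are close to each other and to \<open>t\<close>.\<close>

lemma bilipschitz_path_near_geodesic:
  assumes hyp: "delta_hyperbolic \<delta>" and "0 < A" "0 \<le> \<delta>"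
  obtains D1 where "0 \<le> D1"
    "\<And>c L S t. \<lbrakk>bilipschitz_path A L c; geodesic_segment (c 0) (c L) S; t \<in> {0..L}\<rbrakk>
       \<Longrightarrow> \<exists>u\<in>S. d (c t) u \<le> D1"
proof -
  obtain D0 where D0: "0 \<le> D0"
    "\<And>c L S u. \<lbrakk>bilipschitz_path A L c; geodesic_segment (c 0) (c L) S; u \<in> S\<rbrakk>
       \<Longrightarrow> \<exists>t\<in>{0..L}. d u (c t) \<le> D0"
    using geodesic_near_bilipschitz_path [OF assms] by blast
  show ?thesis
  proof
    show "0 \<le> A * (A * (2 * D0 + 2)) + D0" using D0(1) \<open>0 < A\<close> by simp
    fix c L S t assume c: "bilipschitz_path A L c" and S: "geodesic_segment (c 0) (c L) S" and t: "t \<in> {0..L}"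
    obtain a b \<sigma> where s: "a \<le> b" "geodesic {a..b} \<sigma>" "\<sigma> a = c 0" "\<sigma> b = c L" "S = \<sigma> ` {a..b}"
      using S by (auto simp: geodesic_segment_def)
    have M: "\<sigma> r \<in> M" if "r \<in> {a..b}" for r using s that by (auto simp: geodesic_def)
    have \<sigma>: "d (\<sigma> r1) (\<sigma> r2) = \<bar>r1 - r2\<bar>" if "r1 \<in> {a..b}" "r2 \<in> {a..b}" for r1 r2
      using s(2) that by (auto simp: geodesic_def)
    note cD = bilipschitz_pathD [OF c]
    have L0: "0 \<in> {0..L}" "L \<in> {0..L}" using cD(1) by auto
    define X where "X = {r \<in> {a..b}. \<exists>t'\<in>{0..t}. d (\<sigma> r) (c t') \<le> D0}"
    define Y where "Y = {r \<in> {a..b}. \<exists>t'\<in>{t..L}. d (\<sigma> r) (c t') \<le> D0}"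
    have XY: "r \<in> X \<union> Y" if "r \<in> {a..b}" for r
    proof -
      have "\<sigma> r \<in> S" using that s(5) by blast
      then obtain t' where "t' \<in> {0..L}" "d (\<sigma> r) (c t') \<le> D0" using D0(2) [OF c S] by blast
      then show ?thesis using that t by (cases "t' \<le> t") (auto simp: X_def Y_def)
    qed
    have aX: "a \<in> X" using s(1,3) t cD(2) [OF L0(1)] D0(1) by (auto simp: X_def intro!: bexI [of _ 0])
    have bY: "b \<in> Y" using s(1,4) t cD(2) [OF L0(2)] D0(1) by (auto simp: Y_def intro!: bexI [of _ L])
    have bdd: "bdd_above X" by (rule bdd_aboveI [of _ b]) (auto simp: X_def)
    define r where "r = Sup X"
    have rab: "r \<in> {a..b}"
    proof -
      have "a \<le> r" unfolding r_def by (rule cSup_upper [OF aX bdd])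
      moreover have "r \<le> b" unfolding r_def by (rule cSup_least) (use aX in \<open>auto simp: X_def\<close>)
      ultimately show ?thesis by simp
    qed
    obtain r1 where r1: "r1 \<in> X" "r - 1 < r1" using less_cSupD [of X "r - 1"] aX unfolding r_def by force
    have r1r: "r1 \<le> r" unfolding r_def by (rule cSup_upper [OF r1(1) bdd])
    \<comment> \<open>The supremum itself need not belong to \<open>X\<close> or \<open>Y\<close>;
      an error of 1 on each side gives the 2 in the bound.\<close>
    have "\<exists>r2\<in>Y. r \<le> r2 \<and> r2 \<le> r + 1"
    proof (cases "r = b")
      case False
      define r2 where "r2 = min b (r + 1)"
      have "r < r2" using False rab by (auto simp: r2_def)
      then have "r2 \<notin> X" using cSup_upper [OF _ bdd] unfolding r_def by (meson leD)
      moreover have "r2 \<in> {a..b}" using rab by (auto simp: r2_def)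
      ultimately have "r2 \<in> Y" using XY [of r2] by blast
      then show ?thesis using \<open>r < r2\<close> by (intro bexI [of _ r2]) (auto simp: r2_def)
    qed (use bY in auto)
    then obtain r2 where r2: "r2 \<in> Y" "r \<le> r2" "r2 \<le> r + 1" by blast
    obtain t1 where t1: "t1 \<in> {0..t}" "d (\<sigma> r1) (c t1) \<le> D0" and r1ab: "r1 \<in> {a..b}" using r1 by (auto simp: X_def)
    obtain t2 where t2: "t2 \<in> {t..L}" "d (\<sigma> r2) (c t2) \<le> D0" and r2ab: "r2 \<in> {a..b}" using r2 by (auto simp: Y_def)
    have tL: "t1 \<in> {0..L}" "t2 \<in> {0..L}" using t1 t2 t by auto
    have MM: "\<sigma> r1 \<in> M" "\<sigma> r2 \<in> M" "c t1 \<in> M" "c t2 \<in> M" "c t \<in> M" using M r1ab r2ab cD(2) tL t by auto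
    have "d (c t1) (c t2) \<le> d (c t1) (\<sigma> r1) + d (\<sigma> r1) (\<sigma> r2) + d (\<sigma> r2) (c t2)"
      using triangle [OF MM(3) MM(1) MM(4)] triangle [OF MM(1,2,4)] by linarith
    also have "\<dots> \<le> D0 + 2 + D0"
      using t1(2) t2(2) \<sigma> [OF r1ab r2ab] commute [of "c t1" "\<sigma> r1"] r1(2) r1r r2(2,3) by linarith
    finally have "A * d (c t1) (c t2) \<le> A * (2 * D0 + 2)" using \<open>0 < A\<close> by (intro mult_left_mono) auto
    then have "\<bar>t - t1\<bar> \<le> A * (2 * D0 + 2)" using cD(4) [OF tL] t1(1) t2(1) by auto
    then have "A * \<bar>t - t1\<bar> \<le> A * (A * (2 * D0 + 2))" using \<open>0 < A\<close> by (intro mult_left_mono) auto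
    then have "d (c t) (c t1) \<le> A * (A * (2 * D0 + 2))" using cD(3) [OF t tL(1)] by linarith
    then have "d (c t) (\<sigma> r1) \<le> A * (A * (2 * D0 + 2)) + D0"
      using triangle [OF MM(5) MM(3) MM(1)] t1(2) commute [of "c t1" "\<sigma> r1"] by linarith
    then show "\<exists>u\<in>S. d (c t) u \<le> A * (A * (2 * D0 + 2)) + D0" using r1ab s(5) by blast
  qed
qed

text \<open>The quantifier order matters: \<open>C\<close> is independent of \<open>D\<close> and
  \<open>R\<close>. These only tell how far \<open>t\<close> must be from the ends for the two end
  sides of the quadrilateral to be out of reach, which leaves the opposite side.\<close>

lemma bilipschitz_paths_fellow_travel:
  assumes hyp: "delta_hyperbolic \<delta>" and "0 < A" "0 \<le> \<delta>"
  obtains C where "0 \<le> C"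
    "\<And>c1 L1 c2 L2 t D R. \<lbrakk>bilipschitz_path A L1 c1; bilipschitz_path A L2 c2;
        d (c1 0) (c2 0) \<le> D; d (c1 L1) (c2 L2) \<le> R; t \<in> {0..L1};
        A * (C + D) < t; A * (C + R) < L1 - t\<rbrakk>
       \<Longrightarrow> \<exists>t'\<in>{0..L2}. d (c1 t) (c2 t') \<le> C"
proof -
  obtain D0 where D0: "0 \<le> D0"
    "\<And>c L S u. \<lbrakk>bilipschitz_path A L c; geodesic_segment (c 0) (c L) S; u \<in> S\<rbrakk>
       \<Longrightarrow> \<exists>t\<in>{0..L}. d u (c t) \<le> D0"
    using geodesic_near_bilipschitz_path [OF assms] by blast
  obtain D1 where D1: "0 \<le> D1"
    "\<And>c L S t. \<lbrakk>bilipschitz_path A L c; geodesic_segment (c 0) (c L) S; t \<in> {0..L}\<rbrakk>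
       \<Longrightarrow> \<exists>u\<in>S. d (c t) u \<le> D1"
    using bilipschitz_path_near_geodesic [OF assms] by blast
  show ?thesis
  proof
    show "0 \<le> D1 + 2 * \<delta> + D0" using D0 D1 \<open>0 \<le> \<delta>\<close> by simp
    fix c1 L1 c2 L2 t D R
    assume c1: "bilipschitz_path A L1 c1" and c2: "bilipschitz_path A L2 c2"
      and top: "d (c1 0) (c2 0) \<le> D" and bot: "d (c1 L1) (c2 L2) \<le> R" and t: "t \<in> {0..L1}"
      and tt: "A * (D1 + 2 * \<delta> + D0 + D) < t" "A * (D1 + 2 * \<delta> + D0 + R) < L1 - t"
    note c1D = bilipschitz_pathD [OF c1] and c2D = bilipschitz_pathD [OF c2]
    have L: "0 \<in> {0..L1}" "L1 \<in> {0..L1}" "0 \<in> {0..L2}" "L2 \<in> {0..L2}" using c1D(1) c2D(1) by auto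
    have MM: "c1 0 \<in> M" "c1 L1 \<in> M" "c2 0 \<in> M" "c2 L2 \<in> M" "c1 t \<in> M" using L t c1D(2) c2D(2) by auto
    obtain S1 where S1: "geodesic_segment (c1 0) (c1 L1) S1" using hyperbolic_segment [OF hyp MM(1,2)] .
    obtain S2 where S2: "geodesic_segment (c2 0) (c2 L2) S2" using hyperbolic_segment [OF hyp MM(3,4)] .
    obtain P where P: "geodesic_segment (c1 0) (c2 0) P" using hyperbolic_segment [OF hyp MM(1,3)] .
    obtain Q where Q: "geodesic_segment (c1 L1) (c2 L2) Q" using hyperbolic_segment [OF hyp MM(2,4)] .
    obtain u where u: "u \<in> S1" "d (c1 t) u \<le> D1" using D1(2) [OF c1 S1 t] by blast
    obtain w where w: "w \<in> P \<union> S2 \<union> Q" "d u w \<le> 2 * \<delta>"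
      using hyperbolic_quadrilateral [OF hyp S1 u(1) P S2 Q] by blast
    have uM: "u \<in> M" and wM: "w \<in> M" using u w S1 P S2 Q geodesic_segmentD(3) by blast+
    have cw: "d (c1 t) w \<le> D1 + 2 * \<delta>" using triangle [OF MM(5) uM wM] u w by linarith
    have "w \<in> S2"
    proof (rule ccontr)
      assume "w \<notin> S2"
      then consider "w \<in> P" | "w \<in> Q" using w by blast
      then show False
      proof cases
        case 1
        have "d w (c1 0) \<le> D"
          using geodesic_segmentD(4) [OF P 1] top nonneg [of w "c2 0"] commute [of w "c1 0"] by linarith
        then have "d (c1 t) (c1 0) \<le> D1 + 2 * \<delta> + D0 + D"
          using triangle [OF MM(5) wM MM(1)] cw D0(1) by linarith
        then have "A * d (c1 t) (c1 0) \<le> A * (D1 + 2 * \<delta> + D0 + D)" using \<open>0 < A\<close> by (intro mult_left_mono) auto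
        then show False using c1D(4) [OF t L(1)] tt(1) by auto
      next
        case 2
        have "d w (c1 L1) \<le> R"
          using geodesic_segmentD(4) [OF Q 2] bot nonneg [of w "c2 L2"] commute [of w "c1 L1"] by linarith
        then have "d (c1 t) (c1 L1) \<le> D1 + 2 * \<delta> + D0 + R"
          using triangle [OF MM(5) wM MM(2)] cw D0(1) by linarith
        then have "A * d (c1 t) (c1 L1) \<le> A * (D1 + 2 * \<delta> + D0 + R)" using \<open>0 < A\<close> by (intro mult_left_mono) auto
        then show False using c1D(4) [OF t L(2)] tt(2) by auto
      qed
    qed
    then obtain t' where t': "t' \<in> {0..L2}" "d w (c2 t') \<le> D0" using D0(2) [OF c2 S2] by blast
    then have "d (c1 t) (c2 t') \<le> D1 + 2 * \<delta> + D0"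
      using triangle [OF MM(5) wM c2D(2) [OF t'(1)]] cw by linarith
    then show "\<exists>t'\<in>{0..L2}. d (c1 t) (c2 t') \<le> D1 + 2 * \<delta> + D0" using t'(1) by blast
  qed
qed

end

section \<open>Bounds for the Kobayashi metric\<close>

lemma Hol_discD:
  fixes f :: "complex \<Rightarrow> complex^'n"
  assumes "f \<in> Hol_disc \<Omega>"
  shows "(\<lambda>z. f z $ i) holomorphic_on ball 0 1" "norm z < 1 \<Longrightarrow> f z \<in> \<Omega>"
  using assms by (auto simp: Hol_disc_def holomorphic_map_on_def image_subset_iff)

lemma holomorphic_on_complex_dot:
  fixes f :: "complex \<Rightarrow> complex^'n"
  assumes "\<And>i. (\<lambda>z. f z $ i) holomorphic_on S"
  shows "(\<lambda>z. complex_dot a (f z)) holomorphic_on S"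
  unfolding complex_dot_def by (intro holomorphic_intros assms)

lemma deriv_complex_dot:
  fixes f :: "complex \<Rightarrow> complex^'n"
  assumes f: "f \<in> Hol_disc \<Omega>" and v: "(\<chi> i. deriv (\<lambda>z. f z $ i) 0 * \<xi>) = v"
  shows "deriv (\<lambda>z. complex_dot a (f z)) 0 * \<xi> = complex_dot a v"
proof -
  have "((\<lambda>z. f z $ i) has_field_derivative deriv (\<lambda>z. f z $ i) 0) (at 0)" for i
    using holomorphic_derivI [OF Hol_discD(1) [OF f] open_ball] by simp
  then have "((\<lambda>z. \<Sum>i\<in>UNIV. a $ i * f z $ i) has_field_derivative (\<Sum>i\<in>UNIV. a $ i * deriv (\<lambda>z. f z $ i) 0)) (at 0)"
    by (intro DERIV_sum DERIV_cmult)
  then have "deriv (\<lambda>z. complex_dot a (f z)) 0 = (\<Sum>i\<in>UNIV. a $ i * deriv (\<lambda>z. f z $ i) 0)"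
    unfolding complex_dot_def by (rule DERIV_imp_deriv)
  then show ?thesis using v by (auto simp: complex_dot_def sum_distrib_right mult.assoc)
qed

lemma kobayashi_metric_le:
  fixes f :: "complex \<Rightarrow> complex^'n"
  assumes "f \<in> Hol_disc \<Omega>" "f 0 = x" "(\<chi> i. deriv (\<lambda>z. f z $ i) 0 * \<xi>) = v"
  shows "kobayashi_metric \<Omega> x v \<le> cmod \<xi>"
  unfolding kobayashi_metric_def
  by (rule cInf_lower) (use assms in \<open>auto intro!: bdd_belowI [of _ 0]\<close>)

lemma affine_disc:
  fixes v :: "complex^'n"
  assumes "ball x \<rho> \<subseteq> \<Omega>" "0 < \<rho>"
  shows "\<exists>f :: complex \<Rightarrow> complex^'n. f \<in> Hol_disc \<Omega> \<and> f 0 = x \<and> (\<chi> i. deriv (\<lambda>z. f z $ i) 0 * complex_of_real (norm v / \<rho>)) = v"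
proof -
  \<comment> \<open>For \<open>v = 0\<close> the division by zero gives \<open>w = 0\<close> and a
    constant disc.\<close>
  define w where "w = (\<rho> / norm v) *\<^sub>R v"
  define f :: "complex \<Rightarrow> complex^'n" where "f z = x + z *s w" for z
  have nw: "norm w \<le> \<rho>" using assms(2) by (simp add: w_def)
  have "f \<in> Hol_disc \<Omega>"
    unfolding Hol_disc_def holomorphic_map_on_def
  proof (intro CollectI conjI allI image_subsetI)
    show "(\<lambda>z. f z $ i) holomorphic_on ball 0 1" for i
      unfolding f_def by (simp, intro holomorphic_intros)
    fix z :: complex assume "z \<in> ball 0 1"
    then have z: "norm z < 1" by simp
    have "norm z * norm w \<le> norm z * \<rho>" using nw by (intro mult_left_mono) auto
    also have "\<dots> < 1 * \<rho>" using z assms(2) by (intro mult_strict_right_mono)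
    finally have "norm z * norm w < \<rho>" by simp
    then show "f z \<in> \<Omega>" using assms(1) by (auto simp: f_def dist_norm norm_scale_complex_vec)
  qed
  moreover have "f 0 = x" by (simp add: f_def)
  moreover have "(\<chi> i. deriv (\<lambda>z. f z $ i) 0 * complex_of_real (norm v / \<rho>)) = v"
  proof (cases "v = 0")
    case False
    have "deriv (\<lambda>z. f z $ i) 0 = w $ i" for i
      unfolding f_def by (rule DERIV_imp_deriv) (auto intro!: derivative_eq_intros)
    moreover have "w $ i * complex_of_real (norm v / \<rho>) = v $ i" for i
      using False assms(2) by (simp add: w_def scaleR_conv_of_real [of _ "v $ i"])
    ultimately show ?thesis by (simp add: vec_eq_iff)
  qed (simp add: vec_eq_iff)
  ultimately show ?thesis by blast
qed

lemma kobayashi_metric_le_ball: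
  fixes v :: "complex^'n"
  assumes "ball x \<rho> \<subseteq> \<Omega>" "0 < \<rho>"
  shows "kobayashi_metric \<Omega> x v \<le> norm v / \<rho>"
proof -
  obtain f :: "complex \<Rightarrow> complex^'n" where "f \<in> Hol_disc \<Omega>" "f 0 = x" "(\<chi> i. deriv (\<lambda>z. f z $ i) 0 * complex_of_real (norm v / \<rho>)) = v"
    using affine_disc [OF assms] by blast
  then have "kobayashi_metric \<Omega> x v \<le> cmod (complex_of_real (norm v / \<rho>))"
    by (rule kobayashi_metric_le)
  then show ?thesis using assms(2) by (simp add: norm_divide)
qed

text \<open>A lower bound for a real infimum requires a nonempty set, which an affine disc in a ball
  around \<open>x\<close> provides.\<close>

lemma kobayashi_metric_greatest:
  fixes \<Omega> :: "(complex^'n) set"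
  assumes "open \<Omega>" "x \<in> \<Omega>"
    and "\<And>(f :: complex \<Rightarrow> complex^'n) \<xi>. \<lbrakk>f \<in> Hol_disc \<Omega>; f 0 = x; (\<chi> i. deriv (\<lambda>z. f z $ i) 0 * \<xi>) = v\<rbrakk> \<Longrightarrow> B \<le> cmod \<xi>"
  shows "B \<le> kobayashi_metric \<Omega> x v"
proof -
  obtain \<rho> where \<rho>: "0 < \<rho>" "ball x \<rho> \<subseteq> \<Omega>" using assms(1,2) by (meson open_contains_ball)
  show ?thesis
    unfolding kobayashi_metric_def
    by (rule cInf_greatest) (use affine_disc [OF \<rho>(2,1), of v] assms(3) in blast)+
qed

text \<open>A logarithm \<open>h\<close> of \<open>complex_dot a (f z) - b\<close> never takes two values differing by \<open>2 \<pi> \<i>\<close>,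
  so its image contains no disc of radius 4, and Bloch's theorem bounds \<open>h' 0\<close>.\<close>

lemma kobayashi_metric_ge_omitted_hyperplane:
  fixes \<Omega> :: "(complex^'n) set"
  assumes \<Omega>: "open \<Omega>" "C_convex \<Omega>" and nz: "\<And>z. z \<in> \<Omega> \<Longrightarrow> complex_dot a z \<noteq> b" and x: "x \<in> \<Omega>"
  shows "1/48 * cmod (complex_dot a v) \<le> cmod (complex_dot a x - b) * kobayashi_metric \<Omega> x v"
proof -
  obtain \<Lambda> where \<Lambda>: "continuous_on \<Omega> \<Lambda>" "\<And>z. z \<in> \<Omega> \<Longrightarrow> exp (\<Lambda> z) = complex_dot a z - b"
    "\<And>z w. \<lbrakk>z \<in> \<Omega>; w \<in> \<Omega>; complex_dot a z = complex_dot a w\<rbrakk> \<Longrightarrow> \<Lambda> z = \<Lambda> w"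
    using C_convex_logarithm_of_affine [OF \<Omega> nz] by blast
  have pos: "0 < cmod (complex_dot a x - b)" using nz [OF x] by simp
  have "cmod (complex_dot a v) / (48 * cmod (complex_dot a x - b)) \<le> kobayashi_metric \<Omega> x v"
  proof (rule kobayashi_metric_greatest [OF \<Omega>(1) x])
    fix f :: "complex \<Rightarrow> complex^'n" and \<xi> assume f: "f \<in> Hol_disc \<Omega>" "f 0 = x" and v: "(\<chi> i. deriv (\<lambda>z. f z $ i) 0 * \<xi>) = v"
    define F where "F z = complex_dot a (f z) - b" for z
    have Fh: "F holomorphic_on ball 0 1"
      unfolding F_def by (intro holomorphic_intros holomorphic_on_complex_dot Hol_discD(1) [OF f(1)])
    have fin: "f z \<in> \<Omega>" if "z \<in> ball 0 1" for z using Hol_discD(2) [OF f(1)] that by simp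
    have Fnz: "F z \<noteq> 0" if "z \<in> ball 0 1" for z using nz [OF fin [OF that]] by (simp add: F_def)
    obtain h where h: "h holomorphic_on ball 0 1" "\<And>z. z \<in> ball 0 1 \<Longrightarrow> F z = exp (h z)"
      by (rule contractible_imp_holomorphic_log [OF Fh convex_imp_contractible [OF convex_ball]])
         (erule Fnz, erule that, blast)
    have "continuous_on (ball 0 1) (\<lambda>z. \<chi> i. f z $ i)"
      by (intro continuous_on_vec_lambda holomorphic_on_imp_continuous_on Hol_discD(1) [OF f(1)])
    then have cf: "continuous_on (ball 0 1) f" by simp
    \<comment> \<open>\<open>h\<close> and the composition of \<open>\<Lambda>\<close> with
      \<open>f\<close> are logarithms of \<open>F\<close> on a connected disc and differ by a
      constant, while \<open>\<Lambda>\<close> takes equal values wherever \<open>F\<close>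
      does.\<close>
    have no: "h z - h w \<noteq> 2 * of_real pi * \<i>" if zw: "z \<in> ball 0 1" "w \<in> ball 0 1" for z w
    proof
      assume eq: "h z - h w = 2 * of_real pi * \<i>"
      then have "h z = h w + 2 * of_real pi * \<i>" by (simp add: algebra_simps)
      then have "F z = F w" using h(2) zw by (simp add: exp_add)
      then have "\<Lambda> (f z) = \<Lambda> (f w)" using fin zw by (intro \<Lambda>(3)) (auto simp: F_def)
      moreover have "h z - \<Lambda> (f z) = h w - \<Lambda> (f w)"
      proof (rule exp_eq_imp_constant_difference [of "ball 0 1"])
        show "continuous_on (ball 0 1) h" using h(1) by (rule holomorphic_on_imp_continuous_on)
        show "continuous_on (ball 0 1) (\<lambda>z. \<Lambda> (f z))"
          by (rule continuous_on_compose2 [OF \<Lambda>(1) cf]) (use fin in auto)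
        show "exp (h u) = exp (\<Lambda> (f u))" if "u \<in> ball 0 1" for u
          using h(2) [OF that] \<Lambda>(2) [OF fin [OF that]] by (simp add: F_def)
      qed (use zw in auto)
      ultimately show False using eq by simp
    qed
    \<comment> \<open>The number 48 is 4 times 12: Bloch's theorem comes with the constant 1/12, and
      a disc of radius 4, which exceeds \<open>pi\<close>, contains two points at difference
      \<open>2 * pi * \<i>\<close>.\<close>
    have dh: "norm (deriv h 0) \<le> 48"
    proof (rule ccontr)
      assume "\<not> norm (deriv h 0) \<le> 48"
      then have "4 \<le> 1 * norm (deriv h 0) / 12" by simp
      then obtain c where c: "ball c 4 \<subseteq> h ` ball 0 1"
        using Bloch [OF h(1) zero_less_one] by blast
      have "c + of_real pi * \<i> \<in> ball c 4" "c - of_real pi * \<i> \<in> ball c 4"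
        using pi_less_4 by (auto simp: dist_norm norm_mult)
      then have im: "c + of_real pi * \<i> \<in> h ` ball 0 1" "c - of_real pi * \<i> \<in> h ` ball 0 1"
        by (auto intro: subsetD [OF c])
      obtain z where z: "z \<in> ball 0 1" "c + of_real pi * \<i> = h z" using im(1) by (rule imageE) (rule that)
      obtain w where w: "w \<in> ball 0 1" "c - of_real pi * \<i> = h w" using im(2) by (rule imageE) (rule that)
      have "h z - h w = 2 * of_real pi * \<i>" using z(2) w(2) by (simp add: algebra_simps flip: z(2) w(2))
      then show False using no z(1) w(1) by blast
    qed
    have "(h has_field_derivative deriv h 0) (at 0)" using holomorphic_derivI [OF h(1) open_ball] by simp
    then have "((\<lambda>z. exp (h z)) has_field_derivative exp (h 0) * deriv h 0) (at 0)" by (rule DERIV_fun_exp)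
    then have "(F has_field_derivative exp (h 0) * deriv h 0) (at 0)"
      by (rule has_field_derivative_transform_within_open [of _ _ _ "ball 0 1"]) (use h(2) in auto)
    then have dF: "deriv F 0 = F 0 * deriv h 0" using h(2) [of 0] by (simp add: DERIV_imp_deriv)
    have "deriv F 0 = deriv (\<lambda>z. complex_dot a (f z)) 0"
    proof -
      have "((\<lambda>z. complex_dot a (f z)) has_field_derivative deriv (\<lambda>z. complex_dot a (f z)) 0) (at 0)"
        using holomorphic_derivI [OF holomorphic_on_complex_dot [OF Hol_discD(1) [OF f(1)]] open_ball] by simp
      then have "(F has_field_derivative deriv (\<lambda>z. complex_dot a (f z)) 0 - 0) (at 0)"
        unfolding F_def by (intro DERIV_diff DERIV_const)
      then show ?thesis by (simp add: DERIV_imp_deriv)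
    qed
    then have "complex_dot a v = F 0 * deriv h 0 * \<xi>" using deriv_complex_dot [OF f(1) v, of a] dF by simp
    then have "cmod (complex_dot a v) = cmod (complex_dot a x - b) * (cmod (deriv h 0) * cmod \<xi>)"
      by (simp add: norm_mult F_def f(2) mult.assoc)
    also have "\<dots> \<le> cmod (complex_dot a x - b) * (48 * cmod \<xi>)"
      using dh by (intro mult_left_mono mult_right_mono) auto
    finally show "cmod (complex_dot a v) / (48 * cmod (complex_dot a x - b)) \<le> cmod \<xi>"
      using pos by (simp add: divide_le_eq ac_simps)
  qed
  then show ?thesis using pos by (simp add: divide_le_eq ac_simps)
qed

section \<open>Discs in a half plane\<close>

text \<open>Schwarz's lemma, after the Moebius map from the half plane to the disc that sends
  \<open>u 0\<close> to 0.\<close>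

lemma deriv_bound_half_plane:
  fixes u :: "complex \<Rightarrow> complex"
  assumes u: "u holomorphic_on ball 0 1" and lt: "\<And>z. norm z < 1 \<Longrightarrow> Re (u z) < M"
  shows "norm (deriv u 0) \<le> 2 * (M - Re (u 0))"
proof -
  \<comment> \<open>The mirror image of \<open>u 0\<close> in the line
    \<open>Re = M\<close>.\<close>
  define w where "w = 2 * complex_of_real M - cnj (u 0)"
  define g where "g z = (u z - u 0) / (u z - w)" for z
  have less: "norm (u z - u 0) < norm (u z - w)" if "norm z < 1" for z
  proof -
    have "(Re (u z) - Re (u 0))\<^sup>2 < (Re (u z) - (2 * M - Re (u 0)))\<^sup>2"
    proof -
      have "(Re (u z) - (2 * M - Re (u 0)))\<^sup>2 - (Re (u z) - Re (u 0))\<^sup>2 = 4 * (M - Re (u z)) * (M - Re (u 0))"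
        by (simp add: power2_eq_square algebra_simps)
      moreover have "0 < 4 * (M - Re (u z)) * (M - Re (u 0))" using lt [OF that] lt [of 0] by simp
      ultimately show ?thesis by linarith
    qed
    then show ?thesis unfolding cmod_def w_def by (simp add: power2_eq_square)
  qed
  have nz: "u z - w \<noteq> 0" if "norm z < 1" for z using less [OF that] by force
  have g: "g holomorphic_on ball 0 1" unfolding g_def using nz by (intro holomorphic_intros u) auto
  have "norm (deriv g 0) \<le> 1"
    by (rule Schwarz_Lemma(2) [OF g, of 0]) (use less nz in \<open>auto simp: g_def norm_divide divide_less_eq\<close>)
  moreover have "deriv g 0 = deriv u 0 / (u 0 - w)"
  proof -
    have du: "(u has_field_derivative deriv u 0) (at 0)" using holomorphic_derivI [OF u open_ball] by simp
    have "(g has_field_derivative ((deriv u 0 - 0) * (u 0 - w) - (u 0 - u 0) * (deriv u 0 - 0)) / ((u 0 - w) * (u 0 - w))) (at 0)"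
      unfolding g_def by (intro DERIV_divide DERIV_diff DERIV_const du) (use nz in simp)
    then show ?thesis using nz [of 0] by (simp add: DERIV_imp_deriv)
  qed
  moreover have "u 0 - w = complex_of_real (2 * (Re (u 0) - M))" by (simp add: w_def complex_eq_iff)
  moreover have "Re (u 0) < M" using lt [of 0] by simp
  ultimately show ?thesis by (simp add: norm_divide divide_le_eq norm_mult flip: of_real_diff)
qed

text \<open>Only the inner half of each disc is required to stay in the half plane, because its
  points will be at Kobayashi distance at most 1 from the centre. Rescaling the disc doubles the
  constant 2 of \<open>deriv_bound_half_plane\<close>.\<close>

lemma kobayashi_metric_ge_half_plane:
  fixes \<Omega> :: "(complex^'n) set"
  assumes \<Omega>: "open \<Omega>" and x: "x \<in> \<Omega>"
    and lt: "\<And>f z. \<lbrakk>f \<in> Hol_disc \<Omega>; f 0 = x; norm z < 1/2\<rbrakk> \<Longrightarrow> Re (complex_dot a (f z)) < M"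
  shows "1/4 * cmod (complex_dot a v) \<le> (M - Re (complex_dot a x)) * kobayashi_metric \<Omega> x v"
proof -
  obtain \<rho> where \<rho>: "0 < \<rho>" "ball x \<rho> \<subseteq> \<Omega>" using \<Omega> x by (meson open_contains_ball)
  obtain f0 where "f0 \<in> Hol_disc \<Omega>" "f0 0 = x" using affine_disc [OF \<rho>(2,1)] by blast
  then have pos: "0 < M - Re (complex_dot a x)" using lt [of f0 0] by simp
  have "cmod (complex_dot a v) / (4 * (M - Re (complex_dot a x))) \<le> kobayashi_metric \<Omega> x v"
  proof (rule kobayashi_metric_greatest [OF \<Omega> x])
    fix f :: "complex \<Rightarrow> complex^'n" and \<xi> assume f: "f \<in> Hol_disc \<Omega>" "f 0 = x" and v: "(\<chi> i. deriv (\<lambda>z. f z $ i) 0 * \<xi>) = v"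
    define h where "h z = complex_dot a (f z)" for z
    define u where "u z = h (z / 2)" for z
    have h: "h holomorphic_on ball 0 1"
      unfolding h_def by (intro holomorphic_on_complex_dot Hol_discD(1) [OF f(1)])
    have u: "u holomorphic_on ball 0 1"
      unfolding u_def
      by (rule holomorphic_on_compose_gen [OF _ h, of "\<lambda>z. z / 2", unfolded o_def]) (auto intro!: holomorphic_intros simp: norm_divide)
    have "norm (deriv u 0) \<le> 2 * (M - Re (u 0))"
      by (rule deriv_bound_half_plane [OF u]) (auto simp: u_def h_def norm_divide intro!: lt [OF f])
    moreover have "deriv u 0 = deriv h 0 / 2"
    proof -
      have "(h has_field_derivative deriv h 0) (at (0 / 2))" using holomorphic_derivI [OF h open_ball] by simp
      then have "((\<lambda>z. h (z / 2)) has_field_derivative deriv h 0 * (1 / 2)) (at 0)"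
        by (rule DERIV_chain2) (auto intro!: derivative_eq_intros)
      then show ?thesis unfolding u_def by (simp add: DERIV_imp_deriv)
    qed
    ultimately have dh: "norm (deriv h 0) \<le> 4 * (M - Re (complex_dot a x))" by (simp add: u_def h_def f(2) norm_divide)
    have "complex_dot a v = deriv h 0 * \<xi>" using deriv_complex_dot [OF f(1) v, of a] by (simp add: h_def [abs_def])
    then have "cmod (complex_dot a v) = cmod (deriv h 0) * cmod \<xi>" by (simp add: norm_mult)
    also have "\<dots> \<le> 4 * (M - Re (complex_dot a x)) * cmod \<xi>" using dh by (intro mult_right_mono) auto
    finally show "cmod (complex_dot a v) / (4 * (M - Re (complex_dot a x))) \<le> cmod \<xi>"
      using pos by (simp add: divide_le_eq ac_simps)
  qed
  then show ?thesis using pos by (simp add: divide_le_eq ac_simps)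
qed

section \<open>Bounds for the Kobayashi distance\<close>

lemma absolutely_continuous_on_interval_imp_continuous_on:
  fixes f :: "real \<Rightarrow> 'a::real_normed_vector"
  assumes "absolutely_continuous_on_interval a b f"
  shows "continuous_on {a..b} f"
  unfolding continuous_on_iff
proof (intro ballI allI impI)
  fix x e :: real assume x: "x \<in> {a..b}" and "0 < e"
  obtain \<delta> where \<delta>: "0 < \<delta>" "\<And>(I::unit set) l u. \<lbrakk>finite I; \<And>i. i \<in> I \<Longrightarrow> a \<le> l i \<and> l i \<le> u i \<and> u i \<le> b;
       disjoint_family_on (\<lambda>i. {l i<..<u i}) I; (\<Sum>i\<in>I. u i - l i) < \<delta>\<rbrakk>
      \<Longrightarrow> (\<Sum>i\<in>I. norm (f (u i) - f (l i))) < e"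
    by (rule absolutely_continuous_finite_family [OF assms \<open>0 < e\<close>]) (erule that, blast)
  show "\<exists>d>0. \<forall>x'\<in>{a..b}. dist x' x < d \<longrightarrow> dist (f x') (f x) < e"
  proof (intro exI [of _ \<delta>] conjI ballI impI)
    fix y assume y: "y \<in> {a..b}" and d: "dist y x < \<delta>"
    have "(\<Sum>i\<in>{()}. norm (f (max x y) - f (min x y))) < e"
      by (rule \<delta>(2)) (use x y d in \<open>auto simp: disjoint_family_on_def dist_real_def max_def min_def\<close>)
    then show "dist (f y) (f x) < e"
      by (cases "x \<le> y") (auto simp: dist_norm norm_minus_commute max_def min_def)
  qed (use \<delta> in simp)
qed

lemma absolutely_continuous_on_subinterval:
  assumes "absolutely_continuous_on_interval a b f" "a \<le> c" "d \<le> b"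
  shows "absolutely_continuous_on_interval c d f"
  unfolding absolutely_continuous_on_interval_def
proof (intro allI impI)
  fix \<epsilon> :: real assume "\<epsilon> > 0"
  obtain \<delta> where "\<delta> > 0" and \<delta>: "\<And>n s t. (\<forall>k<n. a \<le> s k \<and> s k \<le> t k \<and> t k \<le> b) \<and>
        disjoint_family_on (\<lambda>k. {s k<..<t k}) {..<n} \<and> (\<Sum>k<n. t k - s k) < \<delta> \<Longrightarrow>
        (\<Sum>k<(n::nat). norm (f (t k) - f (s k))) < \<epsilon>"
    using assms(1)[unfolded absolutely_continuous_on_interval_def, rule_format, OF \<open>\<epsilon> > 0\<close>] by blast
  show "\<exists>\<delta>>0. \<forall>(n::nat) s t. (\<forall>k<n. c \<le> s k \<and> s k \<le> t k \<and> t k \<le> d) \<and>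
        disjoint_family_on (\<lambda>k. {s k<..<t k}) {..<n} \<and> (\<Sum>k<n. t k - s k) < \<delta> \<longrightarrow>
        (\<Sum>k<n. norm (f (t k) - f (s k))) < \<epsilon>"
  proof (intro exI [of _ \<delta>] conjI allI impI)
    fix n :: nat and s t :: "nat \<Rightarrow> real"
    assume A: "(\<forall>k<n. c \<le> s k \<and> s k \<le> t k \<and> t k \<le> d) \<and>
        disjoint_family_on (\<lambda>k. {s k<..<t k}) {..<n} \<and> (\<Sum>k<n. t k - s k) < \<delta>"
    have "\<forall>k<n. a \<le> s k \<and> s k \<le> t k \<and> t k \<le> b"
      using A assms(2,3) by (meson order_trans)
    then show "(\<Sum>k<n. norm (f (t k) - f (s k))) < \<epsilon>" using \<delta> A by simp
  qed fact
qed

lemma absolutely_continuous_vector_differentiable_ae: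
  fixes f :: "real \<Rightarrow> 'a::euclidean_space"
  assumes ac: "absolutely_continuous_on_interval a b f"
  obtains N where "negligible N" "\<And>t. t \<in> {a<..<b} - N \<Longrightarrow> \<exists>V. (f has_vector_derivative V) (at t)"
proof -
  have "\<exists>N. negligible N \<and> (\<forall>t\<in>{a<..<b} - N. \<exists>D. ((\<lambda>x. f x \<bullet> e) has_real_derivative D) (at t))"
    if e: "e \<in> Basis" for e
  proof -
    have "absolutely_continuous_on_interval a b (\<lambda>x. f x \<bullet> e)"
      by (rule absolutely_continuous_on_interval_dominated [OF ac, of _ 1])
         (use Basis_le_norm [OF e] in \<open>simp flip: inner_diff_left\<close>)
    then obtain N where "negligible N" "\<And>x. x \<in> {a<..<b} - N \<Longrightarrow> \<exists>D. ((\<lambda>x. f x \<bullet> e) has_real_derivative D) (at x)"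
      by (rule absolutely_continuous_differentiable_ae) (erule that, blast)
    then show ?thesis by blast
  qed
  then obtain N where N: "\<And>e. e \<in> Basis \<Longrightarrow> negligible (N e)"
    "\<And>e t. e \<in> Basis \<Longrightarrow> t \<in> {a<..<b} - N e \<Longrightarrow> \<exists>D. ((\<lambda>x. f x \<bullet> e) has_real_derivative D) (at t)"
    by metis
  show ?thesis
  proof (rule that [of "\<Union>e\<in>Basis. N e"])
    show "negligible (\<Union>e\<in>Basis. N e)" using N(1) by (intro negligible_Union) auto
    fix t assume t: "t \<in> {a<..<b} - (\<Union>e\<in>Basis. N e)"
    have "f differentiable (at t)"
    proof (rule differentiable_componentwise_within [THEN iffD2], rule ballI)
      fix e :: 'a assume e: "e \<in> Basis"
      then have "t \<in> {a<..<b} - N e" using t by blast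
      then obtain D where "((\<lambda>x. f x \<bullet> e) has_real_derivative D) (at t)" using N(2) [OF e] by blast
      then show "(\<lambda>x. f x \<bullet> e) differentiable (at t)"
        using real_differentiable_def by blast
    qed
    then have "(f has_vector_derivative vector_derivative f (at t)) (at t)" by (simp add: vector_derivative_works)
    then show "\<exists>V. (f has_vector_derivative V) (at t)" by blast
  qed
qed

lemma derivative_abs_le_norm:
  fixes E :: "real \<Rightarrow> real" and f :: "real \<Rightarrow> 'a::real_normed_vector"
  assumes E: "(E has_real_derivative D) (at t)" and f: "(f has_vector_derivative V) (at t)"
    and le: "\<And>s. \<bar>E s - E t\<bar> \<le> norm (f s - f t)"
  shows "\<bar>D\<bar> \<le> norm V"
proof (rule field_le_epsilon)
  fix e :: real assume "0 < e"
  then have e: "0 < e / 2" by simp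
  obtain d1 where d1: "0 < d1" "\<And>s. norm (s - t) < d1 \<Longrightarrow> norm (E s - E t - D * (s - t)) \<le> e / 2 * norm (s - t)"
    using E e unfolding has_field_derivative_def has_derivative_at_alt by blast
  obtain d2 where d2: "0 < d2" "\<And>s. norm (s - t) < d2 \<Longrightarrow> norm (f s - f t - (s - t) *\<^sub>R V) \<le> e / 2 * norm (s - t)"
    using f e unfolding has_vector_derivative_def has_derivative_at_alt by blast
  define h where "h = min d1 d2 / 2"
  have h: "0 < h" "h < d1" "h < d2" using d1(1) d2(1) by (auto simp: h_def min_def)
  have "norm (E (t + h) - E t - D * (t + h - t)) \<le> e / 2 * norm (t + h - t)" by (rule d1(2)) (use h in simp)
  then have 1: "\<bar>E (t + h) - E t - D * h\<bar> \<le> e / 2 * h" using h by simp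
  have "norm (f (t + h) - f t - (t + h - t) *\<^sub>R V) \<le> e / 2 * norm (t + h - t)" by (rule d2(2)) (use h in simp)
  then have 2: "norm (f (t + h) - f t - h *\<^sub>R V) \<le> e / 2 * h" using h by simp
  have "\<bar>D * h\<bar> \<le> \<bar>E (t + h) - E t\<bar> + e / 2 * h" using 1 by linarith
  also have "\<dots> \<le> norm (f (t + h) - f t) + e / 2 * h" using le by simp
  also have "norm (f (t + h) - f t) \<le> norm (h *\<^sub>R V) + e / 2 * h"
    using 2 norm_triangle_ineq2 [of "f (t + h) - f t" "h *\<^sub>R V"] by linarith
  finally have "\<bar>D\<bar> * h \<le> (norm V + e) * h" using h by (simp add: abs_mult algebra_simps)
  then show "\<bar>D\<bar> \<le> norm V + e" using h(1) by simp
qed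

text \<open>Common core of both lower bounds: \<open>w\<close> will be the modulus of the equation
  of an omitted hyperplane or the depth in a half space. By \<open>lip\<close> and
  \<open>met\<close> the metric dominates \<open>c\<close> times the derivative of
  \<open>ln w\<close> along the curve, and absolute continuity of \<open>ln w\<close> allows
  integration.\<close>

lemma kobayashi_length_ge_ln:
  fixes \<sigma> :: "real \<Rightarrow> complex^'n" and w :: "complex^'n \<Rightarrow> real"
  assumes "a \<le> b" and ac: "absolutely_continuous_on_interval a b \<sigma>" and "0 < c"
    and pos: "\<And>t. t \<in> {a..b} \<Longrightarrow> 0 < w (\<sigma> t)"
    and lip: "\<And>y z. \<bar>w y - w z\<bar> \<le> cmod (complex_dot \<alpha> (y - z))"
    and met: "\<And>t v. t \<in> {a..b} \<Longrightarrow> c * cmod (complex_dot \<alpha> v) \<le> w (\<sigma> t) * kobayashi_metric \<Omega> (\<sigma> t) v"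
  shows "ennreal (c * \<bar>ln (w (\<sigma> b)) - ln (w (\<sigma> a))\<bar>) \<le> kobayashi_length \<Omega> a b \<sigma>"
proof -
  obtain K where K: "0 < K" "\<And>x. cmod (complex_dot \<alpha> x) \<le> norm x * K"
    using bounded_linear.pos_bounded [OF bounded_linear_complex_dot] by blast
  have wK: "\<bar>w y - w z\<bar> \<le> K * norm (y - z)" for y z using lip [of y z] K(2) [of "y - z"] by (simp add: mult.commute)
  have "continuous_on UNIV w"
    unfolding continuous_on_iff
  proof (intro ballI allI impI)
    fix x and e :: real assume "0 < e"
    show "\<exists>d>0. \<forall>x'\<in>UNIV. dist x' x < d \<longrightarrow> dist (w x') (w x) < e"
    proof (intro exI [of _ "e / K"] conjI ballI impI)
      show "0 < e / K" using \<open>0 < e\<close> K(1) by simp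
      fix y assume "dist y x < e / K"
      then have "K * norm (y - x) < e" using K(1) by (simp add: dist_norm pos_less_divide_eq mult.commute)
      then show "dist (w y) (w x) < e" using wK [of y x] by (simp add: dist_real_def)
    qed
  qed
  then have cw: "continuous_on {a..b} (\<lambda>t. w (\<sigma> t))"
    by (rule continuous_on_compose2 [OF _ absolutely_continuous_on_interval_imp_continuous_on [OF ac]]) simp
  obtain t0 where t0: "t0 \<in> {a..b}" "\<And>t. t \<in> {a..b} \<Longrightarrow> w (\<sigma> t0) \<le> w (\<sigma> t)"
    using continuous_attains_inf [OF compact_Icc _ cw] \<open>a \<le> b\<close> by auto
  \<comment> \<open>The positive minimum of \<open>w\<close> on the compact curve makes
    \<open>ln\<close> Lipschitz on the values that occur.\<close>
  define m where "m = w (\<sigma> t0)"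
  have m: "0 < m" "\<And>t. t \<in> {a..b} \<Longrightarrow> m \<le> w (\<sigma> t)" using pos [OF t0(1)] t0(2) by (auto simp: m_def)
  have lnm: "ln x - ln y \<le> \<bar>x - y\<bar> / m" if "m \<le> x" "m \<le> y" for x y
  proof -
    have "ln x - ln y \<le> (x - y) / y" using that m(1) by (intro ln_diff_le) auto
    also have "\<dots> \<le> \<bar>x - y\<bar> / y" using that m(1) by (intro divide_right_mono) auto
    also have "\<dots> \<le> \<bar>x - y\<bar> / m" using that m(1) by (intro divide_left_mono) auto
    finally show ?thesis .
  qed
  define U where "U t = c * ln (w (\<sigma> t))" for t
  have acU: "absolutely_continuous_on_interval a b U"
  proof (rule absolutely_continuous_on_interval_dominated [OF ac, of _ "c * (K / m)"])
    fix s t assume st: "a \<le> s" "s \<le> t" "t \<le> b"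
    have "\<bar>ln (w (\<sigma> t)) - ln (w (\<sigma> s))\<bar> \<le> \<bar>w (\<sigma> t) - w (\<sigma> s)\<bar> / m"
      using lnm [of "w (\<sigma> t)" "w (\<sigma> s)"] lnm [of "w (\<sigma> s)" "w (\<sigma> t)"] m(2) st by (auto simp: abs_minus_commute)
    also have "\<dots> \<le> K * norm (\<sigma> t - \<sigma> s) / m" using wK m(1) by (intro divide_right_mono) auto
    finally have "c * \<bar>ln (w (\<sigma> t)) - ln (w (\<sigma> s))\<bar> \<le> c * (K * norm (\<sigma> t - \<sigma> s) / m)"
      using \<open>0 < c\<close> by (intro mult_left_mono) auto
    then show "norm (U t - U s) \<le> c * (K / m) * norm (\<sigma> t - \<sigma> s)"
      using \<open>0 < c\<close> by (simp add: U_def abs_mult flip: right_diff_distrib)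
  qed
  obtain N1 where N1: "negligible N1" "\<And>t. t \<in> {a<..<b} - N1 \<Longrightarrow> \<exists>V. (\<sigma> has_vector_derivative V) (at t)"
    using absolutely_continuous_vector_differentiable_ae [OF ac] by metis
  obtain N2 where N2: "negligible N2" "\<And>t. t \<in> {a<..<b} - N2 \<Longrightarrow> \<exists>D. (U has_real_derivative D) (at t)"
    using absolutely_continuous_differentiable_ae [OF acU] by metis
  have "ennreal \<bar>U b - U a\<bar> \<le> (\<integral>\<^sup>+ t\<in>{a..b}. ennreal (kobayashi_metric \<Omega> (\<sigma> t)
                              (vector_derivative \<sigma> (at t within {a..b}))) \<partial>lebesgue)"
  proof (rule absolutely_continuous_increment_le_nn_integral [OF acU \<open>a \<le> b\<close> negligible_Un [OF N1(1) N2(1)]])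
    fix t assume t: "t \<in> {a<..<b} - (N1 \<union> N2)"
    then have tab: "t \<in> {a..b}" "a < t" "t < b" "a < b" by auto
    obtain V where V: "(\<sigma> has_vector_derivative V) (at t)" using N1(2) t by blast
    obtain D where D: "(U has_real_derivative D) (at t)" using N2(2) t by blast
    have vd: "vector_derivative \<sigma> (at t within {a..b}) = V"
      using V tab by (intro vector_derivative_at_within_ivl) auto
    \<comment> \<open>Differentiability almost everywhere is known for \<open>U\<close>; that of
      \<open>w\<close> along the curve is recovered through the exponential.\<close>
    have "((\<lambda>s. exp (U s / c)) has_real_derivative exp (U t / c) * (D / c)) (at t)"
      by (intro DERIV_fun_exp DERIV_cdivide D)
    then have "((\<lambda>s. w (\<sigma> s)) has_real_derivative exp (U t / c) * (D / c)) (at t)"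
      by (rule has_field_derivative_transform_within_open [of _ _ _ "{a<..<b}"])
         (use tab pos \<open>0 < c\<close> in \<open>auto simp: U_def\<close>)
    then have "((\<lambda>s. w (\<sigma> s)) has_real_derivative w (\<sigma> t) * (D / c)) (at t)"
      using \<open>0 < c\<close> pos [OF tab(1)] by (simp add: U_def)
    moreover have "((\<lambda>s. complex_dot \<alpha> (\<sigma> s)) has_vector_derivative complex_dot \<alpha> V) (at t)"
      by (rule bounded_linear.has_vector_derivative [OF bounded_linear_complex_dot V])
    ultimately have "\<bar>w (\<sigma> t) * (D / c)\<bar> \<le> cmod (complex_dot \<alpha> V)"
      by (rule derivative_abs_le_norm) (use lip in \<open>simp add: complex_dot_diff\<close>)
    then have "w (\<sigma> t) * \<bar>D\<bar> \<le> c * cmod (complex_dot \<alpha> V)"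
      using \<open>0 < c\<close> pos [OF tab(1)] by (simp add: abs_mult abs_divide divide_le_eq mult.commute)
    also have "\<dots> \<le> w (\<sigma> t) * kobayashi_metric \<Omega> (\<sigma> t) V" by (rule met [OF tab(1)])
    finally have "\<bar>D\<bar> \<le> kobayashi_metric \<Omega> (\<sigma> t) V" using pos [OF tab(1)] by simp
    then show "\<exists>D. (U has_real_derivative D) (at t) \<and> ennreal \<bar>D\<bar>
        \<le> ennreal (kobayashi_metric \<Omega> (\<sigma> t) (vector_derivative \<sigma> (at t within {a..b})))"
      using D by (intro exI [of _ D]) (simp add: vd ennreal_leI)
  qed
  then show ?thesis
    using \<open>0 < c\<close> by (simp add: U_def kobayashi_length_def abs_mult flip: right_diff_distrib)
qed

definition kobayashi_curve :: "(complex^'n) set \<Rightarrow> complex^'n \<Rightarrow> complex^'n \<Rightarrow> real \<Rightarrow> real \<Rightarrow> (real \<Rightarrow> complex^'n) \<Rightarrow> bool" where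
  "kobayashi_curve \<Omega> x y a b \<sigma> \<longleftrightarrow> a \<le> b \<and> absolutely_continuous_on_interval a b \<sigma> \<and> \<sigma> ` {a..b} \<subseteq> \<Omega> \<and>
       \<sigma> a = x \<and> \<sigma> b = y"

text \<open>Positivity of the distance excludes the infimum \<open>\<infinity>\<close>, which \<^const>\<open>enn2real\<close> sends to \<open>0\<close>.\<close>

lemma kobayashi_dist_curve:
  assumes "Metric_space \<Omega> (kobayashi_dist \<Omega>)" "x \<in> \<Omega>" "y \<in> \<Omega>" "x \<noteq> y" "kobayashi_dist \<Omega> x y < R"
  obtains a b \<sigma> where "kobayashi_curve \<Omega> x y a b \<sigma>" "kobayashi_length \<Omega> a b \<sigma> < ennreal R"
proof -
  interpret Metric_space \<Omega> "kobayashi_dist \<Omega>" by fact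
  define L where "L = {kobayashi_length \<Omega> a b \<sigma> | a b \<sigma>. kobayashi_curve \<Omega> x y a b \<sigma>}"
  have K: "kobayashi_dist \<Omega> x y = enn2real (Inf L)"
    unfolding kobayashi_dist_def L_def kobayashi_curve_def by (rule refl)
  have "0 < kobayashi_dist \<Omega> x y" using mdist_pos_eq assms(2-4) by blast
  then have "Inf L < top" unfolding K enn2real_positive_iff by blast
  then have "Inf L < ennreal R" using assms(5) K enn2real_less [of "Inf L" R] by auto
  then obtain l where "l \<in> L" "l < ennreal R" unfolding Inf_less_iff by blast
  then show ?thesis using that by (auto simp: L_def)
qed

lemma kobayashi_dist_le_length:
  assumes "kobayashi_curve \<Omega> x y a b \<sigma>" "kobayashi_length \<Omega> a b \<sigma> \<le> ennreal R" "0 \<le> R"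
  shows "kobayashi_dist \<Omega> x y \<le> R"
proof -
  have "Inf {kobayashi_length \<Omega> a b \<sigma> | a b \<sigma>. a \<le> b \<and> absolutely_continuous_on_interval a b \<sigma> \<and> \<sigma> ` {a..b} \<subseteq> \<Omega> \<and>
       \<sigma> a = x \<and> \<sigma> b = y} \<le> kobayashi_length \<Omega> a b \<sigma>"
    by (rule Inf_lower) (use assms(1) in \<open>unfold kobayashi_curve_def, blast\<close>)
  then show ?thesis
    unfolding kobayashi_dist_def using assms(2,3) by (intro enn2real_leI) (auto intro: order_trans)
qed

text \<open>Restricting a curve does not lengthen it, so a short curve ending at \<open>y\<close>
  stays close to \<open>y\<close> throughout.\<close>

lemma kobayashi_dist_tail:
  assumes c: "kobayashi_curve \<Omega> x y a b \<sigma>" and l: "kobayashi_length \<Omega> a b \<sigma> \<le> ennreal R" "0 \<le> R" and t: "t \<in> {a..b}"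
  shows "kobayashi_dist \<Omega> (\<sigma> t) y \<le> R"
proof (rule kobayashi_dist_le_length [OF _ _ l(2)])
  show "kobayashi_curve \<Omega> (\<sigma> t) y t b \<sigma>"
    using c t absolutely_continuous_on_subinterval [of a b \<sigma> t b] by (auto simp: kobayashi_curve_def)
  let ?k = "\<lambda>c s. ennreal (kobayashi_metric \<Omega> (\<sigma> s) (vector_derivative \<sigma> (at s within {c..b}))) * indicator {c..b} s"
  \<comment> \<open>Derivatives within \<open>{t..b}\<close> and within \<open>{a..b}\<close> can
    differ at end points only, which form a null set.\<close>
  have "{t, b} \<in> null_sets lebesgue" by (simp flip: negligible_iff_null_sets)
  then have "AE s in lebesgue. s \<notin> {t, b}" by (rule AE_not_in)
  then have "AE s in lebesgue. ?k t s \<le> ?k a s"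
  proof eventually_elim
    case (elim s)
    show ?case
    proof (cases "s \<in> {t<..<b}")
      case True
      then have "at s within {t..b} = at s" "at s within {a..b} = at s" using t by (auto intro!: at_within_Icc_at)
      then show ?thesis using True t by simp
    next
      case False
      then have "s \<notin> {t..b}" using elim by auto
      then show ?thesis by simp
    qed
  qed
  then have "kobayashi_length \<Omega> t b \<sigma> \<le> kobayashi_length \<Omega> a b \<sigma>"
    unfolding kobayashi_length_def by (rule nn_integral_mono_AE)
  then show "kobayashi_length \<Omega> t b \<sigma> \<le> ennreal R" using l(1) by (rule order_trans)
qed

text \<open>Integrates \<open>kobayashi_metric_ge_omitted_hyperplane\<close>. For hyperplanes
  through frontier points it makes transversal segments quasi-geodesics and sends distances to
  infinity at their feet.\<close>

lemma kobayashi_dist_ge_omitted_hyperplane: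
  fixes \<Omega> :: "(complex^'n) set"
  assumes ms: "Metric_space \<Omega> (kobayashi_dist \<Omega>)" and \<Omega>: "open \<Omega>" "C_convex \<Omega>"
    and nz: "\<And>z. z \<in> \<Omega> \<Longrightarrow> complex_dot \<alpha> z \<noteq> \<beta>" and xy: "x \<in> \<Omega>" "y \<in> \<Omega>"
  shows "\<bar>ln (cmod (complex_dot \<alpha> x - \<beta>)) - ln (cmod (complex_dot \<alpha> y - \<beta>))\<bar> \<le> 48 * kobayashi_dist \<Omega> x y"
proof (cases "x = y")
  case True
  then show ?thesis using Metric_space.nonneg [OF ms] by simp
next
  case False
  define w where "w z = cmod (complex_dot \<alpha> z - \<beta>)" for z
  show ?thesis
  proof (rule ccontr)
    assume "\<not> ?thesis"
    then have "kobayashi_dist \<Omega> x y < 1/48 * \<bar>ln (w y) - ln (w x)\<bar>" by (simp add: w_def abs_minus_commute)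
    then obtain a b \<sigma> where c: "kobayashi_curve \<Omega> x y a b \<sigma>"
      and l: "kobayashi_length \<Omega> a b \<sigma> < ennreal (1/48 * \<bar>ln (w y) - ln (w x)\<bar>)"
      by (rule kobayashi_dist_curve [OF ms xy False])
    have "ennreal (1/48 * \<bar>ln (w (\<sigma> b)) - ln (w (\<sigma> a))\<bar>) \<le> kobayashi_length \<Omega> a b \<sigma>"
    proof (rule kobayashi_length_ge_ln [where \<alpha> = \<alpha>])
      show "a \<le> b" "absolutely_continuous_on_interval a b \<sigma>" using c by (auto simp: kobayashi_curve_def)
      have in\<Omega>: "\<sigma> t \<in> \<Omega>" if "t \<in> {a..b}" for t using c that by (auto simp: kobayashi_curve_def)
      show "0 < w (\<sigma> t)" if "t \<in> {a..b}" for t using nz [OF in\<Omega> [OF that]] by (simp add: w_def)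
      show "\<bar>w y - w z\<bar> \<le> cmod (complex_dot \<alpha> (y - z))" for y z
        unfolding w_def using norm_triangle_ineq3 [of "complex_dot \<alpha> y - \<beta>" "complex_dot \<alpha> z - \<beta>"]
        by (simp add: complex_dot_diff)
      show "1/48 * cmod (complex_dot \<alpha> v) \<le> w (\<sigma> t) * kobayashi_metric \<Omega> (\<sigma> t) v" if "t \<in> {a..b}" for t v
        unfolding w_def by (rule kobayashi_metric_ge_omitted_hyperplane [OF \<Omega> nz in\<Omega> [OF that]])
    qed simp
    then show False using l c by (simp add: kobayashi_curve_def)
  qed
qed

text \<open>The hypothesis on discs is local: a curve of length below \<open>R\<close> ending at
  \<open>y\<close> stays within distance \<open>R\<close> of \<open>y\<close>. This makes the bound
  applicable to half spaces that do not contain \<open>\<Omega>\<close>.\<close>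

lemma kobayashi_dist_ge_half_plane:
  fixes \<Omega> :: "(complex^'n) set"
  assumes ms: "Metric_space \<Omega> (kobayashi_dist \<Omega>)" and \<Omega>: "open \<Omega>"
    and xy: "x \<in> \<Omega>" "y \<in> \<Omega>" "kobayashi_dist \<Omega> x y < R"
    and lt: "\<And>z f \<zeta>. \<lbrakk>z \<in> \<Omega>; kobayashi_dist \<Omega> z y \<le> R; f \<in> Hol_disc \<Omega>; f 0 = z; norm \<zeta> < 1/2\<rbrakk>
               \<Longrightarrow> Re (complex_dot \<alpha> (f \<zeta>)) < M"
  shows "\<bar>ln (M - Re (complex_dot \<alpha> y)) - ln (M - Re (complex_dot \<alpha> x))\<bar> \<le> 4 * R"
proof (cases "x = y")
  case True
  then show ?thesis using Metric_space.nonneg [OF ms, of x y] xy(3) by simp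
next
  case False
  have R: "0 \<le> R" using Metric_space.nonneg [OF ms, of x y] xy(3) by simp
  define w where "w z = M - Re (complex_dot \<alpha> z)" for z
  obtain a b \<sigma> where c: "kobayashi_curve \<Omega> x y a b \<sigma>" and l: "kobayashi_length \<Omega> a b \<sigma> < ennreal R"
    by (rule kobayashi_dist_curve [OF ms xy(1,2) False xy(3)])
  have "ennreal (1/4 * \<bar>ln (w (\<sigma> b)) - ln (w (\<sigma> a))\<bar>) \<le> kobayashi_length \<Omega> a b \<sigma>"
  proof (rule kobayashi_length_ge_ln [where \<alpha> = \<alpha>])
    show "a \<le> b" "absolutely_continuous_on_interval a b \<sigma>" using c by (auto simp: kobayashi_curve_def)
    have in\<Omega>: "\<sigma> t \<in> \<Omega>" "kobayashi_dist \<Omega> (\<sigma> t) y \<le> R" if "t \<in> {a..b}" for t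
      using c that kobayashi_dist_tail [OF c less_imp_le [OF l] R that] by (auto simp: kobayashi_curve_def)
    have lt': "Re (complex_dot \<alpha> (f \<zeta>)) < M" if "t \<in> {a..b}" "f \<in> Hol_disc \<Omega>" "f 0 = \<sigma> t" "norm \<zeta> < 1/2" for t f \<zeta>
      by (rule lt [OF in\<Omega> [OF that(1)] that(2-4)])
    show "0 < w (\<sigma> t)" if t: "t \<in> {a..b}" for t
    proof -
      obtain \<rho> where \<rho>: "0 < \<rho>" "ball (\<sigma> t) \<rho> \<subseteq> \<Omega>" using \<Omega> in\<Omega>(1) [OF t] by (meson open_contains_ball)
      obtain f0 :: "complex \<Rightarrow> complex^'n" where "f0 \<in> Hol_disc \<Omega>" "f0 0 = \<sigma> t" using affine_disc [OF \<rho>(2,1)] by blast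
      then show ?thesis using lt' [OF t, of f0 0] by (simp add: w_def)
    qed
    show "\<bar>w y - w z\<bar> \<le> cmod (complex_dot \<alpha> (y - z))" for y z
      unfolding w_def using abs_Re_le_cmod [of "complex_dot \<alpha> (y - z)"] by (simp add: complex_dot_diff abs_minus_commute)
    show "1/4 * cmod (complex_dot \<alpha> v) \<le> w (\<sigma> t) * kobayashi_metric \<Omega> (\<sigma> t) v" if t: "t \<in> {a..b}" for t v
      unfolding w_def by (rule kobayashi_metric_ge_half_plane [OF \<Omega> in\<Omega>(1) [OF t]]) (rule lt' [OF t]; assumption)
  qed simp
  then have "ennreal (1/4 * \<bar>ln (w y) - ln (w x)\<bar>) < ennreal R"
    using l c by (auto simp: kobayashi_curve_def intro: le_less_trans)
  then have "1/4 * \<bar>ln (w y) - ln (w x)\<bar> < R" by (subst (asm) ennreal_less_iff) auto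
  then show ?thesis by (simp add: w_def)
qed

section \<open>Upper bounds from curves and discs\<close>

lemma has_vector_derivative_vec_componentwise:
  fixes f :: "real \<Rightarrow> complex^'n"
  assumes "\<And>i. ((\<lambda>s. f s $ i) has_vector_derivative V $ i) (at t within S)"
  shows "(f has_vector_derivative V) (at t within S)"
  unfolding has_vector_derivative_def
proof (rule has_derivative_componentwise_within [THEN iffD2], rule ballI)
  fix e :: "complex^'n" assume "e \<in> Basis"
  then obtain i b where e: "e = axis i b" by (auto simp: Basis_vec_def)
  have "((\<lambda>s. f s $ i \<bullet> b) has_derivative (\<lambda>h. (h *\<^sub>R V $ i) \<bullet> b)) (at t within S)"
    using bounded_linear.has_derivative [OF bounded_linear_inner_left assms [of i, unfolded has_vector_derivative_def]] .
  then show "((\<lambda>x. f x \<bullet> e) has_derivative (\<lambda>x. x *\<^sub>R V \<bullet> e)) (at t within S)"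
    by (simp add: e inner_axis)
qed

text \<open>\<open>B'\<close> makes the curve Lipschitz, hence absolutely continuous and admissible;
  \<open>B\<close> is the bound that is integrated.\<close>

lemma kobayashi_dist_le_C1:
  fixes \<sigma> :: "real \<Rightarrow> complex^'n"
  assumes "a < b" and im: "\<And>t. t \<in> {a..b} \<Longrightarrow> \<sigma> t \<in> \<Omega>"
    and der: "\<And>t. t \<in> {a..b} \<Longrightarrow> (\<sigma> has_vector_derivative \<sigma>' t) (at t within {a..b})"
    and B': "\<And>t. t \<in> {a..b} \<Longrightarrow> norm (\<sigma>' t) \<le> B'"
    and k: "\<And>t. t \<in> {a..b} \<Longrightarrow> kobayashi_metric \<Omega> (\<sigma> t) (\<sigma>' t) \<le> B" and "0 \<le> B"
  shows "kobayashi_dist \<Omega> (\<sigma> a) (\<sigma> b) \<le> B * (b - a)"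
proof (rule kobayashi_dist_le_length)
  have "norm (\<sigma> t - \<sigma> s) \<le> B' * (t - s)" if st: "a \<le> s" "s \<le> t" "t \<le> b" for s t
  proof -
    have "norm (\<sigma> t - \<sigma> s) \<le> B' * norm (t - s)"
    proof (rule differentiable_bound [of "{a..b}" \<sigma> "\<lambda>t h. h *\<^sub>R \<sigma>' t"])
      show "(\<sigma> has_derivative (\<lambda>h. h *\<^sub>R \<sigma>' x)) (at x within {a..b})" if "x \<in> {a..b}" for x
        using der [OF that] by (simp add: has_vector_derivative_def)
      show "onorm (\<lambda>h. h *\<^sub>R \<sigma>' x) \<le> B'" if "x \<in> {a..b}" for x
      proof (rule onorm_le)
        fix h :: real
        have "norm (\<sigma>' x) * \<bar>h\<bar> \<le> B' * \<bar>h\<bar>" by (intro mult_right_mono B' that) auto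
        then show "norm (h *\<^sub>R \<sigma>' x) \<le> B' * norm h" by (simp add: mult.commute)
      qed
    qed (use st in auto)
    then show ?thesis using st by simp
  qed
  then have "absolutely_continuous_on_interval a b \<sigma>"
    by (rule absolutely_continuous_on_interval_lipschitz)
  then show "kobayashi_curve \<Omega> (\<sigma> a) (\<sigma> b) a b \<sigma>"
    using \<open>a < b\<close> im by (auto simp: kobayashi_curve_def)
  have "kobayashi_length \<Omega> a b \<sigma> \<le> (\<integral>\<^sup>+ t. ennreal B * indicator {a..b} t \<partial>lebesgue)"
    unfolding kobayashi_length_def
  proof (rule nn_integral_mono)
    fix t :: real
    show "ennreal (kobayashi_metric \<Omega> (\<sigma> t) (vector_derivative \<sigma> (at t within {a..b}))) * indicator {a..b} t
        \<le> ennreal B * indicator {a..b} t"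
    proof (cases "t \<in> {a..b}")
      case True
      then have "vector_derivative \<sigma> (at t within {a..b}) = \<sigma>' t"
        using vector_derivative_within_closed_interval [OF \<open>a < b\<close> True der [OF True]] by simp
      then show ?thesis using k [OF True] True by (simp add: ennreal_leI)
    qed simp
  qed
  also have "\<dots> = ennreal B * emeasure lebesgue {a..b}" by (rule nn_integral_cmult_indicator) simp
  also have "\<dots> = ennreal (B * (b - a))" using \<open>a < b\<close> \<open>0 \<le> B\<close> by (simp add: ennreal_mult)
  finally show "kobayashi_length \<Omega> a b \<sigma> \<le> ennreal (B * (b - a))" .
qed (use assms in simp)

lemma kobayashi_dist_le_segment:
  assumes "0 < \<rho>" "\<And>z. z \<in> closed_segment x y \<Longrightarrow> ball z \<rho> \<subseteq> \<Omega>"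
  shows "kobayashi_dist \<Omega> x y \<le> norm (y - x) / \<rho>"
proof -
  define \<sigma> where "\<sigma> t = x + t *\<^sub>R (y - x)" for t
  have ball: "ball (\<sigma> t) \<rho> \<subseteq> \<Omega>" if "t \<in> {0..1}" for t
  proof (rule assms(2))
    show "\<sigma> t \<in> closed_segment x y"
      unfolding closed_segment_def using that by (auto simp: \<sigma>_def algebra_simps intro!: exI [of _ t])
  qed
  have "kobayashi_dist \<Omega> (\<sigma> 0) (\<sigma> 1) \<le> norm (y - x) / \<rho> * (1 - 0)"
  proof (rule kobayashi_dist_le_C1 [where \<sigma>' = "\<lambda>_. y - x" and B' = "norm (y - x)"])
    show "\<sigma> t \<in> \<Omega>" if "t \<in> {0..1}" for t using subsetD [OF ball [OF that], of "\<sigma> t"] assms(1) by simp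
    show "(\<sigma> has_vector_derivative y - x) (at t within {0..1})" for t
      unfolding \<sigma>_def by (auto intro!: derivative_eq_intros)
    show "kobayashi_metric \<Omega> (\<sigma> t) (y - x) \<le> norm (y - x) / \<rho>" if "t \<in> {0..1}" for t
      by (rule kobayashi_metric_le_ball [OF ball [OF that] assms(1)])
  qed (use assms(1) in auto)
  then show ?thesis by (simp add: \<sigma>_def)
qed

lemma kobayashi_dist_le_in_ball:
  assumes "ball x (2 * r) \<subseteq> \<Omega>" "dist x y < r"
  shows "kobayashi_dist \<Omega> x y \<le> 1"
proof -
  have r: "0 < r" using assms(2) zero_le_dist [of x y] by linarith
  have "kobayashi_dist \<Omega> x y \<le> norm (y - x) / r"
  proof (rule kobayashi_dist_le_segment [OF r])
    fix z assume "z \<in> closed_segment x y"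
    then have "dist x z < r" using segment_bound(1) [of z x y] assms(2) by (simp add: dist_norm norm_minus_commute)
    have "ball z r \<subseteq> ball x (2 * r)"
    proof
      fix u assume "u \<in> ball z r"
      then show "u \<in> ball x (2 * r)" using \<open>dist x z < r\<close> dist_triangle [of x u z] by simp
    qed
    then show "ball z r \<subseteq> \<Omega>" using assms(1) by blast
  qed
  also have "\<dots> \<le> 1" using assms(2) r by (simp add: dist_norm norm_minus_commute)
  finally show ?thesis .
qed

text \<open>In the exponential parametrisation the speed and the radius of the inscribed ball shrink
  together, and their quotient is the constant \<open>norm \<nu> / c\<close>.\<close>

lemma kobayashi_dist_le_cone:
  assumes cone: "truncated_cone x \<nu> c t \<subseteq> \<Omega>" and "0 < c" "0 < t" and s: "0 \<le> s1" "s1 < s2"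
  shows "kobayashi_dist \<Omega> (x + (t * exp (- s1)) *\<^sub>R \<nu>) (x + (t * exp (- s2)) *\<^sub>R \<nu>) \<le> norm \<nu> / c * (s2 - s1)"
proof (rule kobayashi_dist_le_C1 [where \<sigma>' = "\<lambda>s. - (t * exp (- s)) *\<^sub>R \<nu>" and B' = "t * norm \<nu>"])
  fix s assume s: "s \<in> {s1..s2}"
  then have e: "0 < t * exp (- s)" "t * exp (- s) \<le> t" using \<open>0 < t\<close> \<open>0 \<le> s1\<close> by auto
  show "x + (t * exp (- s)) *\<^sub>R \<nu> \<in> \<Omega>" using cone truncated_cone_axis [OF \<open>0 < c\<close> e] by blast
  show "((\<lambda>s. x + (t * exp (- s)) *\<^sub>R \<nu>) has_vector_derivative - (t * exp (- s)) *\<^sub>R \<nu>) (at s within {s1..s2})"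
    by (auto intro!: derivative_eq_intros)
  show "norm (- (t * exp (- s)) *\<^sub>R \<nu>) \<le> t * norm \<nu>" using e by (simp add: mult_right_mono)
  have "ball (x + (t * exp (- s)) *\<^sub>R \<nu>) (c * (t * exp (- s))) \<subseteq> \<Omega>"
    using cone e unfolding truncated_cone_def by (intro order_trans [OF _ cone [unfolded truncated_cone_def]] UN_upper) auto
  then have "kobayashi_metric \<Omega> (x + (t * exp (- s)) *\<^sub>R \<nu>) (- (t * exp (- s)) *\<^sub>R \<nu>)
      \<le> norm (- (t * exp (- s)) *\<^sub>R \<nu>) / (c * (t * exp (- s)))"
    using e \<open>0 < c\<close> by (intro kobayashi_metric_le_ball) auto
  also have "\<dots> = norm \<nu> / c" using e by (simp add: abs_mult)
  finally show "kobayashi_metric \<Omega> (x + (t * exp (- s)) *\<^sub>R \<nu>) (- (t * exp (- s)) *\<^sub>R \<nu>) \<le> norm \<nu> / c" .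
qed (use assms in auto)

text \<open>Around a point \<open>z0\<close> of the segment from 0 to \<open>\<zeta>\<close> there
  is a disc of radius \<open>1 - norm z0\<close>, at least 1/2, on which \<open>f\<close> can be
  recentred. The segment has length at most 1/2, so its image has Kobayashi speed at most 1.\<close>

lemma kobayashi_dist_le_disc:
  fixes f :: "complex \<Rightarrow> complex^'n"
  assumes f: "f \<in> Hol_disc \<Omega>" and \<zeta>: "norm \<zeta> \<le> 1/2"
  shows "kobayashi_dist \<Omega> (f 0) (f \<zeta>) \<le> 1"
proof -
  define \<sigma> where "\<sigma> t = f (complex_of_real t * \<zeta>)" for t
  define \<sigma>' where "\<sigma>' t = (\<chi> i. deriv (\<lambda>z. f z $ i) (complex_of_real t * \<zeta>) * \<zeta>)" for t
  have n: "norm (complex_of_real t * \<zeta>) \<le> 1/2" if "t \<in> {0..1}" for t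
  proof -
    have "norm (complex_of_real t * \<zeta>) \<le> 1 * norm \<zeta>" unfolding norm_mult using that by (intro mult_right_mono) auto
    then show ?thesis using \<zeta> by simp
  qed
  have inb: "complex_of_real t * \<zeta> \<in> ball 0 1" if "t \<in> {0..1}" for t using n [OF that] by simp
  have der: "(\<sigma> has_vector_derivative \<sigma>' t) (at t within {0..1})" if t: "t \<in> {0..1}" for t
  proof (rule has_vector_derivative_vec_componentwise)
    fix i
    have "((\<lambda>z. f z $ i) has_field_derivative deriv (\<lambda>z. f z $ i) (complex_of_real t * \<zeta>)) (at (complex_of_real t * \<zeta>))"
      by (rule holomorphic_derivI [OF Hol_discD(1) [OF f] open_ball inb [OF t]])
    moreover have "((\<lambda>t. complex_of_real t * \<zeta>) has_vector_derivative \<zeta>) (at t within {0..1})"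
      by (auto intro!: derivative_eq_intros)
    ultimately have "((\<lambda>z. f z $ i) \<circ> (\<lambda>t. complex_of_real t * \<zeta>) has_vector_derivative
       \<zeta> * deriv (\<lambda>z. f z $ i) (complex_of_real t * \<zeta>)) (at t within {0..1})"
      by (intro field_vector_diff_chain_within) (auto intro: has_field_derivative_at_within)
    then show "((\<lambda>s. \<sigma> s $ i) has_vector_derivative \<sigma>' t $ i) (at t within {0..1})"
      by (simp add: \<sigma>_def \<sigma>'_def o_def mult.commute)
  qed
  have "continuous_on {0..1} \<sigma>'"
    unfolding \<sigma>'_def
  proof (intro continuous_on_vec_lambda continuous_on_mult continuous_on_const)
    fix i
    show "continuous_on {0..1} (\<lambda>t. deriv (\<lambda>z. f z $ i) (complex_of_real t * \<zeta>))"
      by (rule continuous_on_compose2 [OF holomorphic_on_imp_continuous_on [OF holomorphic_deriv [OF Hol_discD(1) [OF f] open_ball]]])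
         (use inb in \<open>auto intro!: continuous_intros\<close>)
  qed
  then have "bounded (\<sigma>' ` {0..1})" by (intro compact_imp_bounded compact_continuous_image) auto
  then obtain B' where "\<forall>x\<in>\<sigma>' ` {0..1}. norm x \<le> B'" unfolding bounded_iff by blast
  then have B': "norm (\<sigma>' t) \<le> B'" if "t \<in> {0..1}" for t using that by blast
  have k: "kobayashi_metric \<Omega> (\<sigma> t) (\<sigma>' t) \<le> 1" if t: "t \<in> {0..1}" for t
  proof -
    define z0 where "z0 = complex_of_real t * \<zeta>"
    define r where "r = 1 - norm z0"
    have r: "1/2 \<le> r" "norm z0 + r = 1" using n [OF t] by (auto simp: r_def z0_def)
    define g where "g w = f (z0 + complex_of_real r * w)" for w
    have arg: "norm (z0 + complex_of_real r * w) < 1" if "norm w < 1" for w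
    proof -
      have "norm (z0 + complex_of_real r * w) \<le> norm z0 + r * norm w"
        using norm_triangle_ineq [of z0 "complex_of_real r * w"] r by (simp add: norm_mult)
      also have "\<dots> < norm z0 + r * 1" using that r by (intro add_strict_left_mono mult_strict_left_mono) auto
      finally show ?thesis using r by simp
    qed
    have "g \<in> Hol_disc \<Omega>"
      unfolding Hol_disc_def holomorphic_map_on_def
    proof (intro CollectI conjI allI image_subsetI)
      show "(\<lambda>w. g w $ i) holomorphic_on ball 0 1" for i
        unfolding g_def
        by (rule holomorphic_on_compose_gen [OF _ Hol_discD(1) [OF f], of "\<lambda>w. z0 + complex_of_real r * w", unfolded o_def])
           (use arg in \<open>auto intro!: holomorphic_intros\<close>)
      show "g w \<in> \<Omega>" if "w \<in> ball 0 1" for w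
        unfolding g_def using that by (intro Hol_discD(2) [OF f] arg) simp
    qed
    moreover have "g 0 = \<sigma> t" by (simp add: g_def \<sigma>_def z0_def)
    moreover have "(\<chi> i. deriv (\<lambda>w. g w $ i) 0 * (\<zeta> / complex_of_real r)) = \<sigma>' t"
    proof -
      have "deriv (\<lambda>w. g w $ i) 0 = deriv (\<lambda>z. f z $ i) z0 * complex_of_real r" for i
      proof -
        have "((\<lambda>z. f z $ i) has_field_derivative deriv (\<lambda>z. f z $ i) z0) (at (z0 + complex_of_real r * 0))"
          using holomorphic_derivI [OF Hol_discD(1) [OF f] open_ball inb [OF t]] by (simp add: z0_def)
        moreover have "((\<lambda>w. z0 + complex_of_real r * w) has_field_derivative complex_of_real r) (at 0)"
          by (auto intro!: derivative_eq_intros)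
        ultimately have "((\<lambda>w. f (z0 + complex_of_real r * w) $ i) has_field_derivative deriv (\<lambda>z. f z $ i) z0 * complex_of_real r) (at 0)"
          by (rule DERIV_chain2)
        then show ?thesis unfolding g_def by (rule DERIV_imp_deriv)
      qed
      then show ?thesis using r by (simp add: \<sigma>'_def z0_def)
    qed
    ultimately have "kobayashi_metric \<Omega> (\<sigma> t) (\<sigma>' t) \<le> cmod (\<zeta> / complex_of_real r)" by (rule kobayashi_metric_le)
    also have "\<dots> = norm \<zeta> / r" using r by (simp add: norm_divide)
    also have "\<dots> \<le> 1" using \<zeta> r by simp
    finally show ?thesis .
  qed
  have "kobayashi_dist \<Omega> (\<sigma> 0) (\<sigma> 1) \<le> 1 * (1 - 0)"
  proof (rule kobayashi_dist_le_C1 [where \<sigma>' = \<sigma>' and B' = B'])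
    show "\<sigma> t \<in> \<Omega>" if "t \<in> {0..1}" for t
      unfolding \<sigma>_def using inb [OF that] by (intro Hol_discD(2) [OF f]) simp
  qed (use der B' k in simp_all)
  then show ?thesis by (simp add: \<sigma>_def)
qed

section \<open>Supporting complex hyperplanes at frontier points\<close>

text \<open>The coefficients are read off on the real basis \<open>axis i 1\<close>,
  \<open>axis i \<i>\<close>. For the differential of a defining function, the kernel of
  \<open>complex_dot a\<close> is the complex tangent hyperplane inside the real one.\<close>

lemma real_linear_eq_Re_complex_dot:
  fixes D :: "complex^'n \<Rightarrow> real"
  assumes "linear D"
  obtains a where "D = (\<lambda>v. Re (complex_dot a v))"
proof -
  define a :: "complex^'n" where "a = (\<chi> i. Complex (D (axis i 1)) (- D (axis i \<i>)))"
  have "D v = Re (complex_dot a v)" for v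
  proof -
    have v: "v = (\<Sum>i\<in>UNIV. Re (v $ i) *\<^sub>R axis i 1 + Im (v $ i) *\<^sub>R axis i \<i>)"
    proof (rule vec_eq_iff [THEN iffD2], rule allI)
      fix j
      have "(\<Sum>i\<in>UNIV. Re (v $ i) *\<^sub>R axis i 1 + Im (v $ i) *\<^sub>R axis i \<i>) $ j
          = (\<Sum>i\<in>UNIV. if i = j then v $ j else 0)"
        unfolding sum_component
        by (rule sum.cong) (auto simp: axis_def complex_eq_iff)
      also have "\<dots> = v $ j" by simp
      finally show "v $ j = (\<Sum>i\<in>UNIV. Re (v $ i) *\<^sub>R axis i 1 + Im (v $ i) *\<^sub>R axis i \<i>) $ j" by simp
    qed
    have "D v = (\<Sum>i\<in>UNIV. Re (v $ i) * D (axis i 1) + Im (v $ i) * D (axis i \<i>))"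
      by (subst v) (simp add: linear_sum [OF assms] linear_add [OF assms] linear_cmul [OF assms])
    also have "\<dots> = Re (complex_dot a v)"
      by (simp add: complex_dot_def a_def algebra_simps)
    finally show ?thesis .
  qed
  then show ?thesis using that by blast
qed

lemma C_convex_supporting_hyperplane:
  fixes \<Omega> :: "(complex^'n) set"
  assumes \<Omega>: "open \<Omega>" "C_convex \<Omega>" "C1_hypersurface (frontier \<Omega>)" and p: "p \<in> frontier \<Omega>"
  obtains \<alpha> where "\<And>z. z \<in> \<Omega> \<Longrightarrow> complex_dot \<alpha> (z - p) \<noteq> 0"
proof -
  obtain r :: "complex^'n \<Rightarrow> real" and D \<nu> c t \<rho> where "0 < \<rho>" and r: "(r has_derivative D) (at p)" "r p = 0" "0 < D \<nu>"
    and inside: "\<And>z. \<lbrakk>dist z p < \<rho>; 0 < r z\<rbrakk> \<Longrightarrow> z \<in> \<Omega>"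
    using C1_boundary_inner_side [OF \<Omega>(1,3) p] by metis
  obtain a where a: "D = (\<lambda>v. Re (complex_dot a v))"
    using real_linear_eq_Re_complex_dot [OF has_derivative_linear [OF r(1)]] by blast
  have "p \<notin> \<Omega>" using p \<Omega>(1) by (simp add: frontier_def interior_open)
  have r1: "(r has_derivative (\<lambda>v. Re (complex_dot a v))) (at p)" and r3: "0 < Re (complex_dot a \<nu>)"
    using r unfolding a by auto
  show ?thesis
  proof (rule that)
    fix z assume "z \<in> \<Omega>"
    show "complex_dot a (z - p) \<noteq> 0"
    proof (rule C_convex_tangent_hyperplane [where r = r and \<rho> = \<rho> and n = \<nu> and \<Omega> = \<Omega>])
      show "w \<in> \<Omega>" if "dist w p < \<rho>" "0 < r w" for w using inside that .
    qed fact+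
  qed
qed

section \<open>Limits along transversal curves\<close>

text \<open>Along the segment the logarithm of the equation of a hyperplane through \<open>x\<close>
  missing \<open>\<Omega>\<close> is a constant minus \<open>s\<close>, which gives the lower bound
  with 48; inscribed balls give the upper bound with \<open>norm \<nu> / c\<close>. Neither constant
  depends on \<open>x\<close>.\<close>

lemma bilipschitz_path_transversal:
  fixes \<Omega> :: "(complex^'n) set"
  assumes ms: "Metric_space \<Omega> (kobayashi_dist \<Omega>)"
    and \<Omega>: "open \<Omega>" "C_convex \<Omega>" "C1_hypersurface (frontier \<Omega>)"
    and x: "x \<in> frontier \<Omega>" and cone: "truncated_cone x \<nu> c t \<subseteq> \<Omega>" and ct: "0 < c" "0 < t"
    and A: "norm \<nu> / c \<le> A" "48 \<le> A" and L: "0 \<le> L"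
  shows "Metric_space.bilipschitz_path \<Omega> (kobayashi_dist \<Omega>) A L (\<lambda>s. x + (t * exp (- s)) *\<^sub>R \<nu>)"
proof -
  interpret Metric_space \<Omega> "kobayashi_dist \<Omega>" by fact
  obtain \<alpha> where \<alpha>: "\<And>z. z \<in> \<Omega> \<Longrightarrow> complex_dot \<alpha> (z - x) \<noteq> 0"
    using C_convex_supporting_hyperplane [OF \<Omega> x] by metis
  define g where "g s = x + (t * exp (- s)) *\<^sub>R \<nu>" for s
  have g\<Omega>: "g s \<in> \<Omega>" if "0 \<le> s" for s
  proof -
    have "0 < t * exp (- s)" "t * exp (- s) \<le> t" using ct(2) that by auto
    then show ?thesis using cone truncated_cone_axis [OF ct(1), of "t * exp (- s)" t x \<nu>] by (auto simp: g_def)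
  qed
  \<comment> \<open>\<open>\<nu>\<close> is transversal to the hyperplane, because the top of the
    segment lies in \<open>\<Omega>\<close>.\<close>
  have n0: "complex_dot \<alpha> \<nu> \<noteq> 0"
  proof
    assume "complex_dot \<alpha> \<nu> = 0"
    then have "complex_dot \<alpha> (g 0 - x) = 0" by (simp add: g_def complex_dot_scaleR)
    then show False using \<alpha> [OF g\<Omega> [of 0]] by simp
  qed
  have val: "ln (cmod (complex_dot \<alpha> (g s) - complex_dot \<alpha> x)) = ln t - s + ln (cmod (complex_dot \<alpha> \<nu>))" for s
  proof -
    have "complex_dot \<alpha> (g s) - complex_dot \<alpha> x = (t * exp (- s)) *\<^sub>R complex_dot \<alpha> \<nu>"
      by (simp add: g_def complex_dot_add complex_dot_scaleR)
    then have "cmod (complex_dot \<alpha> (g s) - complex_dot \<alpha> x) = t * exp (- s) * cmod (complex_dot \<alpha> \<nu>)"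
      using ct(2) by (simp add: norm_mult)
    then show ?thesis using ct(2) n0 by (simp add: ln_mult)
  qed
  have lower: "\<bar>s - r\<bar> \<le> 48 * kobayashi_dist \<Omega> (g s) (g r)" if "0 \<le> s" "0 \<le> r" for s r
  proof -
    have "complex_dot \<alpha> z \<noteq> complex_dot \<alpha> x" if "z \<in> \<Omega>" for z using \<alpha> [OF that] by (simp add: complex_dot_diff)
    then have "\<bar>ln (cmod (complex_dot \<alpha> (g s) - complex_dot \<alpha> x)) - ln (cmod (complex_dot \<alpha> (g r) - complex_dot \<alpha> x))\<bar>
        \<le> 48 * kobayashi_dist \<Omega> (g s) (g r)"
      by (rule kobayashi_dist_ge_omitted_hyperplane [OF ms \<Omega>(1,2) _ g\<Omega> [OF that(1)] g\<Omega> [OF that(2)]])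
    then show ?thesis by (simp add: val abs_minus_commute)
  qed
  have up1: "kobayashi_dist \<Omega> (g s) (g r) \<le> A * (r - s)" if "0 \<le> s" "s < r" for s r
  proof -
    have "kobayashi_dist \<Omega> (g s) (g r) \<le> norm \<nu> / c * (r - s)"
      unfolding g_def by (rule kobayashi_dist_le_cone [OF cone ct that])
    also have "\<dots> \<le> A * (r - s)" using A(1) that by (intro mult_right_mono) auto
    finally show ?thesis .
  qed
  have upper: "kobayashi_dist \<Omega> (g s) (g r) \<le> A * \<bar>s - r\<bar>" if "0 \<le> s" "0 \<le> r" for s r
  proof -
    consider "s < r" | "s = r" | "r < s" by linarith
    then show ?thesis
    proof cases
      case 1 then show ?thesis using up1 that by simp
    next
      case 2 then show ?thesis using g\<Omega> [OF that(1)] by simp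
    next
      case 3 then show ?thesis using up1 [of r s] that commute [of "g s" "g r"] by simp
    qed
  qed
  have "\<bar>s - r\<bar> \<le> A * kobayashi_dist \<Omega> (g s) (g r)" if "0 \<le> s" "0 \<le> r" for s r
  proof -
    have "48 * kobayashi_dist \<Omega> (g s) (g r) \<le> A * kobayashi_dist \<Omega> (g s) (g r)" using A(2) by (intro mult_right_mono) auto
    then show ?thesis using lower [OF that] by linarith
  qed
  then show ?thesis
    unfolding bilipschitz_path_def g_def [symmetric] using L g\<Omega> upper by auto
qed

text \<open>The equation of an omitted hyperplane through \<open>p\<close> tends to 0 along the
  segment, and its logarithm to minus infinity.\<close>

lemma kobayashi_dist_transversal_unbounded:
  fixes \<Omega> :: "(complex^'n) set"
  assumes ms: "Metric_space \<Omega> (kobayashi_dist \<Omega>)"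
    and \<Omega>: "open \<Omega>" "C_convex \<Omega>" "C1_hypersurface (frontier \<Omega>)"
    and p: "p \<in> frontier \<Omega>" and cone: "truncated_cone p \<nu> c t \<subseteq> \<Omega>" and ct: "0 < c" "0 < t" and z: "z \<in> \<Omega>"
  obtains s0 where "0 < s0" "\<And>s. \<lbrakk>0 < s; s < s0; s \<le> t\<rbrakk> \<Longrightarrow> R < kobayashi_dist \<Omega> z (p + s *\<^sub>R \<nu>)"
proof -
  obtain \<alpha> where \<alpha>: "\<And>z. z \<in> \<Omega> \<Longrightarrow> complex_dot \<alpha> (z - p) \<noteq> 0"
    using C_convex_supporting_hyperplane [OF \<Omega> p] by metis
  have g\<Omega>: "p + s *\<^sub>R \<nu> \<in> \<Omega>" if "0 < s" "s \<le> t" for s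
    using cone truncated_cone_axis [OF ct(1) that] by blast
  define m where "m = cmod (complex_dot \<alpha> \<nu>)"
  have m: "0 < m" using \<alpha> [OF g\<Omega> [OF ct(2) order_refl]] by (auto simp: m_def complex_dot_scaleR)
  define l where "l = ln (cmod (complex_dot \<alpha> z - complex_dot \<alpha> p))"
  define s0 where "s0 = exp (l - 48 * R) / m"
  have s0: "0 < s0" using m by (simp add: s0_def)
  show ?thesis
  proof (rule that [OF s0])
    fix s assume s: "0 < s" "s < s0" "s \<le> t"
    have "complex_dot \<alpha> w \<noteq> complex_dot \<alpha> p" if "w \<in> \<Omega>" for w using \<alpha> [OF that] by (simp add: complex_dot_diff)
    then have "\<bar>l - ln (cmod (complex_dot \<alpha> (p + s *\<^sub>R \<nu>) - complex_dot \<alpha> p))\<bar> \<le> 48 * kobayashi_dist \<Omega> z (p + s *\<^sub>R \<nu>)"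
      unfolding l_def by (rule kobayashi_dist_ge_omitted_hyperplane [OF ms \<Omega>(1,2) _ z g\<Omega> [OF s(1,3)]])
    moreover have "cmod (complex_dot \<alpha> (p + s *\<^sub>R \<nu>) - complex_dot \<alpha> p) = s * m"
      using s by (simp add: complex_dot_add complex_dot_scaleR m_def)
    moreover have "ln (s * m) < ln (exp (l - 48 * R))"
    proof (subst ln_less_cancel_iff)
      show "s * m < exp (l - 48 * R)" using s(2) m by (simp add: s0_def pos_less_divide_eq)
    qed (use s m in auto)
    ultimately show "R < kobayashi_dist \<Omega> z (p + s *\<^sub>R \<nu>)" by simp
  qed
qed

text \<open>\<open>R\<close> stays fixed while one scale \<open>\<eta>\<close> tends to 0 for both
  the parameter and the Euclidean distance. The limit set of the main argument is the union over all
  \<open>R\<close>.\<close>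

definition transversal_limit :: "(complex^'n) set \<Rightarrow> (real \<Rightarrow> complex^'n) \<Rightarrow> real \<Rightarrow> complex^'n \<Rightarrow> bool" where
  "transversal_limit \<Omega> \<gamma> R q \<longleftrightarrow>
     (\<forall>\<eta>>0. \<exists>x\<in>\<Omega>. \<exists>s. 0 < s \<and> s < \<eta> \<and> dist x q < \<eta> \<and> kobayashi_dist \<Omega> x (\<gamma> s) \<le> R)"

text \<open>A limit inside \<open>\<Omega>\<close> would have bounded distance from points of the
  segment arbitrarily close to \<open>p\<close>.\<close>

lemma transversal_limit_frontier:
  fixes \<Omega> :: "(complex^'n) set"
  assumes ms: "Metric_space \<Omega> (kobayashi_dist \<Omega>)"
    and \<Omega>: "open \<Omega>" "C_convex \<Omega>" "C1_hypersurface (frontier \<Omega>)"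
    and p: "p \<in> frontier \<Omega>" and cone: "truncated_cone p \<nu> c t \<subseteq> \<Omega>" and ct: "0 < c" "0 < t"
    and q: "transversal_limit \<Omega> (\<lambda>s. p + s *\<^sub>R \<nu>) R q"
  shows "q \<in> frontier \<Omega>"
proof -
  interpret Metric_space \<Omega> "kobayashi_dist \<Omega>" by fact
  have "q \<in> closure \<Omega>"
    unfolding closure_approachable using q unfolding transversal_limit_def by blast
  moreover have "q \<notin> \<Omega>"
  proof
    assume q\<Omega>: "q \<in> \<Omega>"
    obtain e where e: "0 < e" "ball q e \<subseteq> \<Omega>" using \<Omega>(1) q\<Omega> by (meson open_contains_ball)
    obtain s0 where s0: "0 < s0" "\<And>s. \<lbrakk>0 < s; s < s0; s \<le> t\<rbrakk> \<Longrightarrow> R + 1 < kobayashi_dist \<Omega> q (p + s *\<^sub>R \<nu>)"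
      by (rule kobayashi_dist_transversal_unbounded [OF ms \<Omega> p cone ct q\<Omega>]) (rule that)
    have "0 < min (e/2) (min s0 t)" using e s0 ct by simp
    then obtain x s where x: "x \<in> \<Omega>" "0 < s" "s < min (e/2) (min s0 t)" "dist x q < min (e/2) (min s0 t)"
      "kobayashi_dist \<Omega> x (p + s *\<^sub>R \<nu>) \<le> R"
      using q unfolding transversal_limit_def by blast
    have "kobayashi_dist \<Omega> q x \<le> 1"
      by (rule kobayashi_dist_le_in_ball [of q "e/2"]) (use e x in \<open>auto simp: dist_commute\<close>)
    moreover have "p + s *\<^sub>R \<nu> \<in> \<Omega>" using cone truncated_cone_axis [OF ct(1), of s t p \<nu>] x by auto
    ultimately have "kobayashi_dist \<Omega> q (p + s *\<^sub>R \<nu>) \<le> R + 1" using triangle [OF q\<Omega> x(1)] x(5) by fastforce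
    then show False using s0(2) [of s] x by auto
  qed
  ultimately show ?thesis using \<Omega>(1) by (simp add: frontier_def interior_open)
qed

text \<open>The limits \<open>q'\<close> near \<open>q\<close> may require unbounded
  \<open>R\<close>. For each accuracy, a segment ending near a suitable \<open>q'\<close> fellow
  travels with the one at \<open>p\<close>, and its point at a depth \<open>\<tau>\<close> fixed
  beforehand is within the universal distance \<open>C\<close>; so \<open>q\<close> is a limit for
  \<open>C\<close>.\<close>

lemma transversal_limits_closed:
  fixes \<Omega> :: "(complex^'n) set"
  assumes ms: "Metric_space \<Omega> (kobayashi_dist \<Omega>)"
    and hyp: "Metric_space.delta_hyperbolic \<Omega> (kobayashi_dist \<Omega>) \<delta>" "0 \<le> \<delta>"
    and \<Omega>: "open \<Omega>" "C_convex \<Omega>" "C1_hypersurface (frontier \<Omega>)"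
    and p: "p \<in> frontier \<Omega>" and cone: "truncated_cone p \<nu> c t \<subseteq> \<Omega>" and ct: "0 < c" "0 < t"
    and lim: "\<And>\<epsilon>. 0 < \<epsilon> \<Longrightarrow> \<exists>q' R. dist q' q < \<epsilon> \<and> transversal_limit \<Omega> (\<lambda>s. p + s *\<^sub>R \<nu>) R q'"
  shows "\<exists>R. transversal_limit \<Omega> (\<lambda>s. p + s *\<^sub>R \<nu>) R q"
proof -
  interpret Metric_space \<Omega> "kobayashi_dist \<Omega>" by fact
  let ?K = "kobayashi_dist \<Omega>"
  have "q \<in> closure (frontier \<Omega>)"
    unfolding closure_approachable
    using lim transversal_limit_frontier [OF ms \<Omega> p cone ct] by blast
  then have q: "q \<in> frontier \<Omega>" by simp
  obtain \<nu>' c' t' where ct': "0 < c'" "0 < t'" and tr: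
    "\<And>\<eta>. 0 < \<eta> \<Longrightarrow> \<exists>\<rho>>0. \<forall>y\<in>\<Omega>. dist y q < \<rho> \<longrightarrow>
       (\<exists>\<sigma>\<in>{\<nu>', - \<nu>'}. \<exists>s. 0 < s \<and> s < \<eta> \<and> s \<le> t' \<and> y - s *\<^sub>R \<sigma> \<in> frontier \<Omega> \<and>
          dist (y - s *\<^sub>R \<sigma>) q < \<eta> \<and> truncated_cone (y - s *\<^sub>R \<sigma>) \<sigma> c' t' \<subseteq> \<Omega>)"
    by (rule C1_boundary_transversal_curves [OF \<Omega>(1,3) q]) (rule that)
  define A where "A = max (max (norm \<nu> / c) (norm \<nu>' / c')) 48"
  have A: "norm \<nu> / c \<le> A" "norm \<nu>' / c' \<le> A" "48 \<le> A" "0 < A" by (auto simp: A_def)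
  obtain C where C: "0 \<le> C"
    "\<And>c1 L1 c2 L2 t D R. \<lbrakk>bilipschitz_path A L1 c1; bilipschitz_path A L2 c2;
        ?K (c1 0) (c2 0) \<le> D; ?K (c1 L1) (c2 L2) \<le> R; t \<in> {0..L1};
        A * (C + D) < t; A * (C + R) < L1 - t\<rbrakk>
       \<Longrightarrow> \<exists>t'\<in>{0..L2}. ?K (c1 t) (c2 t') \<le> C"
    by (rule bilipschitz_paths_fellow_travel [OF hyp(1) A(4) hyp(2)]) (rule that)
  \<comment> \<open>The tops of the segments near \<open>q\<close> are close to one of two fixed
    points, one for each sign of the direction; moving a top there costs at most 1.\<close>
  define D where "D = 1 + \<bar>?K (q + t' *\<^sub>R \<nu>') (p + t *\<^sub>R \<nu>)\<bar> + \<bar>?K (q + t' *\<^sub>R (- \<nu>')) (p + t *\<^sub>R \<nu>)\<bar>"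
  have D: "0 \<le> D" by (simp add: D_def)
  have pt: "p + s *\<^sub>R \<nu> \<in> \<Omega>" if "0 < s" "s \<le> t" for s using cone truncated_cone_axis [OF ct(1) that] by blast
  have "transversal_limit \<Omega> (\<lambda>s. p + s *\<^sub>R \<nu>) C q"
    unfolding transversal_limit_def
  proof (intro allI impI)
    fix \<eta> :: real assume "0 < \<eta>"
    \<comment> \<open>Three demands, none involving \<open>R\<close>: the chosen point is beyond the
      influence of the tops, its companion on the segment at \<open>p\<close> has parameter below
      \<open>\<eta>\<close>, and it is within \<open>\<eta> / 2\<close> of the foot of its
      segment.\<close>
    define \<tau> where "\<tau> = max (A * (C + D) + 1)
      (max (A * (C + D + A * \<bar>ln (t / \<eta>)\<bar>) + 1) \<bar>ln (2 * t' * (norm \<nu>' + 1) / \<eta>)\<bar>)"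
    have \<tau>: "A * (C + D) < \<tau>" "A * (C + D + A * \<bar>ln (t / \<eta>)\<bar>) < \<tau>" "ln (2 * t' * (norm \<nu>' + 1) / \<eta>) \<le> \<tau>" "0 \<le> \<tau>"
      by (auto simp: \<tau>_def less_max_iff_disj le_max_iff_disj)
    have n1: "0 < norm \<nu>' + 1" by (simp add: add_nonneg_pos)
    have s1: "t' * exp (- \<tau>) * norm \<nu>' < \<eta> / 2"
    proof -
      have "2 * t' * (norm \<nu>' + 1) / \<eta> \<le> exp \<tau>"
        using \<tau>(3) ct'(2) n1 \<open>0 < \<eta>\<close> by (metis divide_pos_pos exp_le_cancel_iff exp_ln mult_pos_pos zero_less_numeral)
      then have "t' * (norm \<nu>' + 1) * exp (- \<tau>) \<le> \<eta> / 2"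
        using \<open>0 < \<eta>\<close> by (simp add: exp_minus field_simps)
      moreover have "t' * norm \<nu>' * exp (- \<tau>) < t' * (norm \<nu>' + 1) * exp (- \<tau>)" using ct'(2) by simp
      ultimately show ?thesis by (simp add: ac_simps)
    qed
    define \<eta>1 where "\<eta>1 = min (\<eta>/2) (c' * t' / 4)"
    have \<eta>1: "0 < \<eta>1" "\<eta>1 \<le> \<eta>/2" "\<eta>1 \<le> c' * t' / 4" using \<open>0 < \<eta>\<close> ct' by (auto simp: \<eta>1_def)
    obtain \<rho> where \<rho>: "0 < \<rho>" and foot: "\<forall>y\<in>\<Omega>. dist y q < \<rho> \<longrightarrow>
       (\<exists>\<sigma>\<in>{\<nu>', - \<nu>'}. \<exists>s. 0 < s \<and> s < \<eta>1 \<and> s \<le> t' \<and> y - s *\<^sub>R \<sigma> \<in> frontier \<Omega> \<and>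
          dist (y - s *\<^sub>R \<sigma>) q < \<eta>1 \<and> truncated_cone (y - s *\<^sub>R \<sigma>) \<sigma> c' t' \<subseteq> \<Omega>)"
      using tr [OF \<eta>1(1)] by blast
    obtain q' R where q': "dist q' q < \<rho>/2" "transversal_limit \<Omega> (\<lambda>s. p + s *\<^sub>R \<nu>) R q'"
      using lim [of "\<rho>/2"] \<rho> by auto
    \<comment> \<open>A lower bound for \<open>L2\<close> that will force \<open>L1\<close> past
      \<open>\<tau>\<close> plus the zone of length \<open>A * (C + R)\<close> influenced by the
      lower ends.\<close>
    define E where "E = A * (D + R + A * (\<tau> + A * (C + R) + 1))"
    define \<eta>2 where "\<eta>2 = min (\<rho>/2) (min t (t * exp (- E)))"
    have \<eta>2: "0 < \<eta>2" "\<eta>2 \<le> \<rho>/2" "\<eta>2 \<le> t" "\<eta>2 \<le> t * exp (- E)" using \<rho> ct(2) by (auto simp: \<eta>2_def)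
    obtain y s where y: "y \<in> \<Omega>" "0 < s" "s < \<eta>2" "dist y q' < \<eta>2" "?K y (p + s *\<^sub>R \<nu>) \<le> R"
      using q'(2) \<eta>2(1) unfolding transversal_limit_def by blast
    have "dist y q < \<rho>" using dist_triangle [of y q q'] y(4) q'(1) \<eta>2(2) by linarith
    then obtain \<sigma> sy where \<sigma>: "\<sigma> \<in> {\<nu>', - \<nu>'}" and sy: "0 < sy" "sy \<le> t'"
      and fr: "y - sy *\<^sub>R \<sigma> \<in> frontier \<Omega>" and xq: "dist (y - sy *\<^sub>R \<sigma>) q < \<eta>1"
      and cone': "truncated_cone (y - sy *\<^sub>R \<sigma>) \<sigma> c' t' \<subseteq> \<Omega>"
      using foot y(1) by blast
    define x where "x = y - sy *\<^sub>R \<sigma>"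
    have n\<sigma>: "norm \<sigma> = norm \<nu>'" using \<sigma> by auto
    define L1 where "L1 = ln (t' / sy)"
    define L2 where "L2 = ln (t / s)"
    have st: "s \<le> t" using y(3) \<eta>2(3) by linarith
    have L: "0 \<le> L1" "0 \<le> L2" using sy st y(2) by (auto simp: L1_def L2_def)
    define c1 where "c1 r = x + (t' * exp (- r)) *\<^sub>R \<sigma>" for r
    define c2 where "c2 r = p + (t * exp (- r)) *\<^sub>R \<nu>" for r
    have b1: "bilipschitz_path A L1 c1"
      unfolding c1_def
      using bilipschitz_path_transversal [OF ms \<Omega> fr cone' ct' _ A(3) L(1)] A(2) n\<sigma> by (simp add: x_def)
    have b2: "bilipschitz_path A L2 c2"
      unfolding c2_def by (rule bilipschitz_path_transversal [OF ms \<Omega> p cone ct A(1,3) L(2)])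
    have "t' * exp (- L1) = sy" using sy ct' by (simp add: L1_def exp_minus)
    then have c1e: "c1 0 = x + t' *\<^sub>R \<sigma>" "c1 L1 = y" by (auto simp: c1_def x_def)
    have "t * exp (- L2) = s" using y(2) ct by (simp add: L2_def exp_minus)
    then have c2e: "c2 0 = p + t *\<^sub>R \<nu>" "c2 L2 = p + s *\<^sub>R \<nu>" by (auto simp: c2_def)
    have inL: "0 \<in> {0..L1}" "L1 \<in> {0..L1}" "0 \<in> {0..L2}" "L2 \<in> {0..L2}" using L by auto
    note b1D = bilipschitz_pathD [OF b1] and b2D = bilipschitz_pathD [OF b2]
    have M: "c1 0 \<in> \<Omega>" "c1 L1 \<in> \<Omega>" "c2 0 \<in> \<Omega>" "c2 L2 \<in> \<Omega>" using b1D(2) b2D(2) inL by auto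
    have top: "?K (c1 0) (c2 0) \<le> D"
    proof -
      have bal: "ball (x + t' *\<^sub>R \<sigma>) (c' * t') \<subseteq> \<Omega>"
        using cone' ct'(2) unfolding truncated_cone_def x_def by (meson UN_upper greaterThanAtMost_iff order_refl order_trans)
      have d: "dist (x + t' *\<^sub>R \<sigma>) (q + t' *\<^sub>R \<sigma>) < c' * t' / 2" using xq \<eta>1(1,3) unfolding x_def by simp
      have 1: "?K (x + t' *\<^sub>R \<sigma>) (q + t' *\<^sub>R \<sigma>) \<le> 1"
        by (rule kobayashi_dist_le_in_ball [OF _ d]) (use bal in simp)
      have "dist (x + t' *\<^sub>R \<sigma>) (q + t' *\<^sub>R \<sigma>) < c' * t'" using d mult_pos_pos [OF ct'] by linarith
      then have "q + t' *\<^sub>R \<sigma> \<in> \<Omega>" by (intro subsetD [OF bal]) simp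
      then have "?K (c1 0) (c2 0) \<le> ?K (x + t' *\<^sub>R \<sigma>) (q + t' *\<^sub>R \<sigma>) + ?K (q + t' *\<^sub>R \<sigma>) (p + t *\<^sub>R \<nu>)"
        using triangle [OF M(1) _ M(3), of "q + t' *\<^sub>R \<sigma>"] by (simp add: c1e c2e)
      moreover have "?K (q + t' *\<^sub>R \<sigma>) (p + t *\<^sub>R \<nu>) \<le> D - 1" using \<sigma> by (auto simp: D_def)
      ultimately show ?thesis using 1 by linarith
    qed
    have bot: "?K (c1 L1) (c2 L2) \<le> R" using y(5) by (simp add: c1e c2e)
    have E: "E < L2"
    proof -
      have "s < t * exp (- E)" using y(3) \<eta>2(4) by linarith
      then have "exp E < t / s" using y(2) by (simp add: exp_minus field_simps)
      then have "ln (exp E) < ln (t / s)" using y(2) ct(2) by (subst ln_less_cancel_iff) auto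
      then show ?thesis by (simp add: L2_def)
    qed
    \<comment> \<open>Tops and lower ends of the two segments have distances at most
      \<open>D\<close> and \<open>R\<close>, so a long segment at \<open>p\<close> forces a long one
      at \<open>x\<close>.\<close>
    have L1big: "\<tau> + A * (C + R) + 1 \<le> L1"
    proof -
      have "L2 \<le> A * ?K (c2 0) (c2 L2)" using b2D(4) [OF inL(3,4)] L by simp
      also have "\<dots> \<le> A * (?K (c2 0) (c1 0) + ?K (c1 0) (c1 L1) + ?K (c1 L1) (c2 L2))"
        using triangle [OF M(3,1,4)] triangle [OF M(1,2,4)] A(4) by (intro mult_left_mono) auto
      also have "\<dots> \<le> A * (D + A * L1 + R)"
        using top bot b1D(3) [OF inL(1,2)] L A(4) commute [of "c2 0" "c1 0"] by (intro mult_left_mono) auto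
      finally have "A * (D + R + A * (\<tau> + A * (C + R) + 1)) < A * (D + A * L1 + R)" using E by (simp add: E_def)
      then have "A * (\<tau> + A * (C + R) + 1) < A * L1" using A(4) by simp
      then show ?thesis using A(4) by simp
    qed
    have R: "0 \<le> R" using bot nonneg [of "c1 L1" "c2 L2"] by linarith
    then have "0 \<le> A * (C + R)" using A(4) C(1) by simp
    then have \<tau>L: "\<tau> \<in> {0..L1}" "A * (C + R) < L1 - \<tau>" using L1big \<tau>(4) by auto
    obtain \<tau>' where \<tau>': "\<tau>' \<in> {0..L2}" "?K (c1 \<tau>) (c2 \<tau>') \<le> C"
      using C(2) [OF b1 b2 top bot \<tau>L(1) \<tau>(1) \<tau>L(2)] by blast
    have M2: "c1 \<tau> \<in> \<Omega>" "c2 \<tau>' \<in> \<Omega>" using b1D(2) b2D(2) \<tau>L \<tau>' by auto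
    show "\<exists>x\<in>\<Omega>. \<exists>s. 0 < s \<and> s < \<eta> \<and> dist x q < \<eta> \<and> ?K x (p + s *\<^sub>R \<nu>) \<le> C"
    proof (intro bexI [of _ "c1 \<tau>"] exI [of _ "t * exp (- \<tau>')"] conjI)
      show "0 < t * exp (- \<tau>')" using ct by simp
      show "?K (c1 \<tau>) (p + (t * exp (- \<tau>')) *\<^sub>R \<nu>) \<le> C" using \<tau>'(2) by (simp add: c2_def)
      have "dist (c1 \<tau>) x < \<eta> / 2" using s1 ct' by (simp add: c1_def dist_norm n\<sigma>)
      then show "dist (c1 \<tau>) q < \<eta>" using xq \<eta>1(2) dist_triangle [of "c1 \<tau>" q x] unfolding x_def by linarith
      \<comment> \<open>Otherwise the companion has a parameter of bounded size, and the triangle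
        inequality through the tops bounds \<open>\<tau>\<close> below its chosen value.\<close>
      show "t * exp (- \<tau>') < \<eta>"
      proof (rule ccontr)
        assume "\<not> t * exp (- \<tau>') < \<eta>"
        then have "exp \<tau>' \<le> t / \<eta>" using \<open>0 < \<eta>\<close> by (simp add: exp_minus field_simps)
        then have "ln (exp \<tau>') \<le> ln (t / \<eta>)" using ct(2) \<open>0 < \<eta>\<close> by (subst ln_le_cancel_iff) auto
        then have \<tau>'le: "\<tau>' \<le> \<bar>ln (t / \<eta>)\<bar>" by simp
        have "\<tau> \<le> A * ?K (c1 0) (c1 \<tau>)" using b1D(4) [OF inL(1) \<tau>L(1)] \<tau>(4) by simp
        also have "\<dots> \<le> A * (?K (c1 0) (c2 0) + ?K (c2 0) (c2 \<tau>') + ?K (c2 \<tau>') (c1 \<tau>))"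
          using triangle [OF M(1,3) M2(1)] triangle [OF M(3) M2(2,1)] A(4) by (intro mult_left_mono) auto
        also have "\<dots> \<le> A * (D + A * \<bar>ln (t / \<eta>)\<bar> + C)"
        proof -
          have "?K (c2 0) (c2 \<tau>') \<le> A * \<tau>'" using b2D(3) [OF inL(3) \<tau>'(1)] \<tau>'(1) by simp
          also have "\<dots> \<le> A * \<bar>ln (t / \<eta>)\<bar>" using \<tau>'le A(4) by (intro mult_left_mono) auto
          finally show ?thesis
            using top \<tau>'(2) commute [of "c2 \<tau>'" "c1 \<tau>"] A(4) by (intro mult_left_mono) auto
        qed
        finally show False using \<tau>(2) by (simp add: algebra_simps)
      qed
    qed fact
  qed
  then show ?thesis by blast
qed


text \<open>Holomorphic discs through points close to \<open>p + s \<nu>\<close> have \<open>Re (complex_dot \<beta>)\<close> asymptotically at most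
  \<open>m\<close>, so the Kobayashi metric there dominates the one of a half plane.\<close>

lemma transversal_limit_not_maximal:
  fixes \<Omega> :: "(complex^'n) set"
  assumes ms: "Metric_space \<Omega> (kobayashi_dist \<Omega>)" and \<Omega>: "open \<Omega>" "bounded \<Omega>"
    and \<gamma>: "0 < t" "\<And>s. \<lbrakk>0 < s; s < t\<rbrakk> \<Longrightarrow> p + s *\<^sub>R \<nu> \<in> \<Omega>"
    and q: "transversal_limit \<Omega> (\<lambda>s. p + s *\<^sub>R \<nu>) R q" and less: "Re (complex_dot \<beta> p) < Re (complex_dot \<beta> q)"
    and max: "\<And>R q'. transversal_limit \<Omega> (\<lambda>s. p + s *\<^sub>R \<nu>) R q' \<Longrightarrow> Re (complex_dot \<beta> q') \<le> Re (complex_dot \<beta> q)"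
  shows False
proof -
  interpret Metric_space \<Omega> "kobayashi_dist \<Omega>" by fact
  let ?K = "kobayashi_dist \<Omega>"
  let ?u = "\<lambda>z. Re (complex_dot \<beta> z)"
  define m where "m = ?u q"
  \<comment> \<open>Otherwise offending points accumulate, since \<open>\<Omega>\<close> is bounded,
    at a transversal limit where the functional is at least \<open>m + \<epsilon>\<close>.\<close>
  have asym: "\<exists>\<eta>>0. \<forall>s x. 0 < s \<and> s < \<eta> \<and> x \<in> \<Omega> \<and> ?K x (p + s *\<^sub>R \<nu>) \<le> R' \<longrightarrow> ?u x < m + \<epsilon>"
    if "0 < \<epsilon>" for \<epsilon> R'
  proof (rule ccontr)
    assume neg: "\<not> ?thesis"
    have "\<exists>s x. 0 < s \<and> s < inverse (real (Suc n)) \<and> x \<in> \<Omega> \<and> ?K x (p + s *\<^sub>R \<nu>) \<le> R' \<and> m + \<epsilon> \<le> ?u x" for n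
    proof -
      have "0 < inverse (real (Suc n))" by simp
      then show ?thesis using neg by (meson not_less)
    qed
    then obtain s x where sx: "\<And>n. 0 < s n" "\<And>n. s n < inverse (real (Suc n))" "\<And>n. x n \<in> \<Omega>"
      "\<And>n. ?K (x n) (p + s n *\<^sub>R \<nu>) \<le> R'" "\<And>n. m + \<epsilon> \<le> ?u (x n)"
      by metis
    have "compact (closure \<Omega>)" using \<Omega>(2) by (simp add: compact_closure)
    moreover have "\<forall>n. x n \<in> closure \<Omega>" using sx(3) closure_subset by blast
    ultimately obtain l r where l: "strict_mono (r :: nat \<Rightarrow> nat)" "(x \<circ> r) \<longlonglongrightarrow> l"
      unfolding compact_def by metis
    have "transversal_limit \<Omega> (\<lambda>s. p + s *\<^sub>R \<nu>) R' l"
      unfolding transversal_limit_def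
    proof (intro allI impI)
      fix \<eta> :: real assume "0 < \<eta>"
      have "\<forall>\<^sub>F n in sequentially. dist ((x \<circ> r) n) l < \<eta>" using l(2) \<open>0 < \<eta>\<close> by (rule tendstoD)
      moreover have "\<forall>\<^sub>F n in sequentially. inverse (real (Suc n)) < \<eta>"
        using order_tendstoD(2) [OF LIMSEQ_inverse_real_of_nat \<open>0 < \<eta>\<close>] .
      ultimately have "\<forall>\<^sub>F n in sequentially. dist ((x \<circ> r) n) l < \<eta> \<and> inverse (real (Suc n)) < \<eta>"
        by (rule eventually_conj)
      then obtain n where n: "dist (x (r n)) l < \<eta>" "inverse (real (Suc n)) < \<eta>"
        using eventually_happens' [OF sequentially_bot] by force
      have "inverse (real (Suc (r n))) \<le> inverse (real (Suc n))"
        using seq_suble [OF l(1), of n] by (intro le_imp_inverse_le) auto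
      then have "s (r n) < \<eta>" using sx(2) [of "r n"] n(2) by linarith
      then show "\<exists>x\<in>\<Omega>. \<exists>s. 0 < s \<and> s < \<eta> \<and> dist x l < \<eta> \<and> ?K x (p + s *\<^sub>R \<nu>) \<le> R'"
        using sx(1,3,4) n(1) by (intro bexI [of _ "x (r n)"] exI [of _ "s (r n)"]) auto
    qed
    then have "?u l \<le> m" unfolding m_def by (rule max)
    moreover have "m + \<epsilon> \<le> ?u l"
    proof (rule LIMSEQ_le_const)
      show "(\<lambda>n. ?u ((x \<circ> r) n)) \<longlonglongrightarrow> ?u l"
        by (intro tendsto_Re bounded_linear.tendsto [OF bounded_linear_complex_dot l(2)])
    qed (use sx(5) in auto)
    ultimately show False using \<open>0 < \<epsilon>\<close> by linarith
  qed
  have R: "0 \<le> R"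
  proof -
    obtain x s where "?K x (p + s *\<^sub>R \<nu>) \<le> R" using q zero_less_one unfolding transversal_limit_def by blast
    then show ?thesis using nonneg [of x "p + s *\<^sub>R \<nu>"] by linarith
  qed
  obtain k where k: "0 < k" "\<And>x. cmod (complex_dot \<beta> x) \<le> norm x * k"
    using bounded_linear.pos_bounded [OF bounded_linear_complex_dot] by blast
  have lip: "\<bar>?u x - ?u y\<bar> \<le> k * dist x y" for x y
    using abs_Re_le_cmod [of "complex_dot \<beta> (x - y)"] k(2) [of "x - y"]
    by (simp add: complex_dot_diff dist_norm mult.commute)
  define h where "h = (m - ?u p) / 2"
  have h: "0 < h" using less by (simp add: h_def m_def)
  \<comment> \<open>The depth below \<open>M\<close> is at least \<open>h\<close> at
    \<open>y\<close> near \<open>p\<close> and at most \<open>2 * \<epsilon>\<close> at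
    \<open>x\<close> near \<open>q\<close>. With this \<epsilon> the logarithms differ by at least
    \<open>4 * (R + 1) + 1\<close>, more than the half-plane bound allows.\<close>
  define \<epsilon> where "\<epsilon> = h * exp (- (4 * (R + 1) + 1)) / 2"
  have \<epsilon>: "0 < \<epsilon>" using h by (simp add: \<epsilon>_def)
  define M where "M = m + \<epsilon>"
  \<comment> \<open>In \<open>R + 2\<close>, one unit makes the length bound strict and the other is
    the distance from the centre of a disc to points of its inner half.\<close>
  obtain \<eta>0 where \<eta>0: "0 < \<eta>0"
    "\<And>s x. \<lbrakk>0 < s; s < \<eta>0; x \<in> \<Omega>; ?K x (p + s *\<^sub>R \<nu>) \<le> R + 2\<rbrakk> \<Longrightarrow> ?u x < M"
    using asym [OF \<epsilon>, of "R + 2"] unfolding M_def by blast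
  define \<eta> where "\<eta> = min (min \<eta>0 t) (min (\<epsilon> / k) (h / (k * (norm \<nu> + 1))))"
  have n1: "0 < norm \<nu> + 1" by (simp add: add_nonneg_pos)
  have \<eta>: "0 < \<eta>" "\<eta> \<le> \<eta>0" "\<eta> \<le> t" "\<eta> \<le> \<epsilon> / k" "\<eta> \<le> h / (k * (norm \<nu> + 1))"
    using \<eta>0 \<gamma>(1) \<epsilon> k h n1 by (auto simp: \<eta>_def)
  obtain x s where x: "x \<in> \<Omega>" "0 < s" "s < \<eta>" "dist x q < \<eta>" "?K x (p + s *\<^sub>R \<nu>) \<le> R"
    using q \<eta>(1) unfolding transversal_limit_def by blast
  define y where "y = p + s *\<^sub>R \<nu>"
  have y: "y \<in> \<Omega>" unfolding y_def using x \<eta> by (intro \<gamma>(2)) auto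
  have "\<bar>ln (M - ?u y) - ln (M - ?u x)\<bar> \<le> 4 * (R + 1)"
  proof (rule kobayashi_dist_ge_half_plane [OF ms \<Omega>(1) x(1) y])
    show "?K x y < R + 1" using x(5) by (simp add: y_def)
    fix z f \<zeta>
    assume z: "z \<in> \<Omega>" "?K z y \<le> R + 1" and f: "f \<in> Hol_disc \<Omega>" "f 0 = z" and \<zeta>: "cmod \<zeta> < 1/2"
    have f\<zeta>: "f \<zeta> \<in> \<Omega>" using \<zeta> by (intro Hol_discD(2) [OF f(1)]) simp
    have "?K z (f \<zeta>) \<le> 1" using kobayashi_dist_le_disc [OF f(1), of \<zeta>] \<zeta> f(2) by simp
    then have "?K (f \<zeta>) y \<le> R + 2" using triangle [OF f\<zeta> z(1) y] z(2) commute [of z "f \<zeta>"] by linarith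
    then show "?u (f \<zeta>) < M" using \<eta>0(2) [of s "f \<zeta>"] x \<eta> f\<zeta> by (simp add: y_def)
  qed
  moreover have "?u x < M" using \<eta>0(2) [of s x] x \<eta> by simp
  moreover have "M - ?u x \<le> 2 * \<epsilon>"
  proof -
    have "k * dist x q \<le> k * (\<epsilon> / k)" using x(4) \<eta>(4) k(1) by (intro mult_left_mono) auto
    then have "\<bar>?u x - m\<bar> \<le> \<epsilon>" using lip [of x q] k(1) by (simp add: m_def)
    then show ?thesis by (simp add: M_def)
  qed
  moreover have "h \<le> M - ?u y"
  proof -
    have "dist y p = s * norm \<nu>" using x(2) by (simp add: y_def dist_norm)
    also have "\<dots> \<le> \<eta> * (norm \<nu> + 1)" using x by (intro mult_mono) auto
    also have "\<dots> \<le> h / (k * (norm \<nu> + 1)) * (norm \<nu> + 1)" using \<eta>(5) n1 by (intro mult_right_mono) auto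
    also have "\<dots> = h / k" using n1 by simp
    finally have "k * dist y p \<le> k * (h / k)" using k(1) by (intro mult_left_mono) auto
    then have "\<bar>?u y - ?u p\<bar> \<le> h" using lip [of y p] k(1) by simp
    moreover have "m - ?u p = 2 * h" by (simp add: h_def)
    ultimately show ?thesis using \<epsilon> by (simp add: M_def)
  qed
  ultimately have "ln h - ln (2 * \<epsilon>) \<le> 4 * (R + 1)"
    using h \<epsilon> ln_le_cancel_iff [of h "M - ?u y"] ln_le_cancel_iff [of "M - ?u x" "2 * \<epsilon>"] by linarith
  moreover have "ln (2 * \<epsilon>) = ln h - (4 * (R + 1) + 1)" using h by (simp add: \<epsilon>_def ln_mult)
  ultimately show False by simp
qed

text \<open>A translate of \<open>\<phi>\<close> by a small positive multiple of
  \<open>\<nu>\<close> is a disc in \<open>\<Omega>\<close> whose inner half contains the points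
  over \<open>z0\<close> and \<open>z\<close>; this gives the bound 1 at every scale.\<close>

lemma transversal_limit_along_disc:
  fixes \<phi> :: "complex \<Rightarrow> complex^'n"
  assumes ms: "Metric_space \<Omega> (kobayashi_dist \<Omega>)"
    and \<phi>: "holomorphic_map_on \<phi> (ball z0 r)" "0 < r"
    and inside: "0 < t" "\<And>z s. \<lbrakk>z \<in> ball z0 r; 0 < s; s < t\<rbrakk> \<Longrightarrow> \<phi> z + s *\<^sub>R \<nu> \<in> \<Omega>"
    and z: "dist z z0 < r / 2"
  shows "transversal_limit \<Omega> (\<lambda>s. \<phi> z0 + s *\<^sub>R \<nu>) 1 (\<phi> z)"
  unfolding transversal_limit_def
proof (intro allI impI)
  fix \<eta> :: real assume "0 < \<eta>"
  define s where "s = min (t/2) (\<eta> / (2 * (norm \<nu> + 1)))"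
  have n1: "1 \<le> norm \<nu> + 1" by simp
  have n2: "0 < norm \<nu> + 1" by (simp add: add_nonneg_pos)
  have "0 < \<eta> / (2 * (norm \<nu> + 1))"
    by (rule divide_pos_pos [OF \<open>0 < \<eta>\<close> mult_pos_pos [OF zero_less_numeral n2]])
  then have "0 < s" "s \<le> t / 2" "s \<le> \<eta> / (2 * (norm \<nu> + 1))"
    using inside(1) unfolding s_def by (simp_all only: min_less_iff_conj min.cobounded1 min.cobounded2) simp
  then have s: "0 < s" "s < t" "s \<le> \<eta> / (2 * (norm \<nu> + 1))"
    using inside(1) by linarith+
  have "s * (norm \<nu> + 1) \<le> \<eta> / 2" using s(3) n2 by (simp add: field_simps)
  moreover have "s \<le> s * (norm \<nu> + 1)" "s * norm \<nu> \<le> s * (norm \<nu> + 1)" using s(1) n1 by auto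
  ultimately have s\<eta>: "s < \<eta>" "s * norm \<nu> < \<eta>" using \<open>0 < \<eta>\<close> by linarith+
  define f where "f w = \<phi> (z0 + complex_of_real r * w) + s *\<^sub>R \<nu>" for w
  have arg: "z0 + complex_of_real r * w \<in> ball z0 r" if "norm w < 1" for w
    using that \<open>0 < r\<close> by (simp add: dist_norm norm_mult)
  have f: "f \<in> Hol_disc \<Omega>"
    unfolding Hol_disc_def holomorphic_map_on_def
  proof (intro CollectI conjI allI image_subsetI)
    fix i
    have "(\<lambda>z. \<phi> z $ i) holomorphic_on ball z0 r" using \<phi>(1) by (simp add: holomorphic_map_on_def)
    then have "(\<lambda>w. \<phi> (z0 + complex_of_real r * w) $ i) holomorphic_on ball 0 1"
      by (rule holomorphic_on_compose_gen [of "\<lambda>w. z0 + complex_of_real r * w", unfolded o_def, rotated])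
         (use arg in \<open>auto intro!: holomorphic_intros\<close>)
    then show "(\<lambda>w. f w $ i) holomorphic_on ball 0 1"
      unfolding f_def by (simp, intro holomorphic_intros)
    show "f w \<in> \<Omega>" if "w \<in> ball 0 1" for w
      unfolding f_def using that s by (intro inside(2) arg) auto
  qed
  define w where "w = (z - z0) / complex_of_real r"
  have nw: "norm w \<le> 1/2" using z \<open>0 < r\<close> by (simp add: w_def norm_divide dist_norm divide_le_eq)
  have fw: "f w = \<phi> z + s *\<^sub>R \<nu>" using \<open>0 < r\<close> by (simp add: f_def w_def)
  have "kobayashi_dist \<Omega> (f 0) (f w) \<le> 1" by (rule kobayashi_dist_le_disc [OF f nw])
  then have "kobayashi_dist \<Omega> (\<phi> z + s *\<^sub>R \<nu>) (\<phi> z0 + s *\<^sub>R \<nu>) \<le> 1"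
    using Metric_space.commute [OF ms, of "f 0" "f w"] by (simp add: fw) (simp add: f_def)
  moreover have "\<phi> z + s *\<^sub>R \<nu> \<in> \<Omega>" using Hol_discD(2) [OF f, of w] nw by (simp add: fw)
  moreover have "dist (\<phi> z + s *\<^sub>R \<nu>) (\<phi> z) < \<eta>" using s\<eta>(2) s(1) by (simp add: dist_norm)
  ultimately show "\<exists>x\<in>\<Omega>. \<exists>s. 0 < s \<and> s < \<eta> \<and> dist x (\<phi> z) < \<eta> \<and> kobayashi_dist \<Omega> x (\<phi> z0 + s *\<^sub>R \<nu>) \<le> 1"
    using s(1) s\<eta>(1) by blast
qed

section \<open>Constancy of holomorphic discs in the frontier\<close>

theorem theorem1p4:
  fixes \<Omega> :: "(complex^'d) set"
  assumes "open \<Omega>"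
    and "bounded \<Omega>"
    and "C_convex \<Omega>"
    and "C1_hypersurface (frontier \<Omega>)"
    and "Gromov_hyperbolic \<Omega> (kobayashi_dist \<Omega>)"
  shows "\<forall>\<phi> :: complex \<Rightarrow> complex^'d.
           holomorphic_map_on \<phi> (ball 0 1) \<and> \<phi> ` ball 0 1 \<subseteq> frontier \<Omega>
           \<longrightarrow> \<phi> constant_on ball 0 1"
proof (intro allI impI, rule ccontr)
  fix \<phi> :: "complex \<Rightarrow> complex^'d"
  assume \<phi>: "holomorphic_map_on \<phi> (ball 0 1) \<and> \<phi> ` ball 0 1 \<subseteq> frontier \<Omega>" and nc: "\<not> \<phi> constant_on ball 0 1"
  obtain \<delta> where ms: "Metric_space \<Omega> (kobayashi_dist \<Omega>)"
    and \<delta>: "Metric_space.delta_hyperbolic \<Omega> (kobayashi_dist \<Omega>) \<delta>" "0 \<le> \<delta>"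
    using assms(5) unfolding Gromov_hyperbolic_def by blast
  have fr: "\<phi> z \<in> frontier \<Omega>" if "z \<in> ball 0 1" for z using \<phi> that by blast
  \<comment> \<open>A non-constant map on a connected set fails to be locally constant at some
    \<open>z0\<close>, so values other than \<open>\<phi> z0\<close> persist in every smaller disc,
    in particular where the interior cones are uniform.\<close>
  have "\<exists>z0\<in>ball 0 1. \<forall>e>0. \<exists>z\<in>ball 0 1. dist z z0 < e \<and> \<phi> z \<noteq> \<phi> z0"
  proof (rule ccontr)
    assume neg: "\<not> ?thesis"
    have "\<phi> constant_on ball 0 1"
    proof (rule locally_constant_imp_constant)
      show "connected (ball 0 1 :: complex set)" by (rule connected_ball)
      fix z0 :: complex assume z0: "z0 \<in> ball 0 1"
      then obtain e where e: "0 < e" "\<And>z. z \<in> ball 0 1 \<Longrightarrow> dist z z0 < e \<Longrightarrow> \<phi> z = \<phi> z0" using neg by blast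
      show "\<exists>T. openin (top_of_set (ball 0 1)) T \<and> z0 \<in> T \<and> (\<forall>x\<in>T. \<phi> x = \<phi> z0)"
      proof (rule exI [of _ "ball 0 1 \<inter> ball z0 e"], intro conjI ballI)
        show "openin (top_of_set (ball 0 1)) (ball 0 1 \<inter> ball z0 e)" by (rule openin_open_Int [OF open_ball])
        show "z0 \<in> ball 0 1 \<inter> ball z0 e" using z0 e(1) by simp
        fix x assume "x \<in> ball 0 1 \<inter> ball z0 e"
        then show "\<phi> x = \<phi> z0" by (intro e(2)) (auto simp: dist_commute)
      qed
    qed
    then show False using nc by simp
  qed
  then obtain z0 where z0: "z0 \<in> ball 0 1" and nonconst: "\<And>e. 0 < e \<Longrightarrow> \<exists>z\<in>ball 0 1. dist z z0 < e \<and> \<phi> z \<noteq> \<phi> z0"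
    by blast
  define p where "p = \<phi> z0"
  have p: "p \<in> frontier \<Omega>" using fr z0 by (simp add: p_def)
  obtain r D \<nu> c t \<rho> where ct: "0 < c" "0 < t" and "0 < \<rho>"
    and side: "\<And>x. \<lbrakk>x \<in> frontier \<Omega>; dist x p < \<rho>\<rbrakk> \<Longrightarrow> truncated_cone x \<nu> c t \<subseteq> \<Omega>"
    by (rule C1_boundary_inner_side [OF assms(1,4) p]) (rule that)
  have cone: "truncated_cone p \<nu> c t \<subseteq> \<Omega>" using side [OF p] \<open>0 < \<rho>\<close> by simp
  have "continuous_on (ball 0 1) (\<lambda>z. \<chi> i. \<phi> z $ i)"
    by (intro continuous_on_vec_lambda holomorphic_on_imp_continuous_on) (use \<phi> in \<open>simp add: holomorphic_map_on_def\<close>)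
  then have "continuous_on (ball 0 1) \<phi>" by simp
  then obtain e1 where e1: "0 < e1" "\<And>z. z \<in> ball 0 1 \<Longrightarrow> dist z z0 < e1 \<Longrightarrow> dist (\<phi> z) p < \<rho>"
    using z0 \<open>0 < \<rho>\<close> unfolding continuous_on_iff p_def by blast
  obtain e2 where e2: "0 < e2" "ball z0 e2 \<subseteq> ball 0 1" using z0 open_ball open_contains_ball by metis
  define r0 where "r0 = min e1 e2"
  have r0: "0 < r0" "ball z0 r0 \<subseteq> ball 0 1" using e1 e2 by (auto simp: r0_def)
  have inside: "\<phi> z + s *\<^sub>R \<nu> \<in> \<Omega>" if "z \<in> ball z0 r0" "0 < s" "s < t" for z s
  proof -
    have z: "z \<in> ball 0 1" using that(1) r0(2) by blast
    have "dist (\<phi> z) p < \<rho>" using that(1) by (intro e1(2) z) (simp add: r0_def dist_commute)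
    then show ?thesis using side [OF fr [OF z]] truncated_cone_axis [OF ct(1) that(2), of t "\<phi> z" \<nu>] that(3) by auto
  qed
  have hol: "holomorphic_map_on \<phi> (ball z0 r0)"
    using \<phi> r0(2) by (auto simp: holomorphic_map_on_def intro: holomorphic_on_subset)
  obtain z1 where z1: "dist z1 z0 < r0 / 2" "\<phi> z1 \<noteq> p" using nonconst [of "r0 / 2"] r0(1) by (auto simp: p_def)
  let ?lim = "transversal_limit \<Omega> (\<lambda>s. p + s *\<^sub>R \<nu>)"
  have lim1: "?lim 1 (\<phi> z1)"
    unfolding p_def by (rule transversal_limit_along_disc [OF ms hol r0(1) ct(2) inside z1(1)])
  define Y where "Y = {q. \<exists>R. ?lim R q}"
  have Yfr: "Y \<subseteq> frontier \<Omega>"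
    unfolding Y_def using transversal_limit_frontier [OF ms assms(1,3,4) p cone ct] by blast
  have "closed Y"
  proof (rule closure_subset_eq [THEN iffD1], rule subsetI)
    fix q assume "q \<in> closure Y"
    then have q: "\<forall>e>0. \<exists>y\<in>Y. dist y q < e" by (simp add: closure_approachable)
    have "\<exists>R. ?lim R q"
      by (rule transversal_limits_closed [OF ms \<delta> assms(1,3,4) p cone ct]) (use q in \<open>unfold Y_def, blast\<close>)
    then show "q \<in> Y" by (simp add: Y_def)
  qed
  moreover have "bounded Y" by (rule bounded_subset [OF bounded_closure [OF assms(2)]]) (use Yfr in \<open>auto simp: frontier_def\<close>)
  ultimately have "compact Y" by (simp add: compact_eq_bounded_closed)
  \<comment> \<open>The conjugates turn the bilinear \<open>complex_dot\<close> into the Hermitian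
    product, so the functional increases from \<open>p\<close> to \<open>\<phi> z1\<close> by the
    square of their distance.\<close>
  define \<beta> where "\<beta> = (\<chi> i. cnj ((\<phi> z1 - p) $ i))"
  have "continuous_on Y (\<lambda>z. Re (complex_dot \<beta> z))" by (intro continuous_intros)
  moreover have "\<phi> z1 \<in> Y" using lim1 by (auto simp: Y_def)
  ultimately obtain q where q: "q \<in> Y" "\<And>y. y \<in> Y \<Longrightarrow> Re (complex_dot \<beta> y) \<le> Re (complex_dot \<beta> q)"
    using continuous_attains_sup [OF \<open>compact Y\<close>] by blast
  obtain R where R: "?lim R q" using q(1) by (auto simp: Y_def)
  have "0 < Re (complex_dot \<beta> (\<phi> z1 - p))"
  proof -
    have "complex_dot \<beta> (\<phi> z1 - p) = (\<Sum>i\<in>UNIV. complex_of_real ((cmod ((\<phi> z1 - p) $ i))\<^sup>2))"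
      unfolding complex_dot_def \<beta>_def by (rule sum.cong) (simp_all only: complex_norm_square vec_lambda_beta mult.commute)
    then have "Re (complex_dot \<beta> (\<phi> z1 - p)) = (\<Sum>i\<in>UNIV. (cmod ((\<phi> z1 - p) $ i))\<^sup>2)" by simp
    moreover obtain i where "(\<phi> z1 - p) $ i \<noteq> 0" using z1(2) by (auto simp: vec_eq_iff)
    ultimately show ?thesis by (simp add: sum_pos2 [of UNIV i])
  qed
  then have "Re (complex_dot \<beta> p) < Re (complex_dot \<beta> q)"
    using q(2) [OF \<open>\<phi> z1 \<in> Y\<close>] by (simp add: complex_dot_diff)
  moreover have "p + s *\<^sub>R \<nu> \<in> \<Omega>" if "0 < s" "s < t" for s
    using inside [of z0 s] r0(1) that by (simp add: p_def)
  ultimately show False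
    using transversal_limit_not_maximal [OF ms assms(1,2) ct(2) _ R] q(2) unfolding Y_def by blast
qed

end
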